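(* Let $\mathbf{x}:U\to\mathbb{R}^3$ be a proper frontal and $\mathbf{\Omega}$ a tangent moving basis of $\mathbf{x}$. If the normal curvature has a smooth extension and the extensions of the two principal curvatures are different at a singularity $p$, then there exist two families of curves (not necessarily regular) $\phi_1(t,q):J\times U_1\to U_2$, $\phi_2(t,q):J\times U_1\to U_2$, where $J$ is an open interval containing $0$ and $U_1,U_2$ are open sets of $\mathbb{R}^2$ with $p\in U_1\subset U_2\subset U$, satisfying the following: (i) $\phi_1$ and $\phi_2$ are smooth and $\phi_1(0,q)=\phi_2(0,q)=q$; (ii) for each fixed $q$, $t\mapsto\phi_1(t,q)$ and $t\mapsto\phi_2(t,q)$ are Gaussian lines of curvature of $\mathbf{x}$; (iii) for every $t_0\in J$ such that $\phi_i(t_0,q)\in\Sigma(\mathbf{x})^c$, we have $\phi_i'(t_0,q)\neq0$; and if $\phi_i(t_0,q)\in\Sigma(\mathbf{x})^c$ for $i=1,2$ simultaneously, then $\phi_1'(t_0,q)$ and $\phi_2'(t_0,q)$ are linearly independent. (Here $'$ is the derivative with respect to $t$.)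
   Context: All maps are $C^\infty$ and $U\subset\mathbb{R}^2$ is open. $D$ denotes the Jacobian matrix. A tangent moving basis (tmb) of $\mathbf{x}:U\to\mathbb{R}^3$ is a smooth map $\mathbf{\Omega}=(\mathbf{w}_1\ \mathbf{w}_2):U\to\mathcal{M}_{3\times2}(\mathbb{R})$ with columns linearly independent at every point and $\mathbf{x}_u,\mathbf{x}_v\in\mathrm{span}(\mathbf{w}_1,\mathbf{w}_2)$. The map $\mathbf{x}$ is a frontal if near each point there is a smooth unit vector field orthogonal to $\mathbf{x}_u,\mathbf{x}_v$; equivalently, tmbs exist locally, and a global tmb is always assumed. The normal field induced by $\mathbf{\Omega}$ is $\mathbf{n}=\frac{\mathbf{w}_1\times\mathbf{w}_2}{\|\mathbf{w}_1\times\mathbf{w}_2\|}$. $\Sigma(\mathbf{x})$ is the set of singularities, i.e. points where $\mathbf{x}$ is not immersive; the frontal is proper if $\Sigma(\mathbf{x})$ has empty interior. Set $\mathbf{I}=D\mathbf{x}^TD\mathbf{x}$, $\mathbf{II}=-D\mathbf{x}^TD\mathbf{n}$, $\mathbf{\Lambda}_\Omega=D\mathbf{x}^T\mathbf{\Omega}(\mathbf{\Omega}^T\mathbf{\Omega})^{-1}$. On $\Sigma(\mathbf{x})^c$, $K=\det\mathbf{II}/\det\mathbf{I}$ and $H=\frac12\mathrm{tr}(\mathbf{II}\,\mathbf{I}^{-1})$ are the Gaussian and mean curvatures, and $H\pm\sqrt{H^2-K}$ are the principal curvatures. The normal curvature at $p\in\Sigma(\mathbf{x})^c$ is $k_p(\zeta)=\frac{\zeta^T\mathbf{II}\zeta}{\zeta^T\mathbf{I}\zeta}$,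 $\zeta\in\mathbb{R}^2-\{0\}$; it has a smooth extension if $(p,\omega)\mapsto k_p(\mathbf{\Lambda}_\Omega^{-T}\omega)$ on $\Sigma(\mathbf{x})^c\times(\mathbb{R}^2-\{0\})$ has a smooth extension to $U\times(\mathbb{R}^2-\{0\})$. In that case $K$ and $H$ have smooth extensions to $U$, and the extensions of the principal curvatures are given by $H\pm\sqrt{H^2-K}$ with these extended $H,K$. A smooth curve $\gamma:J\to U$ ($J$ an open interval) is a Gaussian line of curvature of $\mathbf{x}$ if there exists a function $l:J\to\mathbb{R}$ such that $(\mathbf{n}\circ\gamma)'(t)=l(t)(\mathbf{x}\circ\gamma)'(t)$ for all $t\in J$. *)

theory Defs
  imports "HOL-Analysis.Analysis"
begin

text \<open>
  Iterated differentiability, meant for open \<open>S\<close>: \<open>f\<close> is of class \<open>C\<^sup>n\<close> iff it is differentiable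
  on \<open>S\<close> and all its directional derivatives are of class \<open>C\<close>^\<open>(n - 1)\<close> there. All sets on which
  smoothness is asserted below are open.
\<close>

fun Ck_on :: "nat \<Rightarrow> 'a::real_normed_vector set \<Rightarrow> ('a \<Rightarrow> 'b::real_normed_vector) \<Rightarrow> bool" where
  "Ck_on 0 S f \<longleftrightarrow> continuous_on S f"
| "Ck_on (Suc n) S f \<longleftrightarrow>
     (\<forall>x\<in>S. f differentiable (at x)) \<and>
     (\<forall>v. Ck_on n S (\<lambda>x. frechet_derivative f (at x) v))"

definition smooth_on :: "'a::real_normed_vector set \<Rightarrow> ('a \<Rightarrow> 'b::real_normed_vector) \<Rightarrow> bool" where
  "smooth_on S f \<longleftrightarrow> (\<forall>n. Ck_on n S f)"

definition smooth_extension_of ::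
    "'a::real_normed_vector set \<Rightarrow> 'a set \<Rightarrow> ('a \<Rightarrow> 'b::real_normed_vector) \<Rightarrow> ('a \<Rightarrow> 'b) \<Rightarrow> bool" where
  "smooth_extension_of T S f g \<longleftrightarrow> smooth_on T g \<and> (\<forall>x\<in>S. g x = f x)"

text \<open>
  The smooth extension of \<open>f\<close> from \<open>S\<close> to \<open>T\<close>. If one exists and \<open>T - S\<close> has empty interior,
  its values on \<open>T\<close> do not depend on the choice, see \<open>smooth_extension_unique\<close> below.
\<close>

definition smooth_extension ::
    "'a::real_normed_vector set \<Rightarrow> 'a set \<Rightarrow> ('a \<Rightarrow> 'b::real_normed_vector) \<Rightarrow> 'a \<Rightarrow> 'b" where
  "smooth_extension T S f = (SOME g. smooth_extension_of T S f g)"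

lemma smooth_extension_unique:
  assumes "open T" and "interior (T - S) = {}"
    and "smooth_extension_of T S f g" and "smooth_extension_of T S f h" and "x \<in> T"
  shows "g x = h x"
proof -
  have "Ck_on 0 T g" "Ck_on 0 T h"
    using assms(3,4) unfolding smooth_extension_of_def smooth_on_def by blast+
  then have "continuous_on T (\<lambda>y. g y - h y)"
    by (auto intro: continuous_on_diff)
  then have "open (T \<inter> (\<lambda>y. g y - h y) -` (- {0}))"
    using assms(1) by (meson continuous_open_preimage open_Compl closed_singleton)
  moreover have "T \<inter> (\<lambda>y. g y - h y) -` (- {0}) \<subseteq> T - S"
    using assms(3,4) by (auto simp: smooth_extension_of_def)
  ultimately have "T \<inter> (\<lambda>y. g y - h y) -` (- {0}) = {}"
    using assms(2) interior_maximal by blast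
  then show ?thesis
    using assms(5) by auto
qed

text \<open>The inequality matters: for \<open>v = w \<noteq> 0\<close> the set \<open>{v, w}\<close> is independent.\<close>

definition lin_indep_pair :: "'a::real_vector \<Rightarrow> 'a \<Rightarrow> bool" where
  "lin_indep_pair v w \<longleftrightarrow> v \<noteq> w \<and> independent {v, w}"

abbreviation Jac :: "(real^2 \<Rightarrow> real^3) \<Rightarrow> real^2 \<Rightarrow> real^2^3" where
  "Jac f q \<equiv> jacobian f (at q)"

definition singular_set :: "(real^2) set \<Rightarrow> (real^2 \<Rightarrow> real^3) \<Rightarrow> (real^2) set" where
  "singular_set U x = {q \<in> U. \<not> inj (frechet_derivative x (at q))}"

definition frontal :: "(real^2) set \<Rightarrow> (real^2 \<Rightarrow> real^3) \<Rightarrow> bool" where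
  "frontal U x \<longleftrightarrow> smooth_on U x \<and>
     (\<forall>q\<in>U. \<exists>V \<nu> :: real^2 \<Rightarrow> real^3. open V \<and> q \<in> V \<and> V \<subseteq> U \<and> smooth_on V \<nu> \<and>
        (\<forall>r\<in>V. norm (\<nu> r) = 1 \<and> \<nu> r \<bullet> column 1 (Jac x r) = 0 \<and> \<nu> r \<bullet> column 2 (Jac x r) = 0))"

definition proper_frontal :: "(real^2) set \<Rightarrow> (real^2 \<Rightarrow> real^3) \<Rightarrow> bool" where
  "proper_frontal U x \<longleftrightarrow> frontal U x \<and> interior (singular_set U x) = {}"

definition tangent_moving_basis ::
    "(real^2) set \<Rightarrow> (real^2 \<Rightarrow> real^3) \<Rightarrow> (real^2 \<Rightarrow> real^2^3) \<Rightarrow> bool" where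
  "tangent_moving_basis U x \<Omega> \<longleftrightarrow> smooth_on U \<Omega> \<and>
     (\<forall>q\<in>U. lin_indep_pair (column 1 (\<Omega> q)) (column 2 (\<Omega> q)) \<and>
            column 1 (Jac x q) \<in> span {column 1 (\<Omega> q), column 2 (\<Omega> q)} \<and>
            column 2 (Jac x q) \<in> span {column 1 (\<Omega> q), column 2 (\<Omega> q)})"

definition normal_field :: "(real^2 \<Rightarrow> real^2^3) \<Rightarrow> real^2 \<Rightarrow> real^3" where
  "normal_field \<Omega> q =
     (let N = cross3 (column 1 (\<Omega> q)) (column 2 (\<Omega> q)) in (1 / norm N) *\<^sub>R N)"

definition first_form :: "(real^2 \<Rightarrow> real^3) \<Rightarrow> real^2 \<Rightarrow> real^2^2" where
  "first_form x q = transpose (Jac x q) ** Jac x q"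

definition second_form :: "(real^2 \<Rightarrow> real^3) \<Rightarrow> (real^2 \<Rightarrow> real^2^3) \<Rightarrow> real^2 \<Rightarrow> real^2^2" where
  "second_form x \<Omega> q = - (transpose (Jac x q) ** Jac (normal_field \<Omega>) q)"

definition Lambda :: "(real^2 \<Rightarrow> real^3) \<Rightarrow> (real^2 \<Rightarrow> real^2^3) \<Rightarrow> real^2 \<Rightarrow> real^2^2" where
  "Lambda x \<Omega> q =
     transpose (Jac x q) ** \<Omega> q ** matrix_inv (transpose (\<Omega> q) ** \<Omega> q)"

definition gauss_curvature :: "(real^2 \<Rightarrow> real^3) \<Rightarrow> (real^2 \<Rightarrow> real^2^3) \<Rightarrow> real^2 \<Rightarrow> real" where
  "gauss_curvature x \<Omega> q = det (second_form x \<Omega> q) / det (first_form x q)"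

definition mean_curvature :: "(real^2 \<Rightarrow> real^3) \<Rightarrow> (real^2 \<Rightarrow> real^2^3) \<Rightarrow> real^2 \<Rightarrow> real" where
  "mean_curvature x \<Omega> q = 1 / 2 * trace (second_form x \<Omega> q ** matrix_inv (first_form x q))"

definition normal_curvature ::
    "(real^2 \<Rightarrow> real^3) \<Rightarrow> (real^2 \<Rightarrow> real^2^3) \<Rightarrow> real^2 \<Rightarrow> real^2 \<Rightarrow> real" where
  "normal_curvature x \<Omega> q \<zeta> =
     (\<zeta> \<bullet> (second_form x \<Omega> q *v \<zeta>)) / (\<zeta> \<bullet> (first_form x q *v \<zeta>))"

definition normal_curvature_extends ::
    "(real^2) set \<Rightarrow> (real^2 \<Rightarrow> real^3) \<Rightarrow> (real^2 \<Rightarrow> real^2^3) \<Rightarrow> bool" where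
  "normal_curvature_extends U x \<Omega> \<longleftrightarrow>
     (\<exists>k. smooth_extension_of (U \<times> (UNIV - {0})) ((U - singular_set U x) \<times> (UNIV - {0}))
            (\<lambda>(q, \<omega>). normal_curvature x \<Omega> q (matrix_inv (transpose (Lambda x \<Omega> q)) *v \<omega>)) k)"

definition gauss_curvature_ext ::
    "(real^2) set \<Rightarrow> (real^2 \<Rightarrow> real^3) \<Rightarrow> (real^2 \<Rightarrow> real^2^3) \<Rightarrow> real^2 \<Rightarrow> real" where
  "gauss_curvature_ext U x \<Omega> = smooth_extension U (U - singular_set U x) (gauss_curvature x \<Omega>)"

definition mean_curvature_ext ::
    "(real^2) set \<Rightarrow> (real^2 \<Rightarrow> real^3) \<Rightarrow> (real^2 \<Rightarrow> real^2^3) \<Rightarrow> real^2 \<Rightarrow> real" where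
  "mean_curvature_ext U x \<Omega> = smooth_extension U (U - singular_set U x) (mean_curvature x \<Omega>)"

definition principal_curvature_ext_minus ::
    "(real^2) set \<Rightarrow> (real^2 \<Rightarrow> real^3) \<Rightarrow> (real^2 \<Rightarrow> real^2^3) \<Rightarrow> real^2 \<Rightarrow> real" where
  "principal_curvature_ext_minus U x \<Omega> q = mean_curvature_ext U x \<Omega> q
     - sqrt ((mean_curvature_ext U x \<Omega> q)\<^sup>2 - gauss_curvature_ext U x \<Omega> q)"

definition principal_curvature_ext_plus ::
    "(real^2) set \<Rightarrow> (real^2 \<Rightarrow> real^3) \<Rightarrow> (real^2 \<Rightarrow> real^2^3) \<Rightarrow> real^2 \<Rightarrow> real" where
  "principal_curvature_ext_plus U x \<Omega> q = mean_curvature_ext U x \<Omega> q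
     + sqrt ((mean_curvature_ext U x \<Omega> q)\<^sup>2 - gauss_curvature_ext U x \<Omega> q)"

definition gaussian_line_of_curvature ::
    "(real^2) set \<Rightarrow> (real^2 \<Rightarrow> real^3) \<Rightarrow> (real^2 \<Rightarrow> real^2^3) \<Rightarrow> real set \<Rightarrow> (real \<Rightarrow> real^2) \<Rightarrow> bool" where
  "gaussian_line_of_curvature U x \<Omega> J \<gamma> \<longleftrightarrow>
     open J \<and> is_interval J \<and> smooth_on J \<gamma> \<and> \<gamma> ` J \<subseteq> U \<and>
     (\<exists>l :: real \<Rightarrow> real. \<forall>t\<in>J.
        vector_derivative (normal_field \<Omega> \<circ> \<gamma>) (at t) = l t *\<^sub>R vector_derivative (x \<circ> \<gamma>) (at t))"

end

theory Submission
  imports Defs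
begin

text \<open>
  The normal field \<open>n\<close> and the frame \<open>\<Omega>\<close> give \<open>Dx = \<Omega> L\<close> and \<open>Dn = \<Omega> M\<close> on all of \<open>U\<close>, where \<open>L\<close> is
  the transpose of \<open>\<Lambda>\<close>. At regular points \<open>L\<close> is invertible and \<open>M = - A L\<close>, where \<open>A\<close> is the matrix
  of the shape operator in the frame. Substituting \<open>\<omega> = L \<zeta>\<close> turns the normal curvature into the
  quotient of the quadratic form of \<open>G A\<close>, with \<open>G = \<Omega>\<^sup>T \<Omega>\<close>, by the definite form \<open>G\<close>. A smooth extension
  of the normal curvature therefore yields, by polarization, a smooth extension of \<open>A\<close> across the
  singularities. The relation \<open>M = - A L\<close> persists by density, and \<open>det A\<close> and \<open>tr A / 2\<close> are the
  extended Gaussian and mean curvatures (\<open>smooth_shape_operator\<close>). So distinct principal curvatures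
  at \<open>p\<close> mean that \<open>A p\<close> has distinct real eigenvalues, and \<open>A\<close> has smooth independent eigenvector
  fields \<open>\<omega>1\<close>, \<open>\<omega>2\<close> near \<open>p\<close> (\<open>smooth_eigenvectors\<close>).

  A curve \<open>\<gamma>\<close> is a Gaussian line of curvature as soon as \<open>L \<gamma>'\<close> is everywhere an eigenvector of \<open>A\<close>
  or zero (\<open>principal_curve_gaussian_line\<close>). Although \<open>L X = \<omega>i\<close> cannot be solved at singularities,
  the adjugate of \<open>L\<close> gives smooth fields \<open>Xi = adj L \<omega>i\<close> with \<open>L Xi = D \<omega>i\<close>, where \<open>D = det L\<close>. The
  integral curves of \<open>Xi\<close>, or of any multiple of it, are Gaussian lines of curvature.

  The velocities to be independent belong to two different points \<open>\<phi>1 (t, q)\<close> and \<open>\<phi>2 (t, q)\<close>, and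
  the determinant of \<open>X1\<close> and \<open>X2\<close> is \<open>D\<close> times a nonvanishing function, so it is not bounded below near
  \<open>p\<close>. For this reason \<open>\<phi>i\<close> is chosen as the flow of \<open>D Xi\<close> instead of \<open>Xi\<close>. Along such a flow \<open>D\<close>
  at most doubles in a short time \<open>\<epsilon>\<close>, so both curves stay within distance \<open>O(\<epsilon> \<bar>D q\<bar>)\<close> of \<open>q\<close>. Then
  the determinant changes by at most \<open>O(\<epsilon> \<bar>D q\<bar>)\<close>, which for small \<open>\<epsilon>\<close> is less than its absolute value
  at \<open>q\<close> (\<open>transversal_flows\<close>).

  The flows are smooth in time and starting point together (\<open>smooth_local_flow\<close>). Picard iteration in
  a space of functions of time and parameter gives a jointly continuous solution. Its derivatives
  with respect to the parameter solve the linearised equation, which has the same form, so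
  smoothness follows by induction on the order of differentiability (\<open>ode_solution_Ck\<close>).
\<close>

section \<open>Calculus of \<open>C\<^sup>n\<close> maps\<close>

lemma Ck_on_cong:
  assumes "open S" and "\<And>x. x \<in> S \<Longrightarrow> f x = g x"
  shows "Ck_on n S f \<longleftrightarrow> Ck_on n S g"
  using assms(2)
proof (induction n arbitrary: f g)
  case 0
  then show ?case by (simp cong: continuous_on_cong)
next
  case (Suc n)
  have d: "f differentiable (at x) \<longleftrightarrow> g differentiable (at x)" if "x \<in> S" for x
    unfolding differentiable_def
    using has_derivative_transform_within_open[OF _ \<open>open S\<close> that] Suc.prems by metis
  show ?case
  proof (cases "\<forall>x\<in>S. f differentiable (at x)")
    case True
    then have "frechet_derivative f (at x) v = frechet_derivative g (at x) v" if "x \<in> S" for x v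
      using frechet_derivative_transform_within_open[OF _ \<open>open S\<close> that] Suc.prems that by metis
    then have "Ck_on n S (\<lambda>x. frechet_derivative f (at x) v) \<longleftrightarrow> Ck_on n S (\<lambda>x. frechet_derivative g (at x) v)" for v
      by (rule Suc.IH)
    then show ?thesis using d by auto
  qed (use d in auto)
qed

text \<open>
  The working form of the recursive clause: any explicit derivative \<open>f'\<close> may be supplied. Closure
  properties then follow by induction, since the usual differentiation rules express \<open>f'\<close> through
  functions already known to be of class \<open>C\<^sup>n\<close>.
\<close>

lemma Ck_on_SucI:
  assumes "open S" and "\<And>x. x \<in> S \<Longrightarrow> (f has_derivative f' x) (at x)"
    and "\<And>v. Ck_on n S (\<lambda>x. f' x v)"
  shows "Ck_on (Suc n) S f"
proof -
  have "frechet_derivative f (at x) v = f' x v" if "x \<in> S" for x v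
    using frechet_derivative_at[OF assms(2)[OF that]] by simp
  then have "Ck_on n S (\<lambda>x. frechet_derivative f (at x) v)" for v
    using Ck_on_cong[OF assms(1), of "\<lambda>x. frechet_derivative f (at x) v" "\<lambda>x. f' x v"] assms(3) by blast
  then show ?thesis using assms(2) by (auto simp: differentiable_def)
qed

lemma Ck_on_subset: "Ck_on n S f \<Longrightarrow> T \<subseteq> S \<Longrightarrow> Ck_on n T f"
  by (induction n arbitrary: f) (auto intro: continuous_on_subset)

lemma Ck_on_SucD: "Ck_on (Suc n) S f \<Longrightarrow> Ck_on n S f"
proof (induction n arbitrary: f)
  case 0
  then show ?case
    by (auto intro!: differentiable_imp_continuous_on simp: differentiable_on_def
        differentiable_at_withinI)
qed auto

lemma Ck_on_continuous: "Ck_on n S f \<Longrightarrow> continuous_on S f"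
  by (induction n) (simp, metis Ck_on_SucD)

lemma Ck_on_has_derivative:
  "Ck_on (Suc n) S f \<Longrightarrow> x \<in> S \<Longrightarrow> (f has_derivative frechet_derivative f (at x)) (at x)"
  by (simp add: frechet_derivative_works)

text \<open>
  Solutions of differential equations are differentiated on small product neighbourhoods of each
  point only; this lemma glues the results.
\<close>

lemma Ck_on_local:
  assumes "\<And>x. x \<in> S \<Longrightarrow> \<exists>V. open V \<and> x \<in> V \<and> Ck_on n V f"
  shows "Ck_on n S f"
  using assms
proof (induction n arbitrary: f)
  case 0
  show ?case
    unfolding Ck_on.simps
  proof (rule continuous_at_imp_continuous_on, rule ballI)
    fix x assume "x \<in> S"
    then obtain V where "open V" "x \<in> V" "continuous_on V f" using 0 by auto
    then show "isCont f x" by (simp add: continuous_on_eq_continuous_at)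
  qed
next
  case (Suc n)
  have "f differentiable at x" if "x \<in> S" for x
    using Suc.prems[OF that] by auto
  moreover have "Ck_on n S (\<lambda>x. frechet_derivative f (at x) v)" for v
  proof (rule Suc.IH)
    fix x assume "x \<in> S"
    from Suc.prems[OF this] show "\<exists>V. open V \<and> x \<in> V \<and> Ck_on n V (\<lambda>x. frechet_derivative f (at x) v)"
      by auto
  qed
  ultimately show ?case by simp
qed

lemma Ck_on_const: "Ck_on n S (\<lambda>x. c)"
  by (induction n arbitrary: c) (auto intro: continuous_intros)

lemma Ck_on_bounded_linear:
  assumes "bounded_linear L" "open S"
  shows "Ck_on n S L"
proof (cases n)
  case 0
  then show ?thesis using assms by (simp add: linear_continuous_on)
next
  case (Suc m)
  show ?thesis unfolding Suc
    by (rule Ck_on_SucI[OF assms(2)])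
       (auto intro: bounded_linear_imp_has_derivative assms Ck_on_const)
qed

lemma Ck_on_bounded_linear_compose:
  assumes "bounded_linear L" "open S" "Ck_on n S f"
  shows "Ck_on n S (\<lambda>x. L (f x))"
  using assms(3)
proof (induction n arbitrary: f)
  case 0
  then show ?case
    using bounded_linear.continuous_on[OF assms(1)] by auto
next
  case (Suc n)
  show ?case
  proof (rule Ck_on_SucI[OF assms(2)])
    show "((\<lambda>x. L (f x)) has_derivative (\<lambda>v. L (frechet_derivative f (at x) v))) (at x)"
      if "x \<in> S" for x
      by (rule bounded_linear.has_derivative[OF assms(1) Ck_on_has_derivative[OF Suc.prems that]])
  qed (use Suc in auto)
qed

lemma Ck_on_add:
  assumes "open S" "Ck_on n S f" "Ck_on n S g"
  shows "Ck_on n S (\<lambda>x. f x + g x)"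
  using assms(2,3)
proof (induction n arbitrary: f g)
  case 0
  then show ?case by (auto intro: continuous_intros)
next
  case (Suc n)
  show ?case
  proof (rule Ck_on_SucI[OF assms(1)])
    show "((\<lambda>x. f x + g x) has_derivative
        (\<lambda>v. frechet_derivative f (at x) v + frechet_derivative g (at x) v)) (at x)" if "x \<in> S" for x
      by (intro has_derivative_add Ck_on_has_derivative[OF Suc.prems(1) that]
          Ck_on_has_derivative[OF Suc.prems(2) that])
  qed (use Suc in auto)
qed

lemma Ck_on_sum:
  assumes "open S" "\<And>i. i \<in> I \<Longrightarrow> Ck_on n S (f i)"
  shows "Ck_on n S (\<lambda>x. \<Sum>i\<in>I. f i x)"
  using assms(2) by (induction I rule: infinite_finite_induct)
    (auto intro: Ck_on_const Ck_on_add assms(1))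

text \<open>One product rule covers products, scalings and inner products alike.\<close>

lemma Ck_on_bilinear:
  assumes B: "bounded_bilinear B" and "open S" "Ck_on n S f" "Ck_on n S g"
  shows "Ck_on n S (\<lambda>x. B (f x) (g x))"
  using assms(3,4)
proof (induction n arbitrary: f g)
  case 0
  then show ?case
    using bounded_bilinear.continuous_on[OF B] by auto
next
  case (Suc n)
  show ?case
  proof (rule Ck_on_SucI[OF assms(2)])
    show "((\<lambda>x. B (f x) (g x)) has_derivative
        (\<lambda>v. B (f x) (frechet_derivative g (at x) v) + B (frechet_derivative f (at x) v) (g x))) (at x)"
      if "x \<in> S" for x
      by (rule bounded_bilinear.FDERIV[OF B]) (use Suc.prems Ck_on_has_derivative that in blast)+
    show "Ck_on n S (\<lambda>x. B (f x) (frechet_derivative g (at x) v) + B (frechet_derivative f (at x) v) (g x))" for v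
      using Suc.prems Suc.prems[THEN Ck_on_SucD] by (intro Ck_on_add[OF assms(2)] Suc.IH) auto
  qed
qed

lemma has_derivative_componentwise_sum:
  fixes f' :: "'a::euclidean_space \<Rightarrow> 'b::real_normed_vector"
  assumes "(f has_derivative f') F"
  shows "f' v = (\<Sum>i\<in>Basis. (v \<bullet> i) *\<^sub>R f' i)"
proof -
  interpret bounded_linear f' by (rule has_derivative_bounded_linear[OF assms])
  show ?thesis by (subst euclidean_representation[of v, symmetric]) (simp add: sum scale)
qed

text \<open>
  The chain rule differentiates \<open>g\<close> in a direction that depends on the point, whereas \<open>Ck_on\<close> speaks
  of fixed directions. Expanding the direction in a basis reconciles the two.
\<close>

lemma Ck_on_compose:
  fixes f :: "'a::real_normed_vector \<Rightarrow> 'b::euclidean_space"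
  assumes "open S" "open T" "f ` S \<subseteq> T" "Ck_on n S f" "Ck_on n T g"
  shows "Ck_on n S (\<lambda>x. g (f x))"
  using assms(4,5)
proof (induction n arbitrary: g)
  case 0
  then show ?case using assms(3) by (auto intro: continuous_on_compose2)
next
  case (Suc n)
  show ?case
  proof (rule Ck_on_SucI[OF assms(1)])
    fix x assume x: "x \<in> S"
    have df: "(f has_derivative frechet_derivative f (at x)) (at x)"
      using Suc.prems x Ck_on_has_derivative by blast
    have dg: "(g has_derivative frechet_derivative g (at (f x))) (at (f x))"
      using Suc.prems x assms(3) Ck_on_has_derivative by blast
    show "((\<lambda>x. g (f x)) has_derivative
      (\<lambda>v. \<Sum>i\<in>Basis. (frechet_derivative f (at x) v \<bullet> i) *\<^sub>R frechet_derivative g (at (f x)) i)) (at x)"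
      using diff_chain_at[OF df dg]
      unfolding o_def has_derivative_componentwise_sum[OF dg, of "frechet_derivative f (at x) v" for v] .
  next
    fix v
    have "Ck_on n S (\<lambda>x. frechet_derivative f (at x) v)" using Suc.prems by simp
    moreover have "Ck_on n S (\<lambda>x. frechet_derivative g (at (f x)) i)" for i
      using Suc.IH[of "\<lambda>y. frechet_derivative g (at y) i"] Suc.prems Ck_on_SucD by auto
    ultimately show "Ck_on n S (\<lambda>x. \<Sum>i\<in>Basis. (frechet_derivative f (at x) v \<bullet> i) *\<^sub>R frechet_derivative g (at (f x)) i)"
      by (intro Ck_on_sum Ck_on_bilinear[OF bounded_bilinear_scaleR] Ck_on_bounded_linear_compose[OF bounded_linear_inner_left]
          assms)
  qed
qed

lemma Ck_on_Pair:
  assumes "open S" "Ck_on n S f" "Ck_on n S g"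
  shows "Ck_on n S (\<lambda>x. (f x, g x))"
proof -
  have "Ck_on n S (\<lambda>x. (f x, 0) + (0, g x))"
    by (intro Ck_on_add assms Ck_on_bounded_linear_compose[where L="\<lambda>y. (y, 0)"]
        Ck_on_bounded_linear_compose[where L="\<lambda>y. (0, y)"] bounded_linear_Pair
        bounded_linear_ident bounded_linear_zero)
  then show ?thesis by simp
qed

text \<open>
  The derivative of \<open>inverse\<close> is a polynomial in \<open>inverse\<close>, so each order of differentiability gives
  the next. The square root is treated in the same way.
\<close>

lemma Ck_on_inverse:
  fixes S :: "real set"
  assumes "open S" "0 \<notin> S"
  shows "Ck_on n S inverse"
proof (induction n)
  case 0
  then show ?case using assms by (auto intro!: continuous_on_inverse continuous_intros)
next
  case (Suc n)
  show ?case
  proof (rule Ck_on_SucI[OF assms(1)])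
    show "(inverse has_derivative (\<lambda>v. - (inverse x * inverse x) * v)) (at x)" if "x \<in> S" for x :: real
      using that assms(2) by (auto intro!: derivative_eq_intros)
    have "Ck_on n S (\<lambda>x. (- v) * (inverse x * inverse x))" for v
      by (intro Ck_on_bilinear[OF bounded_bilinear_mult] assms Suc Ck_on_const)
    then show "Ck_on n S (\<lambda>x. - (inverse x * inverse x) * v)" for v
      by (simp add: mult.commute)
  qed
qed

lemma Ck_on_sqrt: "Ck_on n {0<..} sqrt"
proof (induction n)
  case 0
  then show ?case by (auto intro: continuous_intros)
next
  case (Suc n)
  show ?case
  proof (rule Ck_on_SucI)
    show "(sqrt has_derivative (\<lambda>v. (v / 2) * inverse (sqrt x))) (at x)" if "x \<in> {0<..}" for x
      using that DERIV_real_sqrt[of x] by (auto simp: has_field_derivative_def mult.commute field_simps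
          elim!: has_derivative_eq_rhs)
    show "Ck_on n {0<..} (\<lambda>x. v / 2 * inverse (sqrt x))" for v
      by (intro Ck_on_bilinear[OF bounded_bilinear_mult] Ck_on_const open_greaterThan
          Ck_on_compose[OF _ _ _ Suc Ck_on_inverse[of "{0<..}"]]) auto
  qed simp
qed

lemma smooth_on_cong: "open S \<Longrightarrow> (\<And>x. x \<in> S \<Longrightarrow> f x = g x) \<Longrightarrow> smooth_on S f \<longleftrightarrow> smooth_on S g"
  unfolding smooth_on_def by (metis Ck_on_cong)

lemma smooth_on_subset: "smooth_on S f \<Longrightarrow> T \<subseteq> S \<Longrightarrow> smooth_on T f"
  unfolding smooth_on_def by (metis Ck_on_subset)

lemma smooth_on_continuous: "smooth_on S f \<Longrightarrow> continuous_on S f"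
  unfolding smooth_on_def by (metis Ck_on_continuous)

lemma smooth_on_differentiable: "smooth_on S f \<Longrightarrow> x \<in> S \<Longrightarrow> f differentiable (at x)"
  unfolding smooth_on_def by (metis Ck_on.simps(2))

lemma smooth_on_has_derivative:
  "smooth_on S f \<Longrightarrow> x \<in> S \<Longrightarrow> (f has_derivative frechet_derivative f (at x)) (at x)"
  using frechet_derivative_works smooth_on_differentiable by metis

lemma smooth_on_frechet_derivative: "smooth_on S f \<Longrightarrow> smooth_on S (\<lambda>x. frechet_derivative f (at x) v)"
  unfolding smooth_on_def by (metis Ck_on.simps(2))

lemma smooth_on_const: "smooth_on S (\<lambda>x. c)"
  unfolding smooth_on_def by (intro allI Ck_on_const)

lemma smooth_on_bounded_linear: "bounded_linear L \<Longrightarrow> open S \<Longrightarrow> smooth_on S L"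
  unfolding smooth_on_def by (rule allI, rule Ck_on_bounded_linear) auto

lemma smooth_on_bounded_linear_compose:
  "bounded_linear L \<Longrightarrow> open S \<Longrightarrow> smooth_on S f \<Longrightarrow> smooth_on S (\<lambda>x. L (f x))"
  unfolding smooth_on_def by (rule allI, rule Ck_on_bounded_linear_compose) auto

lemma smooth_on_add:
  "open S \<Longrightarrow> smooth_on S f \<Longrightarrow> smooth_on S g \<Longrightarrow> smooth_on S (\<lambda>x. f x + g x)"
  unfolding smooth_on_def by (rule allI, rule Ck_on_add) auto

lemma smooth_on_uminus: "open S \<Longrightarrow> smooth_on S f \<Longrightarrow> smooth_on S (\<lambda>x. - f x)"
  by (rule smooth_on_bounded_linear_compose[OF bounded_linear_minus[OF bounded_linear_ident]])

lemma smooth_on_diff: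
  "open S \<Longrightarrow> smooth_on S f \<Longrightarrow> smooth_on S g \<Longrightarrow> smooth_on S (\<lambda>x. f x - g x)"
  using smooth_on_add[of S f "\<lambda>x. - g x"] smooth_on_uminus[of S g] by simp

lemma smooth_on_sum:
  "open S \<Longrightarrow> (\<And>i. i \<in> I \<Longrightarrow> smooth_on S (f i)) \<Longrightarrow> smooth_on S (\<lambda>x. \<Sum>i\<in>I. f i x)"
  unfolding smooth_on_def by (rule allI, rule Ck_on_sum) auto

lemma smooth_on_bilinear:
  "bounded_bilinear B \<Longrightarrow> open S \<Longrightarrow> smooth_on S f \<Longrightarrow> smooth_on S g \<Longrightarrow> smooth_on S (\<lambda>x. B (f x) (g x))"
  unfolding smooth_on_def by (rule allI, rule Ck_on_bilinear) auto

lemmas smooth_on_mult = smooth_on_bilinear[OF bounded_bilinear_mult]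
  and smooth_on_scaleR = smooth_on_bilinear[OF bounded_bilinear_scaleR]
  and smooth_on_inner = smooth_on_bilinear[OF bounded_bilinear_inner]

lemma smooth_on_compose:
  fixes f :: "'a::real_normed_vector \<Rightarrow> 'b::euclidean_space"
  shows "open S \<Longrightarrow> open T \<Longrightarrow> f ` S \<subseteq> T \<Longrightarrow> smooth_on S f \<Longrightarrow> smooth_on T g \<Longrightarrow> smooth_on S (\<lambda>x. g (f x))"
  unfolding smooth_on_def by (rule allI, rule Ck_on_compose[of S T]) auto

lemma smooth_on_Pair:
  "open S \<Longrightarrow> smooth_on S f \<Longrightarrow> smooth_on S g \<Longrightarrow> smooth_on S (\<lambda>x. (f x, g x))"
  unfolding smooth_on_def by (rule allI, rule Ck_on_Pair) auto

lemma smooth_on_divide: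
  fixes f g :: "'a::real_normed_vector \<Rightarrow> real"
  assumes "open S" "smooth_on S f" "smooth_on S g" "\<And>x. x \<in> S \<Longrightarrow> g x \<noteq> 0"
  shows "smooth_on S (\<lambda>x. f x / g x)"
proof -
  have *: "open (- {0::real})" by (rule open_Compl) simp
  have inv: "smooth_on (- {0::real}) inverse"
    unfolding smooth_on_def using Ck_on_inverse[OF *] by simp
  have sub: "g ` S \<subseteq> - {0}" by (rule image_subsetI) (simp add: assms(4))
  have "smooth_on S (\<lambda>x. inverse (g x))"
    by (rule smooth_on_compose[OF assms(1) * sub assms(3) inv])
  then show ?thesis
    unfolding divide_inverse by (rule smooth_on_mult[OF assms(1,2)])
qed

lemma smooth_on_sqrt:
  assumes "open S" "smooth_on S f" "\<And>x. x \<in> S \<Longrightarrow> 0 < f x"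
  shows "smooth_on S (\<lambda>x. sqrt (f x))"
proof -
  have sq: "smooth_on {0<..} sqrt"
    unfolding smooth_on_def using Ck_on_sqrt by blast
  have sub: "f ` S \<subseteq> {0<..}" using assms(3) by auto
  show ?thesis
    by (rule smooth_on_compose[OF assms(1) open_greaterThan sub assms(2) sq])
qed

lemma smooth_on_vec_nth: "open S \<Longrightarrow> smooth_on S f \<Longrightarrow> smooth_on S (\<lambda>x. f x $ i)"
  by (rule smooth_on_bounded_linear_compose[OF bounded_linear_vec_nth])

lemma smooth_on_vecI:
  fixes f :: "'a::real_normed_vector \<Rightarrow> 'b::euclidean_space ^ 'n"
  assumes "open S" "\<And>i. smooth_on S (\<lambda>x. f x $ i)"
  shows "smooth_on S f"
proof -
  have *: "bounded_linear (\<lambda>y. axis i y :: 'b ^ 'n)" for i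
    unfolding linear_conv_bounded_linear[symmetric]
    by (rule linearI) (simp_all add: axis_def vec_eq_iff)
  have "smooth_on S (\<lambda>x. \<Sum>i\<in>UNIV. axis i (f x $ i))"
    by (rule smooth_on_sum[OF assms(1)], rule smooth_on_bounded_linear_compose[OF * assms])
  moreover have "(\<Sum>i\<in>UNIV. axis i (f x $ i)) = f x" for x
    by (simp add: vec_eq_iff axis_def if_distrib[of "\<lambda>f. f $ _"] sum.delta cong: if_cong)
  ultimately show ?thesis by simp
qed

section \<open>Families of solutions of differential equations\<close>

text \<open>
  Gronwall's inequality without the exponential, on an interval so short that \<open>L * \<delta> \<le> 1/2\<close>: by the
  mean value inequality the maximum of \<open>norm (w t)\<close> is at most \<open>norm (w 0) + \<delta> * c\<close> plus half of
  itself.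
\<close>

lemma short_time_estimate:
  fixes w :: "real \<Rightarrow> 'a::real_normed_vector"
  assumes "0 \<le> \<delta>" "0 \<le> L" "L * \<delta> \<le> 1/2" "0 \<le> c"
    and der: "\<And>s. s \<in> {-\<delta>..\<delta>} \<Longrightarrow> (w has_vector_derivative w' s) (at s)"
    and le: "\<And>s. s \<in> {-\<delta>..\<delta>} \<Longrightarrow> norm (w' s) \<le> L * norm (w s) + c"
    and t: "t \<in> {-\<delta>..\<delta>}"
  shows "norm (w t) \<le> 2 * (norm (w 0) + \<delta> * c)"
proof -
  have "continuous_on {-\<delta>..\<delta>} (\<lambda>s. norm (w s))"
    by (intro continuous_on_norm continuous_at_imp_continuous_on ballI has_vector_derivative_continuous[OF der])
  then obtain m where m: "m \<in> {-\<delta>..\<delta>}" "\<And>s. s \<in> {-\<delta>..\<delta>} \<Longrightarrow> norm (w s) \<le> norm (w m)"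
    using continuous_attains_sup[of "{-\<delta>..\<delta>}" "\<lambda>s. norm (w s)"] assms(1) by auto
  have "norm (w m - w 0) \<le> (L * norm (w m) + c) * norm (m - 0)"
  proof (rule differentiable_bound[of "{-\<delta>..\<delta>}"])
    show "(w has_derivative (\<lambda>h. h *\<^sub>R w' s)) (at s within {-\<delta>..\<delta>})" if "s \<in> {-\<delta>..\<delta>}" for s
      using der[OF that] unfolding has_vector_derivative_def by (rule has_derivative_at_withinI)
    show "onorm (\<lambda>h. h *\<^sub>R w' s) \<le> L * norm (w m) + c" if "s \<in> {-\<delta>..\<delta>}" for s
    proof (rule onorm_bound)
      have *: "norm (w' s) \<le> L * norm (w m) + c"
        using le[OF that] mult_left_mono[OF m(2)[OF that] assms(2)] by linarith
      show "0 \<le> L * norm (w m) + c" using assms by simp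
      show "norm (h *\<^sub>R w' s) \<le> (L * norm (w m) + c) * norm h" for h
        using mult_right_mono[OF *, of "\<bar>h\<bar>"] by (simp add: mult.commute)
    qed
  qed (use assms(1) m in auto)
  also have "\<dots> \<le> (L * norm (w m) + c) * \<delta>"
    using m(1) assms by (intro mult_left_mono) auto
  also have "\<dots> = (L * \<delta>) * norm (w m) + \<delta> * c" by (simp add: algebra_simps)
  also have "\<dots> \<le> 1/2 * norm (w m) + \<delta> * c"
    using mult_right_mono[OF assms(3), of "norm (w m)"] by simp
  finally have "norm (w m) \<le> 2 * (norm (w 0) + \<delta> * c)"
    using norm_triangle_ineq2[of "w m" "w 0"] by simp
  with m(2)[OF t] show ?thesis by linarith
qed

text \<open>
  The equation is solved for all parameters at once. The Picard operator is a contraction of the space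
  of bounded continuous functions of \<open>(t, q)\<close>, so that its fixed point is jointly continuous in time
  and parameter. Clamping the time to \<open>{-\<epsilon>..\<epsilon>}\<close> lets the operator act on functions on the whole
  space.
\<close>

lemma picard_continuous_family:
  fixes G :: "real \<times> 'q::metric_space \<times> 'e::banach \<Rightarrow> 'e"
  assumes "0 < \<epsilon>" "0 \<le> L" "L * \<epsilon> \<le> 1/2"
    and contG: "continuous_on UNIV G"
    and lip: "\<And>t q a b. norm (G (t, q, a) - G (t, q, b)) \<le> L * norm (a - b)"
    and bd: "\<And>t q. norm (G (t, q, 0)) \<le> M"
    and cont0: "continuous_on UNIV y0" and bd0: "\<And>q. norm (y0 q) \<le> M"
  shows "\<exists>y. continuous_on UNIV y \<and> (\<forall>q. y (0, q) = y0 q) \<and>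
    (\<forall>t\<in>{-\<epsilon><..<\<epsilon>}. \<forall>q. ((\<lambda>t. y (t, q)) has_vector_derivative G (t, q, y (t, q))) (at t))"
proof -
  define c where "c t = max (-\<epsilon>) (min \<epsilon> t)" for t :: real
  have c: "\<bar>c t\<bar> \<le> \<epsilon>" for t using assms(1) by (auto simp: c_def)
  have cid: "c t = t" if "t \<in> {-\<epsilon>..\<epsilon>}" for t using that by (auto simp: c_def)
  have contc: "continuous_on UNIV c" unfolding c_def by (intro continuous_intros)
  have contc': "continuous_on X (\<lambda>x. c (f x))" if "continuous_on X f" for X and f :: "'z::topological_space \<Rightarrow> real"
    by (rule continuous_on_compose2[OF contc that]) auto
  \<comment> \<open>the integral from 0 to \<open>c t\<close>, rescaled to a fixed interval so that negative times need no case split\<close>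
  define T where "T u = (\<lambda>(t, q). y0 q + c t *\<^sub>R integral (cbox 0 1) (\<lambda>s. G (c t * s, q, u (c t * s, q))))"
    for u :: "real \<times> 'q \<Rightarrow> 'e"
  have contI: "continuous_on UNIV (\<lambda>((t, q), s). G (c t * s, q, u (c t * s, q)))"
    if "continuous_on UNIV u" for u
    unfolding split_beta
    by (intro continuous_on_compose2[OF contG] continuous_on_compose2[OF that] continuous_intros contc') auto
  have contI': "continuous_on X (\<lambda>s. G (r * s, q, u (r * s, q)))"
    if "continuous_on UNIV u" for u r q and X :: "real set"
    by (intro continuous_on_compose2[OF contG] continuous_on_compose2[OF that] continuous_intros contc') auto
  have contT: "continuous_on UNIV (T u)" if "continuous_on UNIV u" for u
  proof -
    have "continuous_on UNIV (\<lambda>x. integral (cbox 0 1) (\<lambda>s. case x of (t, q) \<Rightarrow> G (c t * s, q, u (c t * s, q))))"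
      by (rule integral_continuous_on_param)
         (use continuous_on_subset[OF contI[OF that]] in \<open>auto simp: split_beta\<close>)
    then show ?thesis
      unfolding T_def split_beta
      by (intro continuous_intros contc' continuous_on_compose2[OF cont0]) auto
  qed
  have bdG: "norm (G (t, q, a)) \<le> M + L * B" if "norm a \<le> B" for t q a B
    using lip[of t q a 0] bd[of t q] norm_triangle_ineq2[of "G (t, q, a)" "G (t, q, 0)"]
      mult_left_mono[OF that assms(2)] by simp
  have Tin: "T (apply_bcontfun u) \<in> bcontfun" for u
  proof -
    obtain B where B: "\<And>x. norm (apply_bcontfun u x) \<le> B"
      using norm_bounded[of u] by blast
    have "norm (T u x) \<le> M + \<epsilon> * (M + L * B)" for x
    proof -
      obtain t q where x: "x = (t, q)" by (cases x)
      have "norm (integral {0..1} (\<lambda>s. G (c t * s, q, u (c t * s, q)))) \<le> (M + L * B) * (1 - 0)"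
        by (rule integral_bound) (auto intro: contI' bdG B)
      then have "\<bar>c t\<bar> * norm (integral {0..1} (\<lambda>s. G (c t * s, q, u (c t * s, q)))) \<le> \<epsilon> * (M + L * B)"
        using c[of t] assms(1) by (intro mult_mono) auto
      then show ?thesis
        unfolding x T_def using bd0[of q] by (auto intro!: order_trans[OF norm_triangle_ineq])
    qed
    then show ?thesis by (intro bcontfun_normI[of _ "M + \<epsilon> * (M + L * B)"] contT) simp_all
  qed
  define TT where "TT u = Bcontfun (T (apply_bcontfun u))" for u
  have TT: "apply_bcontfun (TT u) = T u" for u
    unfolding TT_def by (rule Bcontfun_inverse[OF Tin])
  have "dist (TT u) (TT v) \<le> 1/2 * dist u v" for u v
  proof (rule dist_bound)
    fix x :: "real \<times> 'q"
    obtain t q where x: "x = (t, q)" by (cases x)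
    have "norm (integral {0..1} (\<lambda>s. G (c t * s, q, u (c t * s, q)) - G (c t * s, q, v (c t * s, q))))
        \<le> (L * dist u v) * (1 - 0)"
    proof (rule integral_bound)
      show "norm (G (c t * s, q, u (c t * s, q)) - G (c t * s, q, v (c t * s, q))) \<le> L * dist u v" for s
        using lip[of "c t * s" q "u (c t * s, q)" "v (c t * s, q)"]
          mult_left_mono[OF dist_bounded[of u "(c t * s, q)" v] assms(2)] by (simp add: dist_norm)
    qed (auto intro!: continuous_intros contI')
    moreover have "integral {0..1} (\<lambda>s. G (c t * s, q, u (c t * s, q)) - G (c t * s, q, v (c t * s, q)))
       = integral {0..1} (\<lambda>s. G (c t * s, q, u (c t * s, q))) - integral {0..1} (\<lambda>s. G (c t * s, q, v (c t * s, q)))"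
      by (rule integral_diff) (auto intro!: integrable_continuous_real contI')
    ultimately have "dist (TT u x) (TT v x) \<le> \<bar>c t\<bar> * (L * dist u v)"
      unfolding TT T_def x by (simp add: dist_norm scaleR_diff_right[symmetric] mult_left_mono)
    also have "\<dots> \<le> \<epsilon> * (L * dist u v)"
      by (rule mult_right_mono[OF c]) (use assms(2) in auto)
    also have "\<dots> \<le> 1/2 * dist u v"
      using mult_right_mono[OF assms(3), of "dist u v"] by (simp add: algebra_simps)
    finally show "dist (TT u x) (TT v x) \<le> 1/2 * dist u v" .
  qed
  then obtain u where "TT u = u"
    using banach_fix_type[of "1/2" TT] by auto
  define y where "y = apply_bcontfun u"
  have y: "T y = y" using TT[of u] \<open>TT u = u\<close> by (simp add: y_def)
  have conty: "continuous_on UNIV y" by (simp add: y_def)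
  show ?thesis
  proof (intro exI[of _ y] conjI allI ballI)
    show "continuous_on UNIV y" by (rule conty)
    show "y (0, q) = y0 q" for q
      using fun_cong[OF y, of "(0, q)"] cid[of 0] assms(1) by (simp add: T_def)
    fix t q assume t: "t \<in> {-\<epsilon><..<\<epsilon>}"
    have "continuous_on {-\<epsilon>..\<epsilon>} (\<lambda>s. G (s, q, y (s, q)))"
      using contI'[OF conty, of _ 1] by simp
    then obtain F where F: "\<And>s. s \<in> {-\<epsilon>..\<epsilon>} \<Longrightarrow> (F has_vector_derivative G (s, q, y (s, q))) (at s within {-\<epsilon>..\<epsilon>})"
      by (rule antiderivative_continuous) blast
    have yF: "y (s, q) = y0 q + (F s - F 0)" if s: "s \<in> {-\<epsilon>..\<epsilon>}" for s
    proof -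
      have "((\<lambda>r. s *\<^sub>R G (s * r, q, y (s * r, q))) has_integral F (s * 1) - F (s * 0)) {0..1}"
      proof (rule fundamental_theorem_of_calculus)
        fix r :: real assume r: "r \<in> {0..1}"
        have im: "(*) s ` {0..1} \<subseteq> {-\<epsilon>..\<epsilon>}"
        proof
          fix z assume "z \<in> (*) s ` {0..1}"
          then obtain r where "z = s * r" "r \<in> {0..1}" by blast
          then have "\<bar>z\<bar> \<le> \<bar>s\<bar>" by (simp add: abs_mult mult_left_le)
          then show "z \<in> {-\<epsilon>..\<epsilon>}" using s by auto
        qed
        have "((F \<circ> (*) s) has_vector_derivative s *\<^sub>R G (s * r, q, y (s * r, q))) (at r within {0..1})"
        proof (rule vector_diff_chain_within)
          show "((*) s has_vector_derivative s) (at r within {0..1})"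
            by (auto intro!: derivative_eq_intros simp: has_real_derivative_iff_has_vector_derivative[symmetric])
          show "(F has_vector_derivative G (s * r, q, y (s * r, q))) (at (s * r) within (*) s ` {0..1})"
            by (rule has_vector_derivative_within_subset[OF F[OF subsetD[OF im imageI[OF r]]] im])
        qed
        then show "((\<lambda>r. F (s * r)) has_vector_derivative s *\<^sub>R G (s * r, q, y (s * r, q))) (at r within {0..1})"
          by (simp add: o_def)
      qed simp
      then have "s *\<^sub>R integral {0..1} (\<lambda>r. G (s * r, q, y (s * r, q))) = F s - F 0"
        by (simp add: has_integral_iff)
      then show ?thesis
        using fun_cong[OF y, of "(s, q)"] cid[OF s] by (simp add: T_def)
    qed
    have "(F has_vector_derivative G (t, q, y (t, q))) (at t)"
      using F[of t] t by (simp add: at_within_Icc_at)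
    then have "((\<lambda>s. y0 q + (F s - F 0)) has_vector_derivative G (t, q, y (t, q))) (at t)"
      by (auto intro!: derivative_eq_intros)
    then show "((\<lambda>t. y (t, q)) has_vector_derivative G (t, q, y (t, q))) (at t)"
      by (rule has_vector_derivative_transform_within_open[of _ _ _ "{-\<epsilon><..<\<epsilon>}"])
         (use t yF in auto)
  qed
qed

text \<open>
  In finite dimension, continuity of the directional derivatives amounts to continuity of the
  derivative in the operator norm.
\<close>

lemma C1_on_continuous_derivative:
  fixes f :: "'a::euclidean_space \<Rightarrow> 'b::real_normed_vector"
  assumes "Ck_on (Suc 0) D f"
  shows "continuous_on D (\<lambda>x. Blinfun (frechet_derivative f (at x)))"
    and "\<And>x. x \<in> D \<Longrightarrow> blinfun_apply (Blinfun (frechet_derivative f (at x))) = frechet_derivative f (at x)"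
proof -
  show *: "blinfun_apply (Blinfun (frechet_derivative f (at x))) = frechet_derivative f (at x)" if "x \<in> D" for x
    by (rule bounded_linear_Blinfun_apply)
       (use Ck_on_has_derivative[OF assms that] in \<open>rule has_derivative_bounded_linear\<close>)
  show "continuous_on D (\<lambda>x. Blinfun (frechet_derivative f (at x)))"
    by (rule continuous_on_blinfun_componentwise) (use assms in \<open>simp add: * cong: continuous_on_cong\<close>)
qed

lemma C1_derivative_bound:
  fixes f :: "'a::euclidean_space \<Rightarrow> 'b::real_normed_vector"
  assumes "Ck_on (Suc 0) D f" "compact C" "C \<subseteq> D"
  obtains M where "0 \<le> M" and "\<And>x h. x \<in> C \<Longrightarrow> norm (frechet_derivative f (at x) h) \<le> M * norm h"
proof -
  have "bounded ((\<lambda>x. Blinfun (frechet_derivative f (at x))) ` C)"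
    by (intro compact_imp_bounded compact_continuous_image assms
        continuous_on_subset[OF C1_on_continuous_derivative(1)[OF assms(1)]])
  then obtain M where M: "\<And>x. x \<in> C \<Longrightarrow> norm (Blinfun (frechet_derivative f (at x))) \<le> M" "0 < M"
    unfolding bounded_pos by auto
  show thesis
  proof
    show "0 \<le> M" using M by simp
    show "norm (frechet_derivative f (at x) h) \<le> M * norm h" if "x \<in> C" for x h
      using norm_blinfun[of "Blinfun (frechet_derivative f (at x))" h] mult_right_mono[OF M(1)[OF that], of "norm h"]
        C1_on_continuous_derivative(2)[OF assms(1), of x] that assms(3) by auto
  qed
qed

text \<open>
  The first-order error is uniform along a compact set. This will be used along the trajectory of a
  solution, where the error has to be controlled at all times simultaneously.
\<close>

lemma C1_uniform_linearization:
  fixes f :: "'a::euclidean_space \<Rightarrow> 'b::real_normed_vector"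
  assumes f: "Ck_on (Suc 0) D f" and "open D" "compact C" "C \<subseteq> D" "0 < e"
  obtains d where "0 < d" and "\<And>x h. x \<in> C \<Longrightarrow> norm h < d \<Longrightarrow>
     x + h \<in> D \<and> norm (f (x + h) - f x - frechet_derivative f (at x) h) \<le> e * norm h"
proof (cases "C = {}")
  case True
  show thesis by (rule that[of 1]) (use True in auto)
next
  case False
  obtain r where r: "0 < r" "{x. infdist x C \<le> r} \<subseteq> D"
    using compact_in_open_separated[OF False assms(3,2,4)] by blast
  define K where "K = {x. infdist x C \<le> r}"
  define f' where "f' = (\<lambda>x. Blinfun (frechet_derivative f (at x)))"
  have "uniformly_continuous_on K f'"
    unfolding K_def f'_def
    by (intro compact_uniformly_continuous compact_infdist_le False assms r
        continuous_on_subset[OF C1_on_continuous_derivative(1)[OF f]])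
  then obtain d0 where d0: "0 < d0" "\<And>x x'. x \<in> K \<Longrightarrow> x' \<in> K \<Longrightarrow> dist x' x < d0 \<Longrightarrow> dist (f' x') (f' x) < e"
    unfolding uniformly_continuous_on_def using assms(5) by metis
  define d where "d = min r d0"
  show thesis
  proof
    show "0 < d" using r d0 by (simp add: d_def)
    fix x h :: 'a assume x: "x \<in> C" and h: "norm h < d"
    have ball: "z \<in> K" "z \<in> D" if "z \<in> ball x d" for z
    proof -
      have "infdist z C \<le> dist z x" by (rule infdist_le[OF x])
      also have "\<dots> \<le> r" using that by (auto simp: d_def dist_commute)
      finally show "z \<in> K" by (simp add: K_def)
      then show "z \<in> D" using r by (auto simp: K_def)
    qed
    have "norm (f (x + h) - f x - blinfun_apply (f' x) (x + h - x)) \<le> norm (x + h - x) * e"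
    proof (rule differentiable_bound_linearization[where S = "ball x d" and f' = "\<lambda>z. blinfun_apply (f' z)"])
      show "x + t *\<^sub>R (x + h - x) \<in> ball x d" if "t \<in> {0..1}" for t
      proof -
        have "\<bar>t\<bar> * norm h \<le> norm h" using that by (simp add: mult_left_le_one_le)
        then show ?thesis using h by (simp add: dist_norm)
      qed
      show "(f has_derivative blinfun_apply (f' z)) (at z within ball x d)" if "z \<in> ball x d" for z
        unfolding f'_def C1_on_continuous_derivative(2)[OF f ball(2)[OF that]]
        by (rule has_derivative_at_withinI[OF Ck_on_has_derivative[OF f ball(2)[OF that]]])
      show "onorm (blinfun_apply (f' z) - blinfun_apply (f' x)) \<le> e" if "z \<in> ball x d" for z
      proof -
        have "dist (f' z) (f' x) < e"
          using that \<open>0 < d\<close> by (intro d0 ball) (auto simp: d_def dist_commute)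
        moreover have "blinfun_apply (f' z - f' x) = blinfun_apply (f' z) - blinfun_apply (f' x)"
          by (auto simp: blinfun.diff_left)
        ultimately show ?thesis by (simp add: dist_norm norm_blinfun.rep_eq)
      qed
      show "x \<in> ball x d" using \<open>0 < d\<close> by simp
    qed
    moreover have "x \<in> D" using x assms(4) by auto
    ultimately show "x + h \<in> D \<and> norm (f (x + h) - f x - frechet_derivative f (at x) h) \<le> e * norm h"
      using ball(2)[of "x + h"] h C1_on_continuous_derivative(2)[OF f, of x]
      by (simp add: f'_def dist_norm mult.commute)
  qed
qed

text \<open>
  A single constant for all three bounds keeps the later estimates short.
\<close>

lemma C1_bounded_and_lipschitz_on_cball:
  fixes F :: "'a::euclidean_space \<Rightarrow> 'b::real_normed_vector"
  assumes F: "Ck_on (Suc 0) N F" and R: "cball p R \<subseteq> N"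
  obtains B where "0 < B" and "\<And>z. z \<in> cball p R \<Longrightarrow> norm (F z) \<le> B"
    and "\<And>z h. z \<in> cball p R \<Longrightarrow> norm (frechet_derivative F (at z) h) \<le> B * norm h"
    and "\<And>a b. a \<in> cball p R \<Longrightarrow> b \<in> cball p R \<Longrightarrow> norm (F a - F b) \<le> B * norm (a - b)"
proof -
  have "compact (F ` cball p R)"
    by (rule compact_continuous_image[OF continuous_on_subset[OF Ck_on_continuous[OF F] R]]) simp
  from compact_imp_bounded[OF this] obtain M where "0 < M" "\<forall>z \<in> F ` cball p R. norm z \<le> M"
    unfolding bounded_pos by blast
  then have M: "0 < M" "\<And>z. z \<in> cball p R \<Longrightarrow> norm (F z) \<le> M" by simp_all
  obtain L where L: "0 \<le> L" "\<And>z h. z \<in> cball p R \<Longrightarrow> norm (frechet_derivative F (at z) h) \<le> L * norm h"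
    using C1_derivative_bound[OF F compact_cball R] by blast
  have lip: "norm (F a - F b) \<le> L * norm (a - b)" if "a \<in> cball p R" "b \<in> cball p R" for a b
  proof (rule differentiable_bound[OF convex_cball _ _ that])
    show "(F has_derivative frechet_derivative F (at z)) (at z within cball p R)" if "z \<in> cball p R" for z
      by (rule has_derivative_at_withinI[OF Ck_on_has_derivative[OF F]]) (use R that in auto)
    show "onorm (frechet_derivative F (at z)) \<le> L" if "z \<in> cball p R" for z
      by (rule onorm_bound[OF L(1) L(2)[OF that]])
  qed
  have le: "L * r \<le> max M L * r" "M \<le> max M L" if "0 \<le> r" for r
    using that by (simp_all add: mult_right_mono)
  show thesis
  proof (rule that[of "max M L"])
    show "0 < max M L" using M by simp
    show "norm (F z) \<le> max M L" if "z \<in> cball p R" for z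
      using M(2)[OF that] by simp
    show "norm (frechet_derivative F (at z) h) \<le> max M L * norm h" if "z \<in> cball p R" for z h
      using L(2)[OF that, of h] le(1)[of "norm h"] by simp
    show "norm (F a - F b) \<le> max M L * norm (a - b)" if "a \<in> cball p R" "b \<in> cball p R" for a b
      using lip[OF that] le(1)[of "norm (a - b)"] by simp
  qed
qed

text \<open>
  Passes the Lipschitz constant of a differential equation on to its linearisation, so that both can
  be treated on the same time interval.
\<close>

lemma directional_derivative_le_lipschitz:
  fixes f :: "'a::real_normed_vector \<Rightarrow> 'b::real_normed_vector"
  assumes f: "(f has_derivative f') (at x)" and "0 < d"
    and lip: "\<And>s. \<bar>s\<bar> < d \<Longrightarrow> norm (f (x + s *\<^sub>R v) - f x) \<le> B * \<bar>s\<bar>"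
  shows "norm (f' v) \<le> B"
proof -
  have lin: "bounded_linear f'" by (rule has_derivative_bounded_linear[OF f])
  show ?thesis
  proof (rule field_le_epsilon)
    fix e :: real assume "0 < e"
    define e' where "e' = e / (norm v + 1)"
    have v: "0 < norm v + 1" by (simp add: add_nonneg_pos)
    then have e': "0 < e'" using \<open>0 < e\<close> by (simp add: e'_def)
    then obtain r where r: "0 < r"
        "\<And>y. norm (y - x) < r \<Longrightarrow> norm (f y - f x - f' (y - x)) \<le> e' * norm (y - x)"
      using f unfolding has_derivative_at_alt by blast
    define s where "s = min (d / 2) (r / (2 * (norm v + 1)))"
    have s: "0 < s" "s < d" "s \<le> r / (2 * (norm v + 1))" using assms(2) r v by (auto simp: s_def)
    have "2 * (s * (norm v + 1)) \<le> r"
      using s(3) v by (simp add: pos_le_divide_eq algebra_simps)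
    then have "s * (norm v + 1) < r" using r(1) by linarith
    then have "norm (x + s *\<^sub>R v - x) < r" using s by (simp add: algebra_simps)
    from r(2)[OF this] have "norm (f (x + s *\<^sub>R v) - f x - s *\<^sub>R f' v) \<le> e' * (s * norm v)"
      using s by (simp add: linear_simps(5)[OF lin])
    moreover have "norm (f (x + s *\<^sub>R v) - f x) \<le> B * s" using lip[of s] s by simp
    ultimately have "norm (s *\<^sub>R f' v) \<le> B * s + e' * (s * norm v)"
      using norm_triangle_sub[of "s *\<^sub>R f' v" "f (x + s *\<^sub>R v) - f x"] by (simp add: norm_minus_commute)
    then have "s * norm (f' v) \<le> s * (B + e' * norm v)" using s by (simp add: algebra_simps)
    then have "norm (f' v) \<le> B + e' * norm v" using s by simp
    also have "e' * norm v \<le> e' * (norm v + 1)" using e' by simp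
    also have "\<dots> = e" using v by (simp add: e'_def)
    finally show "norm (f' v) \<le> B + e" by simp
  qed
qed

text \<open>
  The solutions \<open>Z h\<close> of the linearised equation are the derivatives of \<open>y\<close> in the directions \<open>h\<close> of the
  parameter: the remainder \<open>y (t, q + h) - y (t, q) - Z h t\<close> satisfies a linear differential
  inequality whose inhomogeneous term is \<open>o(norm h)\<close> uniformly in \<open>t\<close>, and \<open>short_time_estimate\<close>
  carries this over to the remainder itself.
\<close>

lemma has_derivative_wrt_parameter:
  fixes y :: "real \<times> 'q::euclidean_space \<Rightarrow> 'e::euclidean_space"
    and G :: "real \<times> 'q \<times> 'e \<Rightarrow> 'e"
  assumes "open D" and G: "Ck_on (Suc 0) D G"
    and "0 \<le> \<delta>" "0 \<le> L" "L * \<delta> \<le> 1/2" "open Q" "q \<in> Q"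
    and inD: "\<And>t p. t \<in> {-\<delta>..\<delta>} \<Longrightarrow> p \<in> Q \<Longrightarrow> (t, p, y (t, p)) \<in> D"
    and sol: "\<And>t p. t \<in> {-\<delta>..\<delta>} \<Longrightarrow> p \<in> Q \<Longrightarrow> ((\<lambda>t. y (t, p)) has_vector_derivative G (t, p, y (t, p))) (at t)"
    and lip: "\<And>t p a b. (t, p, a) \<in> D \<Longrightarrow> (t, p, b) \<in> D \<Longrightarrow> norm (G (t, p, a) - G (t, p, b)) \<le> L * norm (a - b)"
    and init: "((\<lambda>p. y (0, p)) has_derivative y0') (at q)"
    and Z0: "\<And>h. Z h 0 = y0' h"
    and Z: "\<And>h t. t \<in> {-\<delta>..\<delta>} \<Longrightarrow>
       (Z h has_vector_derivative frechet_derivative G (at (t, q, y (t, q))) (0, h, Z h t)) (at t)"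
    and t: "t \<in> {-\<delta>..\<delta>}"
  shows "((\<lambda>p. y (t, p)) has_derivative (\<lambda>h. Z h t)) (at q)"
proof -
  define c where "c s = (s, q, y (s, q))" for s
  define DG where "DG s = frechet_derivative G (at (c s))" for s
  have cD: "c s \<in> D" if "s \<in> {-\<delta>..\<delta>}" for s using inD[OF that \<open>q \<in> Q\<close>] by (simp add: c_def)
  have dG: "(G has_derivative DG s) (at (c s))" if "s \<in> {-\<delta>..\<delta>}" for s
    unfolding DG_def by (rule Ck_on_has_derivative[OF G cD[OF that]])
  have Zd: "(Z h has_vector_derivative DG s (0, h, Z h s)) (at s)" if "s \<in> {-\<delta>..\<delta>}" for h s
    using Z[OF that] by (simp add: DG_def c_def)
  have linG: "linear (DG s)" if "s \<in> {-\<delta>..\<delta>}" for s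
    using dG[OF that] has_derivative_linear by blast
  have DGL: "norm (DG s (0, 0, z)) \<le> L * norm z" if s: "s \<in> {-\<delta>..\<delta>}" for s z
  proof -
    have "\<forall>\<^sub>F r in at (0::real). c s + r *\<^sub>R (0, 0, z) \<in> D"
    proof (rule topological_tendstoD[OF _ \<open>open D\<close>])
      show "((\<lambda>r. c s + r *\<^sub>R (0, 0, z)) \<longlongrightarrow> c s) (at 0)"
        by (rule tendsto_eq_intros refl | simp add: zero_prod_def)+
    qed (use cD[OF s] in simp)
    then obtain d where d: "0 < d" "\<And>r. r \<noteq> 0 \<Longrightarrow> dist r 0 < d \<Longrightarrow> c s + r *\<^sub>R (0, 0, z) \<in> D"
      unfolding eventually_at by auto
    show ?thesis
    proof (rule directional_derivative_le_lipschitz[OF dG[OF s] \<open>0 < d\<close>])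
      fix r :: real assume "\<bar>r\<bar> < d"
      then have "c s + r *\<^sub>R (0, 0, z) \<in> D" using d(2)[of r] cD[OF s] by (cases "r = 0") (auto simp: zero_prod_def[symmetric])
      then show "norm (G (c s + r *\<^sub>R (0, 0, z)) - G (c s)) \<le> L * norm z * \<bar>r\<bar>"
        using lip[of s q "y (s, q) + r *\<^sub>R z" "y (s, q)"] cD[OF s] by (simp add: c_def ac_simps)
    qed
  qed
  have DGdiff: "DG s (0, h, a) - DG s (0, k, b) = DG s (0, h - k, a - b)" if "s \<in> {-\<delta>..\<delta>}" for s h k a b
    using linear_diff[OF linG[OF that], of "(0, h, a)" "(0, k, b)"] by simp

  \<comment> \<open>uniqueness for the linearised equation makes \<open>h \<mapsto> Z h\<close> linear\<close>
  have y0'lin: "linear y0'" using init has_derivative_linear by blast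
  have zero: "w s = 0"
    if "w 0 = 0" "\<And>s. s \<in> {-\<delta>..\<delta>} \<Longrightarrow> (w has_vector_derivative DG s (0, 0, w s)) (at s)" "s \<in> {-\<delta>..\<delta>}" for w s
    using short_time_estimate[OF assms(3,4,5) order_refl that(2) _ that(3)] DGL that(1) by simp
  have "linear (\<lambda>h. Z h t)"
  proof (rule linearI)
    fix h k
    have "Z (h + k) t - (Z h t + Z k t) = 0"
    proof (rule zero[where w = "\<lambda>t. Z (h + k) t - (Z h t + Z k t)"])
      fix s assume s: "s \<in> {-\<delta>..\<delta>}"
      have eq: "DG s (0, h + k, Z (h + k) s) - (DG s (0, h, Z h s) + DG s (0, k, Z k s))
         = DG s (0, 0, Z (h + k) s - (Z h s + Z k s))"
        using DGdiff[OF s, of "h + k" "Z (h + k) s" "h + k" "Z h s + Z k s"]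
          linear_add[OF linG[OF s], of "(0, h, Z h s)" "(0, k, Z k s)"] by simp
      show "((\<lambda>t. Z (h + k) t - (Z h t + Z k t)) has_vector_derivative
          DG s (0, 0, Z (h + k) s - (Z h s + Z k s))) (at s)"
        unfolding eq[symmetric] by (intro has_vector_derivative_diff has_vector_derivative_add Zd s)
    qed (use Z0 linear_add[OF y0'lin] t in auto)
    then show "Z (h + k) t = Z h t + Z k t" by simp
  next
    fix r h
    have "Z (r *\<^sub>R h) t - r *\<^sub>R Z h t = 0"
    proof (rule zero[where w = "\<lambda>t. Z (r *\<^sub>R h) t - r *\<^sub>R Z h t"])
      fix s assume s: "s \<in> {-\<delta>..\<delta>}"
      have eq: "DG s (0, r *\<^sub>R h, Z (r *\<^sub>R h) s) - r *\<^sub>R DG s (0, h, Z h s) = DG s (0, 0, Z (r *\<^sub>R h) s - r *\<^sub>R Z h s)"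
        using DGdiff[OF s, of "r *\<^sub>R h" "Z (r *\<^sub>R h) s" "r *\<^sub>R h" "r *\<^sub>R Z h s"]
          linear_scale[OF linG[OF s], of r "(0, h, Z h s)"] by simp
      show "((\<lambda>t. Z (r *\<^sub>R h) t - r *\<^sub>R Z h t) has_vector_derivative
          DG s (0, 0, Z (r *\<^sub>R h) s - r *\<^sub>R Z h s)) (at s)"
        unfolding eq[symmetric]
        by (intro has_vector_derivative_diff Zd s bounded_linear.has_vector_derivative[OF bounded_linear_scaleR_right])
    qed (use Z0 linear_scale[OF y0'lin] t in auto)
    then show "Z (r *\<^sub>R h) t = r *\<^sub>R Z h t" by simp
  qed
  then have "bounded_linear (\<lambda>h. Z h t)" by (simp add: linear_conv_bounded_linear)

  have "continuous_on {-\<delta>..\<delta>} (\<lambda>s. y (s, q))"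
    by (intro continuous_at_imp_continuous_on ballI has_vector_derivative_continuous[OF sol[OF _ \<open>q \<in> Q\<close>]])
  then have "continuous_on {-\<delta>..\<delta>} c"
    unfolding c_def by (intro continuous_intros)
  then have C: "compact (c ` {-\<delta>..\<delta>})" "c ` {-\<delta>..\<delta>} \<subseteq> D"
    using cD by (auto intro: compact_continuous_image)
  obtain M where M: "0 \<le> M" "\<And>s v. s \<in> {-\<delta>..\<delta>} \<Longrightarrow> norm (DG s v) \<le> M * norm v"
    using C1_derivative_bound[OF G C] unfolding DG_def by (metis imageI)
  obtain N where N: "0 \<le> N" "\<And>h. norm (y0' h) \<le> N * norm h"
    using bounded_linear.nonneg_bounded[OF has_derivative_bounded_linear[OF init]] by (metis mult.commute)
  \<comment> \<open>a Lipschitz constant of the solution in the parameter, see \<open>kle\<close> below\<close>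
  define K where "K = 2 * (N + 1 + \<delta> * (M + 1))"
  have K: "0 \<le> K" using N M assms by (simp add: K_def)
  have "\<exists>d>0. \<forall>p. norm (p - q) < d \<longrightarrow> norm (y (t, p) - y (t, q) - Z (p - q) t) \<le> e * norm (p - q)" if e: "0 < e" for e
  proof -
    define e1 where "e1 = min 1 (e / (2 * (1 + \<delta> * (1 + K))))"
    have den: "0 < 2 * (1 + \<delta> * (1 + K))" using K assms by (simp add: add_pos_nonneg)
    have e1: "0 < e1" "e1 \<le> 1" "e1 * (2 * (1 + \<delta> * (1 + K))) \<le> e"
    proof -
      show "0 < e1" "e1 \<le> 1" using e den by (auto simp: e1_def)
      have "e1 \<le> e / (2 * (1 + \<delta> * (1 + K)))" by (simp add: e1_def)
      then show "e1 * (2 * (1 + \<delta> * (1 + K))) \<le> e" using den by (simp add: pos_le_divide_eq)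
    qed
    obtain d1 where d1: "0 < d1" "\<And>s k. s \<in> {-\<delta>..\<delta>} \<Longrightarrow> norm k < d1 \<Longrightarrow>
        c s + k \<in> D \<and> norm (G (c s + k) - G (c s) - DG s k) \<le> e1 * norm k"
      using C1_uniform_linearization[OF G \<open>open D\<close> C \<open>0 < e1\<close>] unfolding DG_def by (metis imageI)
    obtain d2 where d2: "0 < d2" "\<And>p. norm (p - q) < d2 \<Longrightarrow>
        norm (y (0, p) - y (0, q) - y0' (p - q)) \<le> e1 * norm (p - q)"
      using init e1(1) unfolding has_derivative_at_alt by blast
    obtain d3 where d3: "0 < d3" "ball q d3 \<subseteq> Q"
      using \<open>open Q\<close> \<open>q \<in> Q\<close> open_contains_ball by blast
    define d where "d = Min {d1 / (1 + K), d2, d3}"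
    have d: "0 < d" "d \<le> d1 / (1 + K)" "d \<le> d2" "d \<le> d3"
      using d1 d2 d3 K by (auto simp: d_def)
    have "norm (y (t, p) - y (t, q) - Z (p - q) t) \<le> e * norm (p - q)" if p: "norm (p - q) < d" for p
    proof -
      define h where "h = p - q"
      have pQ: "p \<in> Q" using d3 d p by (auto simp: dist_norm norm_minus_commute)
      have hd: "(1 + K) * norm h < d1"
        using p d(2) K by (simp add: h_def pos_le_divide_eq mult.commute)
          (smt (verit) K mult_strict_left_mono pos_le_divide_eq mult.commute)
      have hd1: "norm h < d1" using hd mult_nonneg_nonneg[OF K norm_ge_zero[of h]] by (simp add: distrib_right)
      define k where "k s = y (s, p) - y (s, q)" for s
      have ps: "(s, p, y (s, p)) = c s + (0, h, k s)" "(s, p, y (s, q)) = c s + (0, h, 0)" for s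
        by (simp_all add: c_def k_def h_def)
      have k': "(k has_vector_derivative G (s, p, y (s, p)) - G (c s)) (at s)" if "s \<in> {-\<delta>..\<delta>}" for s
        unfolding k_def c_def by (intro has_vector_derivative_diff sol that pQ \<open>q \<in> Q\<close>)
      have kle: "norm (k s) \<le> K * norm h" if "s \<in> {-\<delta>..\<delta>}" for s
      proof -
        have "norm (k s) \<le> 2 * (norm (k 0) + \<delta> * ((M + 1) * norm h))"
        proof (rule short_time_estimate[OF assms(3,4,5) _ k' _ that])
          show "0 \<le> (M + 1) * norm h" using M by simp
          fix s assume s: "s \<in> {-\<delta>..\<delta>}"
          have A: "c s + (0, h, 0) \<in> D" "norm (G (c s + (0, h, 0)) - G (c s) - DG s (0, h, 0)) \<le> e1 * norm h"
            using d1(2)[OF s, of "(0, h, 0)"] hd1 by (simp_all add: norm_Pair)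
          have B: "norm (G (s, p, y (s, p)) - G (c s + (0, h, 0))) \<le> L * norm (k s)"
            using lip[OF inD[OF s pQ], of "y (s, q)"] A(1) by (simp add: ps(2)[symmetric] k_def)
          have E: "norm (DG s (0, h, 0)) \<le> M * norm h" using M(2)[OF s, of "(0, h, 0)"] by (simp add: norm_Pair)
          have "norm (G (c s + (0, h, 0)) - G (c s)) \<le> e1 * norm h + M * norm h"
            using norm_triangle_ineq2[of "G (c s + (0, h, 0)) - G (c s)" "DG s (0, h, 0)"] A(2) E by linarith
          also have "\<dots> \<le> (M + 1) * norm h"
            using mult_right_mono[OF e1(2) norm_ge_zero[of h]] by (simp add: algebra_simps)
          finally show "norm (G (s, p, y (s, p)) - G (c s)) \<le> L * norm (k s) + (M + 1) * norm h"
            using B norm_triangle_ineq[of "G (s, p, y (s, p)) - G (c s + (0, h, 0))" "G (c s + (0, h, 0)) - G (c s)"] by simp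
        qed
        moreover have "norm (k 0) \<le> (N + 1) * norm h"
          using d2(2)[of p] p d(3) N(2)[of h] norm_triangle_ineq2[of "k 0" "y0' h"]
            mult_right_mono[OF e1(2) norm_ge_zero[of h]]
          by (simp add: k_def h_def algebra_simps)
        ultimately show ?thesis by (simp add: K_def algebra_simps)
      qed
      have small: "norm (0::real, h, k s) \<le> (1 + K) * norm h" if "s \<in> {-\<delta>..\<delta>}" for s
        using kle[OF that] norm_Pair_le[of h "k s"] by (simp add: norm_Pair[of 0] algebra_simps)
      have "norm (k t - Z h t) \<le> 2 * (norm (k 0 - Z h 0) + \<delta> * (e1 * ((1 + K) * norm h)))"
      proof (rule short_time_estimate[where w = "\<lambda>s. k s - Z h s", OF assms(3,4,5) _ _ _ t])
        show "0 \<le> e1 * ((1 + K) * norm h)" using e1 K by simp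
        fix s assume s: "s \<in> {-\<delta>..\<delta>}"
        show "((\<lambda>s. k s - Z h s) has_vector_derivative
            G (s, p, y (s, p)) - G (c s) - DG s (0, h, Z h s)) (at s)"
          by (rule has_vector_derivative_diff[OF k'[OF s] Zd[OF s]])
        have "norm (0::real, h, k s) < d1" using small[OF s] hd by linarith
        then have "norm (G (c s + (0, h, k s)) - G (c s) - DG s (0, h, k s)) \<le> e1 * norm (0::real, h, k s)"
          using d1(2)[OF s] by blast
        also have "\<dots> \<le> e1 * ((1 + K) * norm h)"
          by (rule mult_left_mono[OF small[OF s]]) (use e1 in simp)
        finally have "norm (G (s, p, y (s, p)) - G (c s) - DG s (0, h, k s)) \<le> e1 * ((1 + K) * norm h)"
          by (simp add: ps)
        moreover have "norm (DG s (0, h, k s) - DG s (0, h, Z h s)) \<le> L * norm (k s - Z h s)"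
          using DGL[OF s] by (simp add: DGdiff[OF s])
        ultimately show "norm (G (s, p, y (s, p)) - G (c s) - DG s (0, h, Z h s))
            \<le> L * norm (k s - Z h s) + e1 * ((1 + K) * norm h)"
          using norm_triangle_ineq[of "G (s, p, y (s, p)) - G (c s) - DG s (0, h, k s)" "DG s (0, h, k s) - DG s (0, h, Z h s)"]
          by simp
      qed
      also have "norm (k 0 - Z h 0) \<le> e1 * norm h"
        using d2(2)[of p] p d(3) by (simp add: k_def h_def Z0)
      then have "2 * (norm (k 0 - Z h 0) + \<delta> * (e1 * ((1 + K) * norm h)))
          \<le> 2 * (e1 * norm h + \<delta> * (e1 * ((1 + K) * norm h)))" by simp
      also have "\<dots> = (e1 * (2 * (1 + \<delta> * (1 + K)))) * norm h" by (simp add: algebra_simps)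
      also have "\<dots> \<le> e * norm h" by (rule mult_right_mono[OF e1(3)]) simp
      finally show ?thesis by (simp add: k_def h_def)
    qed
    with d(1) show ?thesis by blast
  qed
  with \<open>bounded_linear (\<lambda>h. Z h t)\<close> show ?thesis
    unfolding has_derivative_at_alt by blast
qed

text \<open>
  One order of differentiability of \<open>G\<close> is spent on linearising. The unknown \<open>z\<close> enters the linearised
  right-hand side linearly, so expanding it in a basis leaves only directional derivatives of \<open>G\<close> in
  fixed directions.
\<close>

lemma smooth_dependence_step_coefficients:
  fixes G :: "real \<times> 'q::euclidean_space \<times> 'e::euclidean_space \<Rightarrow> 'e"
  assumes "open S" "open Q" "open W" and G: "Ck_on (Suc n) (S \<times> Q \<times> W) G" and y: "Ck_on n (S \<times> Q) y"
    and yW: "\<And>t q. t \<in> S \<Longrightarrow> q \<in> Q \<Longrightarrow> y (t, q) \<in> W"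
  shows "Ck_on n (S \<times> Q) (\<lambda>(t, q). G (t, q, y (t, q)))"
    and "Ck_on n (S \<times> Q \<times> UNIV) (\<lambda>(t, q, z). frechet_derivative G (at (t, q, y (t, q))) (0, v, z))"
proof -
  let ?D = "S \<times> Q \<times> W" and ?E = "S \<times> Q \<times> (UNIV :: 'e set)"
  have op: "open (S \<times> Q)" "open ?D" "open ?E" using assms by (auto intro: open_Times)
  show "Ck_on n (S \<times> Q) (\<lambda>(t, q). G (t, q, y (t, q)))"
  proof -
    have "Ck_on n (S \<times> Q) (\<lambda>x. (fst x, snd x, y x))"
      by (intro Ck_on_Pair op y Ck_on_bounded_linear[OF bounded_linear_fst] Ck_on_bounded_linear[OF bounded_linear_snd])
    then have "Ck_on n (S \<times> Q) (\<lambda>x. G (fst x, snd x, y x))"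
      by (rule Ck_on_compose[OF op(1,2) _ _ Ck_on_SucD[OF G], rotated]) (use yW in auto)
    then show ?thesis by (simp add: case_prod_unfold)
  qed
  have yE: "Ck_on n ?E (\<lambda>x. y (fst x, fst (snd x)))"
  proof (rule Ck_on_compose[OF op(3,1) _ _ y])
    show "Ck_on n ?E (\<lambda>x. (fst x, fst (snd x)))"
      by (intro Ck_on_bounded_linear op bounded_linear_Pair bounded_linear_fst
          bounded_linear_compose[OF bounded_linear_fst bounded_linear_snd])
  qed auto
  have D: "Ck_on n ?E (\<lambda>x. frechet_derivative G (at (fst x, fst (snd x), y (fst x, fst (snd x)))) w)" for w
  proof (rule Ck_on_compose[OF op(3,2)])
    show "Ck_on n ?E (\<lambda>x. (fst x, fst (snd x), y (fst x, fst (snd x))))"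
      by (intro Ck_on_Pair op yE Ck_on_bounded_linear[OF bounded_linear_fst]
          Ck_on_bounded_linear[OF bounded_linear_compose[OF bounded_linear_fst bounded_linear_snd]])
    show "Ck_on n ?D (\<lambda>x. frechet_derivative G (at x) w)" using G unfolding Ck_on.simps by blast
  qed (use yW in auto)
  have "Ck_on n ?E (\<lambda>x. frechet_derivative G (at (fst x, fst (snd x), y (fst x, fst (snd x)))) (0, v, 0)
      + (\<Sum>i\<in>Basis. (snd (snd x) \<bullet> i) *\<^sub>R frechet_derivative G (at (fst x, fst (snd x), y (fst x, fst (snd x)))) (0, 0, i)))"
    by (intro Ck_on_add Ck_on_sum op D Ck_on_bilinear[OF bounded_bilinear_scaleR]
        Ck_on_bounded_linear[OF bounded_linear_compose[OF bounded_linear_inner_left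
          bounded_linear_compose[OF bounded_linear_snd bounded_linear_snd]]])
  then show "Ck_on n ?E (\<lambda>(t, q, z). frechet_derivative G (at (t, q, y (t, q))) (0, v, z))"
  proof (rule Ck_on_cong[OF op(3), THEN iffD1, rotated])
    fix x assume x: "x \<in> ?E"
    obtain t q z where xe: "x = (t, q, z)" by (cases x)
    have "(t, q, y (t, q)) \<in> ?D" using x yW by (auto simp: xe)
    then interpret bounded_linear "frechet_derivative G (at (t, q, y (t, q)))"
      using Ck_on_has_derivative[OF G] has_derivative_bounded_linear by blast
    let ?f = "frechet_derivative G (at (t, q, y (t, q)))"
    have z: "(0, v, z) = (0, v, 0) + (\<Sum>i\<in>Basis. (z \<bullet> i) *\<^sub>R (0, 0, i) :: real \<times> 'q \<times> 'e)"
      by (simp add: prod_eq_iff fst_sum snd_sum euclidean_representation)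
    have "?f (0, v, z) = ?f (0, v, 0) + (\<Sum>i\<in>Basis. (z \<bullet> i) *\<^sub>R ?f (0, 0, i))"
      unfolding z by (simp only: add sum scaleR)
    then show "frechet_derivative G (at (fst x, fst (snd x), y (fst x, fst (snd x)))) (0, v, 0)
      + (\<Sum>i\<in>Basis. (snd (snd x) \<bullet> i) *\<^sub>R frechet_derivative G (at (fst x, fst (snd x), y (fst x, fst (snd x)))) (0, 0, i))
      = (case x of (t, q, z) \<Rightarrow> frechet_derivative G (at (t, q, y (t, q))) (0, v, z))"
      by (simp add: xe)
  qed
qed

text \<open>
  Induction on \<open>n\<close> for all equations of this form simultaneously. The time derivative of \<open>y\<close> is \<open>G\<close>
  along \<open>y\<close>, and the directional derivatives of \<open>y\<close> in the parameter solve the linearised equation.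
  The latter is of the same form, with right-hand side of class \<open>C\<^sup>n\<close> if \<open>G\<close> is of class \<open>C\<close>^\<open>(n + 1)\<close>
  and with the same Lipschitz constant \<open>L\<close>, so the condition on the length of the time interval is
  inherited.
\<close>

lemma ode_solution_Ck:
  fixes G :: "real \<times> 'q::euclidean_space \<times> 'e::euclidean_space \<Rightarrow> 'e"
  assumes "0 < \<epsilon>" "0 \<le> L" "L * \<epsilon> \<le> 1/2" "open Q" "open W"
    and "Ck_on n ({-\<epsilon><..<\<epsilon>} \<times> Q \<times> W) G"
    and "\<And>t q a b. t \<in> {-\<epsilon><..<\<epsilon>} \<Longrightarrow> q \<in> Q \<Longrightarrow> a \<in> W \<Longrightarrow> b \<in> W \<Longrightarrow>
           norm (G (t, q, a) - G (t, q, b)) \<le> L * norm (a - b)"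
    and "continuous_on ({-\<epsilon><..<\<epsilon>} \<times> Q) y" and "Ck_on n Q (\<lambda>q. y (0, q))"
    and "\<And>t q. t \<in> {-\<epsilon><..<\<epsilon>} \<Longrightarrow> q \<in> Q \<Longrightarrow> y (t, q) \<in> W"
    and "\<And>t q. t \<in> {-\<epsilon><..<\<epsilon>} \<Longrightarrow> q \<in> Q \<Longrightarrow> ((\<lambda>t. y (t, q)) has_vector_derivative G (t, q, y (t, q))) (at t)"
  shows "Ck_on n ({-\<epsilon><..<\<epsilon>} \<times> Q) y"
  using assms
proof (induction n arbitrary: \<epsilon> Q W G y)
  case 0
  then show ?case by simp
next
  case (Suc n)
  note \<epsilon> = Suc.prems(1) and L = Suc.prems(2) and L\<epsilon> = Suc.prems(3) and oQ = Suc.prems(4) and oW = Suc.prems(5)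
    and G = Suc.prems(6) and lip = Suc.prems(7) and conty = Suc.prems(8) and init = Suc.prems(9)
    and yW = Suc.prems(10) and sol = Suc.prems(11)
  define J where "J = {-\<epsilon><..<\<epsilon>}"
  have oJ: "open J" by (simp add: J_def)
  have y: "Ck_on n (J \<times> Q) y"
    unfolding J_def
    by (rule Suc.IH[OF \<epsilon> L L\<epsilon> oQ oW Ck_on_SucD[OF G] lip conty Ck_on_SucD[OF init] yW sol])
  let ?D = "J \<times> Q \<times> W"
  have oD: "open ?D" using oJ oQ oW by (intro open_Times)
  have GD: "Ck_on (Suc n) ?D G" using G by (simp add: J_def)
  have G1: "Ck_on (Suc 0) ?D G"
  proof -
    have "Ck_on n ?D (\<lambda>x. frechet_derivative G (at x) v)" for v
      using GD unfolding Ck_on.simps by blast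
    then have "Ck_on 0 ?D (\<lambda>x. frechet_derivative G (at x) v)" for v
      using Ck_on_continuous unfolding Ck_on.simps by blast
    then show ?thesis using GD unfolding Ck_on.simps by blast
  qed
  define DG where "DG v = (\<lambda>(t, q, z). frechet_derivative G (at (t, q, y (t, q))) (0, v, z))" for v
  note coeff = smooth_dependence_step_coefficients[OF oJ oQ oW GD y yW[folded J_def]]
  have DGn: "Ck_on n (J \<times> Q \<times> UNIV) (DG v)" for v
    unfolding DG_def by (rule coeff(2))
  have DGlip: "norm (DG v (t, q, a) - DG v (t, q, b)) \<le> L * norm (a - b)" if "t \<in> J" "q \<in> Q" for v t q a b
  proof -
    have in_D: "(t, q, y (t, q)) \<in> ?D" using that yW by (auto simp: J_def)
    have der: "(G has_derivative frechet_derivative G (at (t, q, y (t, q)))) (at (t, q, y (t, q)))"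
      by (rule Ck_on_has_derivative[OF GD in_D])
    interpret bounded_linear "frechet_derivative G (at (t, q, y (t, q)))"
      by (rule has_derivative_bounded_linear[OF der])
    obtain d where d: "0 < d" "ball (y (t, q)) d \<subseteq> W"
      using oW in_D open_contains_ball by blast
    define z where "z = a - b"
    define r where "r = d / (norm z + 1)"
    have z1: "0 < norm z + 1" by (simp add: add_nonneg_pos)
    have "norm (frechet_derivative G (at (t, q, y (t, q))) (0, 0, z)) \<le> L * norm z"
    proof (rule directional_derivative_le_lipschitz[OF der])
      show "0 < r" using d z1 by (simp add: r_def)
      fix s :: real assume "\<bar>s\<bar> < r"
      then have "\<bar>s\<bar> * (norm z + 1) < d" using z1 by (simp add: r_def pos_less_divide_eq)
      then have "norm (s *\<^sub>R z) < d" by (simp add: distrib_left)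
      then have "y (t, q) + s *\<^sub>R z \<in> W" using d(2) by (auto simp: dist_norm)
      then show "norm (G ((t, q, y (t, q)) + s *\<^sub>R (0, 0, z)) - G (t, q, y (t, q))) \<le> L * norm z * \<bar>s\<bar>"
        using lip[of t q "y (t, q) + s *\<^sub>R z" "y (t, q)"] in_D by (simp add: J_def ac_simps)
    qed
    moreover have "DG v (t, q, a) - DG v (t, q, b) = frechet_derivative G (at (t, q, y (t, q))) (0, 0, z)"
      unfolding DG_def split by (subst diff[symmetric]) (simp add: z_def)
    ultimately show ?thesis by (simp add: z_def)
  qed
  define y0' where "y0' q = frechet_derivative (\<lambda>q. y (0, q)) (at q)" for q
  have y0': "((\<lambda>q. y (0, q)) has_derivative y0' q) (at q)" if "q \<in> Q" for q
    unfolding y0'_def by (rule Ck_on_has_derivative[OF init that])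
  have y0'n: "Ck_on n Q (\<lambda>q. y0' q v)" for v
    using init by (simp add: y0'_def)

  show ?case
    unfolding J_def[symmetric]
  proof (rule Ck_on_local, safe)
    fix t0 q0 assume t0: "t0 \<in> J" and q0: "q0 \<in> Q"
    obtain r where r: "0 < r" "cball q0 r \<subseteq> Q"
      using oQ q0 open_contains_cball by blast
    define \<epsilon>' where "\<epsilon>' = (\<bar>t0\<bar> + \<epsilon>) / 2"
    have \<epsilon>': "0 < \<epsilon>'" "\<bar>t0\<bar> < \<epsilon>'" "\<epsilon>' < \<epsilon>" using t0 \<epsilon> by (auto simp: \<epsilon>'_def J_def)
    have L\<epsilon>': "L * \<epsilon>' \<le> 1/2" using mult_left_mono[OF less_imp_le[OF \<epsilon>'(3)] L] L\<epsilon> by linarith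
    define J' where "J' = {-\<epsilon>'<..<\<epsilon>'}"
    define B where "B = ball q0 r"
    have J'J: "J' \<subseteq> J" using \<epsilon>' by (auto simp: J_def J'_def)
    have BQ: "B \<subseteq> Q" using r by (auto simp: B_def)
    have oJB: "open (J' \<times> B)" by (auto simp: J'_def B_def intro: open_Times)
    \<comment> \<open>clamping parameter and time to compact sets extends the linearised equation to the whole space\<close>
    define cp where "cp = closest_point (cball q0 r)"
    have cp: "cp q \<in> cball q0 r" for q unfolding cp_def by (rule closest_point_in_set) (use r in auto)
    have cpid: "cp q = q" if "q \<in> cball q0 r" for q unfolding cp_def by (rule closest_point_self[OF that])
    have contcp: "continuous_on X cp" for X
      unfolding cp_def by (rule continuous_on_closest_point) (use r in auto)
    define c where "c t = max (-\<epsilon>') (min \<epsilon>' t)" for t :: real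
    have c: "c t \<in> {-\<epsilon>'..\<epsilon>'}" for t using \<epsilon>' by (auto simp: c_def)
    have cid: "c t = t" if "t \<in> {-\<epsilon>'..\<epsilon>'}" for t using that by (auto simp: c_def)
    have contc: "continuous_on X c" for X unfolding c_def by (intro continuous_intros)
    have sub: "{-\<epsilon>'..\<epsilon>'} \<subseteq> J" using \<epsilon>' by (auto simp: J_def)

    have "\<exists>Z. continuous_on (J' \<times> B) Z \<and> (\<forall>q\<in>B. Z (0, q) = y0' q v) \<and>
        (\<forall>t\<in>J'. \<forall>q\<in>B. ((\<lambda>t. Z (t, q)) has_vector_derivative DG v (t, q, Z (t, q))) (at t))" for v
    proof -
      define H where "H = (\<lambda>(t, q, z). DG v (c t, cp q, z))"
      have contDG: "continuous_on (J \<times> Q \<times> UNIV) (DG v)" by (rule Ck_on_continuous[OF DGn])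
      have contH: "continuous_on UNIV H"
        unfolding H_def split_beta
        by (rule continuous_on_compose2[OF contDG])
          (use c cp sub r in \<open>auto intro!: continuous_intros continuous_on_compose2[OF contc] continuous_on_compose2[OF contcp]\<close>)
      have "compact (DG v ` ({-\<epsilon>'..\<epsilon>'} \<times> cball q0 r \<times> {0}))"
        by (intro compact_continuous_image[OF continuous_on_subset[OF contDG]] compact_Times)
          (use sub r in auto)
      from compact_imp_bounded[OF this] obtain M1 where "\<forall>z \<in> DG v ` ({-\<epsilon>'..\<epsilon>'} \<times> cball q0 r \<times> {0}). norm z \<le> M1"
        unfolding bounded_iff by blast
      then have M1: "norm (DG v (t, q, 0)) \<le> M1" if "t \<in> {-\<epsilon>'..\<epsilon>'}" "q \<in> cball q0 r" for t q
        using that by blast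
      have cont0: "continuous_on Q (\<lambda>q. y0' q v)" by (rule Ck_on_continuous[OF y0'n])
      have "compact ((\<lambda>q. y0' q v) ` cball q0 r)"
        by (rule compact_continuous_image[OF continuous_on_subset[OF cont0 r(2)]]) simp
      from compact_imp_bounded[OF this] obtain M2 where "\<forall>z \<in> (\<lambda>q. y0' q v) ` cball q0 r. norm z \<le> M2"
        unfolding bounded_iff by blast
      then have M2: "norm (y0' q v) \<le> M2" if "q \<in> cball q0 r" for q
        using that by blast
      have "\<exists>Z. continuous_on UNIV Z \<and> (\<forall>q. Z (0, q) = y0' (cp q) v) \<and>
        (\<forall>t\<in>{-\<epsilon>'<..<\<epsilon>'}. \<forall>q. ((\<lambda>t. Z (t, q)) has_vector_derivative H (t, q, Z (t, q))) (at t))"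
      proof (rule picard_continuous_family[OF \<epsilon>'(1) L L\<epsilon>' contH, where M = "max M1 M2" and ?y0.0 = "\<lambda>q. y0' (cp q) v"])
        show "norm (H (t, q, a) - H (t, q, b)) \<le> L * norm (a - b)" for t q a b
          unfolding H_def split by (rule DGlip) (use c cp sub r in auto)
        show "norm (H (t, q, 0)) \<le> max M1 M2" for t q
          unfolding H_def split by (rule order_trans[OF M1[OF c cp]]) simp
        show "norm (y0' (cp q) v) \<le> max M1 M2" for q
          by (rule order_trans[OF M2[OF cp]]) simp
        show "continuous_on UNIV (\<lambda>q. y0' (cp q) v)"
          by (rule continuous_on_compose2[OF cont0 contcp]) (use cp r in auto)
      qed
      then obtain Z where Z: "continuous_on UNIV Z" "\<And>q. Z (0, q) = y0' (cp q) v"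
        "\<And>t q. t \<in> {-\<epsilon>'<..<\<epsilon>'} \<Longrightarrow> ((\<lambda>t. Z (t, q)) has_vector_derivative H (t, q, Z (t, q))) (at t)"
        by blast
      show ?thesis
      proof (intro exI[of _ Z] conjI ballI)
        show "continuous_on (J' \<times> B) Z" by (rule continuous_on_subset[OF Z(1)]) simp
        show "Z (0, q) = y0' q v" if "q \<in> B" for q
          using that Z(2)[of q] cpid[of q] by (simp add: B_def)
        show "((\<lambda>t. Z (t, q)) has_vector_derivative DG v (t, q, Z (t, q))) (at t)" if "t \<in> J'" "q \<in> B" for t q
          using that Z(3)[of t q] cpid[of q] cid[of t] by (simp add: B_def J'_def H_def)
      qed
    qed
    then obtain Z where Z: "\<And>v. continuous_on (J' \<times> B) (Z v)" "\<And>v q. q \<in> B \<Longrightarrow> Z v (0, q) = y0' q v"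
      "\<And>v t q. t \<in> J' \<Longrightarrow> q \<in> B \<Longrightarrow> ((\<lambda>t. Z v (t, q)) has_vector_derivative DG v (t, q, Z v (t, q))) (at t)"
      by metis

    have Zn: "Ck_on n (J' \<times> B) (Z v)" for v
      unfolding J'_def
    proof (rule Suc.IH[of \<epsilon>' B UNIV "DG v"])
      show "Ck_on n ({-\<epsilon>'<..<\<epsilon>'} \<times> B \<times> UNIV) (DG v)"
        by (rule Ck_on_subset[OF DGn]) (use J'J BQ in \<open>auto simp: J'_def\<close>)
      show "Ck_on n B (\<lambda>q. Z v (0, q))"
        using Ck_on_cong[of B "\<lambda>q. Z v (0, q)" "\<lambda>q. y0' q v" n] Z(2) Ck_on_subset[OF y0'n BQ] by (auto simp: B_def)
      show "norm (DG v (t, q, a) - DG v (t, q, b)) \<le> L * norm (a - b)"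
        if "t \<in> {-\<epsilon>'<..<\<epsilon>'}" "q \<in> B" for t q a b
        by (rule DGlip) (use that J'J BQ in \<open>auto simp: J'_def\<close>)
    qed (use \<epsilon>' L L\<epsilon>' Z in \<open>auto simp: J'_def B_def\<close>)

    have dq: "((\<lambda>q. y (t, q)) has_derivative (\<lambda>h. Z h (t, q))) (at q)" if t: "t \<in> J'" and q: "q \<in> B" for t q
    proof -
      have sub': "{- \<bar>t\<bar>..\<bar>t\<bar>} \<subseteq> J'" using t by (auto simp: J'_def)
      have "L * \<bar>t\<bar> \<le> 1/2"
        using mult_left_mono[of "\<bar>t\<bar>" \<epsilon>' L] t L L\<epsilon>' by (simp add: J'_def abs_le_iff)
      show ?thesis
      proof (rule has_derivative_wrt_parameter[where Z = "\<lambda>h t. Z h (t, q)", OF oD G1 _ L \<open>L * \<bar>t\<bar> \<le> 1/2\<close> _ q])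
        show "(s, p, y (s, p)) \<in> ?D" if "s \<in> {- \<bar>t\<bar>..\<bar>t\<bar>}" "p \<in> B" for s p
          using yW[folded J_def, of s p] subsetD[OF J'J subsetD[OF sub' that(1)]] subsetD[OF BQ that(2)] by simp
        show "((\<lambda>t. y (t, p)) has_vector_derivative G (s, p, y (s, p))) (at s)" if "s \<in> {- \<bar>t\<bar>..\<bar>t\<bar>}" "p \<in> B" for s p
          by (rule sol[folded J_def, OF subsetD[OF J'J subsetD[OF sub' that(1)]] subsetD[OF BQ that(2)]])
        show "((\<lambda>p. y (0, p)) has_derivative y0' q) (at q)" by (rule y0') (use q BQ in auto)
        show "((\<lambda>t. Z h (t, q)) has_vector_derivative
            frechet_derivative G (at (s, q, y (s, q))) (0, h, Z h (s, q))) (at s)"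
          if "s \<in> {- \<bar>t\<bar>..\<bar>t\<bar>}" for h s
          using Z(3)[of s q h] subsetD[OF sub' that] q by (simp add: DG_def)
      qed (use lip Z q in \<open>auto simp: B_def J_def\<close>)
    qed
    \<comment> \<open>joint differentiability, since the derivative in \<open>t\<close> is continuous in both variables\<close>
    have dty: "((\<lambda>(q, t). y (t, q)) has_derivative (\<lambda>(h, \<tau>). Z h (t, q) + \<tau> *\<^sub>R G (t, q, y (t, q)))) (at (q, t))"
      if t: "t \<in> J'" and q: "q \<in> B" for t q
    proof -
      have "((\<lambda>(q, t). y (t, q)) has_derivative
         (\<lambda>(h, \<tau>). Z h (t, q) + blinfun_apply (blinfun_scaleR_left (G (t, q, y (t, q)))) \<tau>)) (at (q, t) within B \<times> J')"
      proof (rule has_derivative_partialsI[where fy = "\<lambda>q t. blinfun_scaleR_left (G (t, q, y (t, q)))"])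
        show "((\<lambda>q. y (t, q)) has_derivative (\<lambda>h. Z h (t, q))) (at q within B)"
          by (rule has_derivative_at_withinI[OF dq[OF t q]])
        show "((\<lambda>t. y (t, q)) has_derivative blinfun_apply (blinfun_scaleR_left (G (t, q, y (t, q))))) (at t within J')"
          if "q \<in> B" "t \<in> J'" for q t
          using sol[folded J_def, OF subsetD[OF J'J that(2)] subsetD[OF BQ that(1)]]
          unfolding has_vector_derivative_def blinfun_scaleR_left.rep_eq by (rule has_derivative_at_withinI)
        have "continuous_on (B \<times> J') (\<lambda>x. (snd x, fst x))" by (intro continuous_intros)
        moreover have "(\<lambda>x. (snd x, fst x)) ` (B \<times> J') \<subseteq> J \<times> Q" using J'J BQ by auto
        ultimately have "continuous_on (B \<times> J') (\<lambda>x. G (snd x, fst x, y (snd x, fst x)))"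
          using continuous_on_compose2[OF Ck_on_continuous[OF coeff(1)]] by fastforce
        then have "continuous_on (B \<times> J') (\<lambda>x. blinfun_scaleR_left (G (snd x, fst x, y (snd x, fst x))))"
          by (rule bounded_linear.continuous_on[OF bounded_linear_blinfun_scaleR_left])
        then show "continuous (at (q, t) within B \<times> J') (\<lambda>(q, t). blinfun_scaleR_left (G (t, q, y (t, q))))"
          using t q by (simp add: continuous_on_eq_continuous_within case_prod_unfold)
      qed (use t in \<open>auto simp: J'_def\<close>)
      moreover have "at (q, t) within B \<times> J' = at (q, t)"
        by (rule at_within_open) (use t q in \<open>auto simp: J'_def B_def intro: open_Times\<close>)
      ultimately show ?thesis by (simp only: blinfun_scaleR_left.rep_eq)
    qed
    have "Ck_on (Suc n) (J' \<times> B) y"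
    proof (rule Ck_on_SucI[OF oJB])
      fix x assume "x \<in> J' \<times> B"
      then obtain t q where x: "x = (t, q)" "t \<in> J'" "q \<in> B" by auto
      have sw: "((\<lambda>x. (snd x, fst x)) has_derivative (\<lambda>x. (snd x, fst x))) (at (t, q))"
        by (intro derivative_intros)
      have "((\<lambda>x. (\<lambda>(q, t). y (t, q)) (snd x, fst x)) has_derivative
          (\<lambda>x. (\<lambda>(h, \<tau>). Z h (t, q) + \<tau> *\<^sub>R G (t, q, y (t, q))) (snd x, fst x))) (at (t, q))"
        by (rule has_derivative_compose[OF sw]) (use dty[OF x(2,3)] in simp)
      then show "(y has_derivative (\<lambda>w. Z (snd w) x + fst w *\<^sub>R (\<lambda>(t, q). G (t, q, y (t, q))) x)) (at x)"
        by (simp add: x)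
    next
      fix w :: "real \<times> 'q"
      have "J' \<times> B \<subseteq> J \<times> Q" using J'J BQ by auto
      then show "Ck_on n (J' \<times> B) (\<lambda>x. Z (snd w) x + fst w *\<^sub>R (\<lambda>(t, q). G (t, q, y (t, q))) x)"
        by (intro Ck_on_add[OF oJB Zn] Ck_on_bounded_linear_compose[OF bounded_linear_scaleR_right oJB]
            Ck_on_subset[OF coeff(1)])
    qed
    then show "\<exists>V. open V \<and> (t0, q0) \<in> V \<and> Ck_on (Suc n) V y"
      using oJB \<epsilon>' r by (intro exI[of _ "J' \<times> B"]) (auto simp: J'_def B_def)
  qed
qed

section \<open>Flows\<close>

definition local_flow ::
    "('e::real_normed_vector \<Rightarrow> 'e) \<Rightarrow> 'e set \<Rightarrow> real \<Rightarrow> 'e set \<Rightarrow> (real \<times> 'e \<Rightarrow> 'e) \<Rightarrow> bool" where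
  "local_flow F N \<epsilon> Q \<phi> \<longleftrightarrow> smooth_on ({-\<epsilon><..<\<epsilon>} \<times> Q) \<phi> \<and> (\<forall>q\<in>Q. \<phi> (0, q) = q) \<and>
     (\<forall>t\<in>{-\<epsilon><..<\<epsilon>}. \<forall>q\<in>Q. \<phi> (t, q) \<in> N \<and>
        ((\<lambda>t. \<phi> (t, q)) has_vector_derivative F (\<phi> (t, q))) (at t))"

lemma local_flowD:
  assumes "local_flow F N \<epsilon> Q \<phi>"
  shows "smooth_on ({-\<epsilon><..<\<epsilon>} \<times> Q) \<phi>" and "\<And>q. q \<in> Q \<Longrightarrow> \<phi> (0, q) = q"
    and "\<And>t q. t \<in> {-\<epsilon><..<\<epsilon>} \<Longrightarrow> q \<in> Q \<Longrightarrow> \<phi> (t, q) \<in> N"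
    and "\<And>t q. t \<in> {-\<epsilon><..<\<epsilon>} \<Longrightarrow> q \<in> Q \<Longrightarrow>
           ((\<lambda>t. \<phi> (t, q)) has_vector_derivative F (\<phi> (t, q))) (at t)"
  using assms by (simp_all add: local_flow_def)

lemma local_flow_restrict:
  assumes "local_flow F N \<epsilon> Q \<phi>" "\<epsilon>' \<le> \<epsilon>" "Q' \<subseteq> Q" "N \<subseteq> N'"
  shows "local_flow F N' \<epsilon>' Q' \<phi>"
proof -
  have J: "{-\<epsilon>'<..<\<epsilon>'} \<subseteq> {-\<epsilon><..<\<epsilon>}" using assms(2) by auto
  show ?thesis
    unfolding local_flow_def
    using smooth_on_subset[OF local_flowD(1)[OF assms(1)] Sigma_mono[OF J assms(3)]]
      local_flowD(2)[OF assms(1) subsetD[OF assms(3)]]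
      local_flowD(3,4)[OF assms(1) subsetD[OF J] subsetD[OF assms(3)]] subsetD[OF assms(4)] by simp
qed

text \<open>
  Composing \<open>F\<close> with the projection to a ball around \<open>p\<close> makes it bounded and Lipschitz on the whole
  space. Since its speed is bounded, a solution starting near \<open>p\<close> does not leave the ball for a short
  time, and there the projection is the identity.
\<close>

theorem smooth_local_flow:
  fixes F :: "'e::euclidean_space \<Rightarrow> 'e"
  assumes "open N" "p \<in> N" and F: "smooth_on N F"
  obtains \<epsilon> r \<phi> where "0 < \<epsilon>" "0 < r" "local_flow F N \<epsilon> (ball p r) \<phi>"
proof -
  obtain R where R: "0 < R" "cball p R \<subseteq> N"
    using assms(1,2) open_contains_cball by blast
  have contF: "continuous_on N F" by (rule smooth_on_continuous[OF F])
  have F1: "Ck_on (Suc 0) N F" using F unfolding smooth_on_def by blast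
  obtain M where M: "0 < M" "\<And>z. z \<in> cball p R \<Longrightarrow> norm (F z) \<le> M"
    and lip: "\<And>a b. a \<in> cball p R \<Longrightarrow> b \<in> cball p R \<Longrightarrow> norm (F a - F b) \<le> M * norm (a - b)"
    using C1_bounded_and_lipschitz_on_cball[OF F1 R(2)] by metis
  define cp where "cp \<rho> = closest_point (cball p \<rho>)" for \<rho>
  have cp: "cp \<rho> q \<in> cball p \<rho>" if "0 < \<rho>" for \<rho> q
    unfolding cp_def by (rule closest_point_in_set) (use that in auto)
  have cpid: "cp \<rho> q = q" if "q \<in> cball p \<rho>" for \<rho> q
    unfolding cp_def by (rule closest_point_self[OF that])
  have contcp: "continuous_on X (cp \<rho>)" if "0 < \<rho>" for X \<rho>
    unfolding cp_def by (rule continuous_on_closest_point) (use that in auto)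
  have cplip: "norm (cp R a - cp R b) \<le> norm (a - b)" for a b
    unfolding cp_def dist_norm[symmetric] by (rule closest_point_lipschitz) (use R in auto)
  define r where "r = R / 2"
  have r: "0 < r" "r < R" using R by (auto simp: r_def)
  \<comment> \<open>short enough for the contraction property and for the solutions to stay in the ball of radius \<open>R\<close>\<close>
  define \<epsilon> where "\<epsilon> = min (1 / (2 * M)) (r / (2 * M))"
  have \<epsilon>: "0 < \<epsilon>" "M * \<epsilon> < r" "M * \<epsilon> \<le> 1/2"
  proof -
    show "0 < \<epsilon>" using M r by (simp add: \<epsilon>_def)
    have "\<epsilon> \<le> r / (2 * M)" by (simp add: \<epsilon>_def)
    then have "2 * (M * \<epsilon>) \<le> r" using M(1) by (simp add: pos_le_divide_eq algebra_simps)
    then show "M * \<epsilon> < r" using r(1) by linarith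
    have "\<epsilon> \<le> 1 / (2 * M)" by (simp add: \<epsilon>_def)
    then show "M * \<epsilon> \<le> 1/2" using M(1) by (simp add: pos_le_divide_eq algebra_simps)
  qed
  have M0: "0 \<le> M" using M(1) by simp
  define H :: "real \<times> 'e \<times> 'e \<Rightarrow> 'e" where "H = (\<lambda>(t, q, z). F (cp R z))"
  have "\<exists>\<phi>. continuous_on UNIV \<phi> \<and> (\<forall>q. \<phi> (0, q) = cp r q) \<and>
    (\<forall>t\<in>{-\<epsilon><..<\<epsilon>}. \<forall>q. ((\<lambda>t. \<phi> (t, q)) has_vector_derivative H (t, q, \<phi> (t, q))) (at t))"
  proof (rule picard_continuous_family[OF \<epsilon>(1) M0 \<epsilon>(3), where G = H and M = "max M (norm p + r)" and ?y0.0 = "cp r"])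
    show "continuous_on UNIV H"
      unfolding H_def split_beta
      by (rule continuous_on_compose2[OF contF])
        (use R cp[OF R(1)] in \<open>auto intro!: continuous_on_compose2[OF contcp[OF R(1)]] continuous_intros\<close>)
    show "norm (H (t, q, a) - H (t, q, b)) \<le> M * norm (a - b)" for t q a b
      unfolding H_def split using lip[OF cp[OF R(1)] cp[OF R(1)], of a b] mult_left_mono[OF cplip M0, of a b] by linarith
    show "norm (H (t, q, 0)) \<le> max M (norm p + r)" for t q
      unfolding H_def split by (rule order_trans[OF M(2)[OF cp[OF R(1)]]]) simp
    show "norm (cp r q) \<le> max M (norm p + r)" for q
      using cp[OF r(1), of q] norm_triangle_ineq2[of "cp r q" p] by (simp add: dist_norm norm_minus_commute)
  qed (rule contcp[OF r(1)])
  then obtain \<phi> where \<phi>: "continuous_on UNIV \<phi>" "\<And>q. \<phi> (0, q) = cp r q"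
    "\<And>t q. t \<in> {-\<epsilon><..<\<epsilon>} \<Longrightarrow> ((\<lambda>t. \<phi> (t, q)) has_vector_derivative H (t, q, \<phi> (t, q))) (at t)"
    by blast
  have inb: "\<phi> (t, q) \<in> ball p R" if t: "t \<in> {-\<epsilon><..<\<epsilon>}" and q: "q \<in> ball p r" for t q
  proof -
    have q0: "\<phi> (0, q) = q" using \<phi>(2)[of q] cpid[of q r] q by simp
    have "norm (\<phi> (t, q) - \<phi> (0, q)) \<le> M * norm (t - 0)"
    proof (rule differentiable_bound[of "{-\<epsilon><..<\<epsilon>}" "\<lambda>t. \<phi> (t, q)"])
      show "((\<lambda>t. \<phi> (t, q)) has_derivative (\<lambda>h. h *\<^sub>R H (s, q, \<phi> (s, q)))) (at s within {-\<epsilon><..<\<epsilon>})"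
        if "s \<in> {-\<epsilon><..<\<epsilon>}" for s
        using \<phi>(3)[OF that, of q] unfolding has_vector_derivative_def by (rule has_derivative_at_withinI)
      show "onorm (\<lambda>h. h *\<^sub>R H (s, q, \<phi> (s, q))) \<le> M" for s
      proof (rule onorm_bound)
        show "norm (h *\<^sub>R H (s, q, \<phi> (s, q))) \<le> M * norm h" for h
          using mult_right_mono[OF M(2)[OF cp[OF R(1), of "\<phi> (s, q)"]] abs_ge_zero[of h]]
          by (simp add: H_def mult.commute)
      qed (use M in simp)
    qed (use t \<epsilon> in auto)
    also have "\<dots> \<le> M * \<epsilon>" using t M by auto
    also have "\<dots> < r" by (rule \<epsilon>(2))
    finally have "norm (\<phi> (t, q) - q) < r" by (simp add: q0)
    then have "dist p (\<phi> (t, q)) < r + r"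
      using q dist_triangle[of p "\<phi> (t, q)" q] by (simp add: dist_norm norm_minus_commute)
    then show ?thesis by (simp add: r_def)
  qed
  have sol: "((\<lambda>t. \<phi> (t, q)) has_vector_derivative F (\<phi> (t, q))) (at t)"
    if t: "t \<in> {-\<epsilon><..<\<epsilon>}" and q: "q \<in> ball p r" for t q
    using \<phi>(3)[OF t, of q] cpid[of "\<phi> (t, q)" R] inb[OF t q] by (simp add: H_def)
  have id: "\<phi> (0, q) = q" if "q \<in> ball p r" for q
    using \<phi>(2)[of q] cpid[of q r] that by simp
  have "smooth_on ({-\<epsilon><..<\<epsilon>} \<times> ball p r) \<phi>"
    unfolding smooth_on_def
  proof
    fix n
    show "Ck_on n ({-\<epsilon><..<\<epsilon>} \<times> ball p r) \<phi>"
    proof (rule ode_solution_Ck[OF \<epsilon>(1) M0 \<epsilon>(3) open_ball open_ball, where G = "\<lambda>x. F (snd (snd x))"])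
      show "Ck_on n ({-\<epsilon><..<\<epsilon>} \<times> ball p r \<times> ball p R) (\<lambda>x. F (snd (snd x)))"
      proof (rule Ck_on_compose[where f = "\<lambda>x. snd (snd x)" and g = F, OF _ assms(1)])
        show "Ck_on n ({-\<epsilon><..<\<epsilon>} \<times> ball p r \<times> ball p R) (\<lambda>x. snd (snd x))"
          by (intro Ck_on_bounded_linear bounded_linear_compose[OF bounded_linear_snd bounded_linear_snd] open_Times) auto
        show "Ck_on n N F" using F by (simp add: smooth_on_def)
      qed (use R in \<open>auto intro!: open_Times\<close>)
      show "Ck_on n (ball p r) (\<lambda>q. \<phi> (0, q))"
        using Ck_on_cong[of "ball p r" "\<lambda>q. \<phi> (0, q)" "\<lambda>q. q" n] id
          Ck_on_bounded_linear[OF bounded_linear_ident, of "ball p r" n] by simp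
      show "continuous_on ({-\<epsilon><..<\<epsilon>} \<times> ball p r) \<phi>" by (rule continuous_on_subset[OF \<phi>(1)]) simp
    qed (use lip inb sol in auto)
  qed
  then have "local_flow F N \<epsilon> (ball p r) \<phi>"
    unfolding local_flow_def using id sol inb R(2) by fastforce
  then show thesis by (rule that[OF \<epsilon>(1) r(1)])
qed

section \<open>Symmetry of second derivatives\<close>

text \<open>
  The second difference on the left is symmetric in \<open>v\<close> and \<open>w\<close>. The mean value theorem, applied along
  \<open>v\<close> and then along \<open>w\<close>, identifies it with a mixed second derivative at a nearby point.
\<close>

lemma second_difference_mean_value:
  fixes f :: "'a::real_normed_vector \<Rightarrow> real"
  assumes f: "Ck_on 2 U f" and "0 < h"
    and inU: "\<And>s t. s \<in> {0..h} \<Longrightarrow> t \<in> {0..h} \<Longrightarrow> q + s *\<^sub>R v + t *\<^sub>R w \<in> U"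
  obtains s t where "s \<in> {0..h}" "t \<in> {0..h}"
    and "f (q + h *\<^sub>R v + h *\<^sub>R w) - f (q + h *\<^sub>R v) - f (q + h *\<^sub>R w) + f q
       = h * h * frechet_derivative (\<lambda>x. frechet_derivative f (at x) v) (at (q + s *\<^sub>R v + t *\<^sub>R w)) w"
proof -
  let ?dv = "\<lambda>x. frechet_derivative f (at x) v"
  have f1: "Ck_on (Suc 0) U f" and f2: "Ck_on (Suc 0) U ?dv"
    using f Ck_on_SucD[of "Suc 0" U f] unfolding numeral_2_eq_2 by (auto simp del: Ck_on.simps simp: Ck_on.simps(2)[of "Suc 0"])
  have line: "((\<lambda>s. g (a + s *\<^sub>R z)) has_real_derivative frechet_derivative g (at (a + s *\<^sub>R z)) z) (at s)"
    if "Ck_on (Suc 0) U g" "a + s *\<^sub>R z \<in> U" for g :: "'a \<Rightarrow> real" and a z s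
  proof -
    have dg: "(g has_derivative frechet_derivative g (at (a + s *\<^sub>R z))) (at (a + s *\<^sub>R z))"
      by (rule Ck_on_has_derivative[OF that])
    have l: "((\<lambda>s. a + s *\<^sub>R z) has_derivative (\<lambda>s. s *\<^sub>R z)) (at s)"
      by (auto intro!: derivative_eq_intros)
    have "((\<lambda>s. g (a + s *\<^sub>R z)) has_derivative (\<lambda>r. frechet_derivative g (at (a + s *\<^sub>R z)) (r *\<^sub>R z))) (at s)"
      by (rule has_derivative_compose[OF l dg])
    then show ?thesis
      using linear_simps(5)[OF has_derivative_bounded_linear[OF dg]]
      by (simp add: has_field_derivative_def mult.commute[of _ "frechet_derivative g _ z"])
  qed
  \<comment> \<open>the increment of \<open>\<phi>\<close> from 0 to \<open>h\<close> is the second difference\<close>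
  define \<phi> where "\<phi> s = f (q + h *\<^sub>R w + s *\<^sub>R v) - f (q + s *\<^sub>R v)" for s
  have "\<exists>s. 0 < s \<and> s < h \<and> \<phi> h - \<phi> 0 = (h - 0) * (?dv (q + h *\<^sub>R w + s *\<^sub>R v) - ?dv (q + s *\<^sub>R v))"
  proof (rule MVT2[OF \<open>0 < h\<close>])
    fix s assume "0 \<le> s" "s \<le> h"
    then have "q + h *\<^sub>R w + s *\<^sub>R v \<in> U" "q + s *\<^sub>R v \<in> U"
      using inU[of s h] inU[of s 0] \<open>0 < h\<close> by (simp_all add: algebra_simps)
    then show "(\<phi> has_real_derivative ?dv (q + h *\<^sub>R w + s *\<^sub>R v) - ?dv (q + s *\<^sub>R v)) (at s)"
      unfolding \<phi>_def by (intro DERIV_diff line f1)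
  qed
  then obtain s where s: "0 < s" "s < h"
    "\<phi> h - \<phi> 0 = h * (?dv (q + h *\<^sub>R w + s *\<^sub>R v) - ?dv (q + s *\<^sub>R v))" by auto
  have "\<exists>t. 0 < t \<and> t < h \<and> ?dv (q + s *\<^sub>R v + h *\<^sub>R w) - ?dv (q + s *\<^sub>R v + 0 *\<^sub>R w)
      = (h - 0) * frechet_derivative ?dv (at (q + s *\<^sub>R v + t *\<^sub>R w)) w"
  proof (rule MVT2[OF \<open>0 < h\<close>])
    fix t assume "0 \<le> t" "t \<le> h"
    then have "q + s *\<^sub>R v + t *\<^sub>R w \<in> U" using inU[of s t] s by simp
    then show "((\<lambda>t. ?dv (q + s *\<^sub>R v + t *\<^sub>R w)) has_real_derivative
        frechet_derivative ?dv (at (q + s *\<^sub>R v + t *\<^sub>R w)) w) (at t)"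
      by (rule line[OF f2])
  qed
  then obtain t where t: "0 < t" "t < h" "?dv (q + s *\<^sub>R v + h *\<^sub>R w) - ?dv (q + s *\<^sub>R v)
      = h * frechet_derivative ?dv (at (q + s *\<^sub>R v + t *\<^sub>R w)) w" by auto
  show thesis
  proof (rule that[of s t])
    have e: "q + h *\<^sub>R w + s *\<^sub>R v = q + s *\<^sub>R v + h *\<^sub>R w" by simp
    have "\<phi> h - \<phi> 0 = h * h * frechet_derivative ?dv (at (q + s *\<^sub>R v + t *\<^sub>R w)) w"
      using s(3) t(3) unfolding e by simp
    then show "f (q + h *\<^sub>R v + h *\<^sub>R w) - f (q + h *\<^sub>R v) - f (q + h *\<^sub>R w) + f q
       = h * h * frechet_derivative ?dv (at (q + s *\<^sub>R v + t *\<^sub>R w)) w"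
      by (simp add: \<phi>_def algebra_simps)
  qed (use s t in auto)
qed

text \<open>
  Schwarz's theorem: exchanging the roles of \<open>v\<close> and \<open>w\<close> in the symmetric second difference and letting
  \<open>h\<close> tend to 0 gives both mixed derivatives as the same limit.
\<close>

lemma second_derivative_symmetric:
  fixes f :: "'a::real_normed_vector \<Rightarrow> real"
  assumes "open U" "q \<in> U" and f: "Ck_on 2 U f"
  shows "frechet_derivative (\<lambda>x. frechet_derivative f (at x) v) (at q) w
       = frechet_derivative (\<lambda>x. frechet_derivative f (at x) w) (at q) v"
proof -
  define A where "A = (\<lambda>x. frechet_derivative (\<lambda>x. frechet_derivative f (at x) v) (at x) w)"
  define B where "B = (\<lambda>x. frechet_derivative (\<lambda>x. frechet_derivative f (at x) w) (at x) v)"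
  have cont: "isCont A q" "isCont B q"
    using f assms(1,2) unfolding A_def B_def numeral_2_eq_2
    by (simp_all add: continuous_on_eq_continuous_at)
  have "\<bar>A q - B q\<bar> \<le> e" if "0 < e" for e
  proof -
    have "(A \<longlongrightarrow> A q) (nhds q)" "(B \<longlongrightarrow> B q) (nhds q)"
      using cont by (simp_all add: isCont_def tendsto_at_iff_tendsto_nhds)
    then have "\<forall>\<^sub>F x in nhds q. dist (A x) (A q) < e / 2 \<and> dist (B x) (B q) < e / 2 \<and> x \<in> U"
      using \<open>0 < e\<close> by (intro eventually_conj tendstoD eventually_nhds_in_open assms) auto
    then obtain d where d: "0 < d" "\<And>x. dist x q < d \<Longrightarrow> dist (A x) (A q) < e / 2 \<and> dist (B x) (B q) < e / 2 \<and> x \<in> U"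
      unfolding eventually_nhds_metric by auto
    define h where "h = d / (norm v + norm w + 1)"
    have n: "0 < norm v + norm w + 1" by (simp add: add_nonneg_pos)
    have h: "0 < h" "h * (norm v + norm w) < d"
    proof -
      show "0 < h" using d n by (simp add: h_def)
      have "h * (norm v + norm w + 1) = d" using n by (simp add: h_def)
      then show "h * (norm v + norm w) < d" using \<open>0 < h\<close> by (simp add: algebra_simps)
    qed
    have near: "dist (q + s *\<^sub>R v + t *\<^sub>R w) q < d" if "s \<in> {0..h}" "t \<in> {0..h}" for s t
    proof -
      have "norm (s *\<^sub>R v + t *\<^sub>R w) \<le> s * norm v + t * norm w"
        using norm_triangle_ineq[of "s *\<^sub>R v" "t *\<^sub>R w"] that by simp
      also have "\<dots> \<le> h * norm v + h * norm w"
        using that by (intro add_mono mult_right_mono) auto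
      finally show ?thesis using h by (simp add: dist_norm algebra_simps)
    qed
    have near': "dist (q + s *\<^sub>R w + t *\<^sub>R v) q < d" if "s \<in> {0..h}" "t \<in> {0..h}" for s t
      using near[OF that(2,1)] by (simp add: add.commute add.left_commute)
    obtain s t where 1: "s \<in> {0..h}" "t \<in> {0..h}"
      "f (q + h *\<^sub>R v + h *\<^sub>R w) - f (q + h *\<^sub>R v) - f (q + h *\<^sub>R w) + f q = h * h * A (q + s *\<^sub>R v + t *\<^sub>R w)"
      using second_difference_mean_value[OF f h(1), of q v w] near d(2) unfolding A_def by metis
    obtain s' t' where 2: "s' \<in> {0..h}" "t' \<in> {0..h}"
      "f (q + h *\<^sub>R w + h *\<^sub>R v) - f (q + h *\<^sub>R w) - f (q + h *\<^sub>R v) + f q = h * h * B (q + s' *\<^sub>R w + t' *\<^sub>R v)"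
      using second_difference_mean_value[OF f h(1), of q w v] near' d(2) unfolding B_def by metis
    have e: "q + h *\<^sub>R w + h *\<^sub>R v = q + h *\<^sub>R v + h *\<^sub>R w" by simp
    have "h * h * A (q + s *\<^sub>R v + t *\<^sub>R w) = h * h * B (q + s' *\<^sub>R w + t' *\<^sub>R v)"
      using 1(3) 2(3) unfolding e by linarith
    then have "A (q + s *\<^sub>R v + t *\<^sub>R w) = B (q + s' *\<^sub>R w + t' *\<^sub>R v)" using h by simp
    then show ?thesis
      using d(2)[OF near[OF 1(1,2)]] d(2)[OF near'[OF 2(1,2)]] by (auto simp: dist_real_def abs_if split: if_splits)
  qed
  then have "\<bar>A q - B q\<bar> \<le> 0" by (metis dense_ge)
  then show ?thesis by (simp add: A_def B_def)
qed

section \<open>Two-by-two matrices\<close>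

text \<open>
  The adjugate, in the form given by the Cayley--Hamilton theorem.
\<close>

definition adj2 :: "real^2^2 \<Rightarrow> real^2^2" where
  "adj2 A = trace A *\<^sub>R mat 1 - A"

lemmas matrix2_simps = vec_eq_iff forall_2 sum_2 matrix_matrix_mult_def matrix_vector_mult_def mat_def
  trace_def det_2 transpose_def inner_vec_def

lemma mult_adj2: "A ** adj2 A = det A *\<^sub>R mat 1"
  by (simp add: adj2_def matrix2_simps algebra_simps)

lemma det_adj2: "det (adj2 A) = det A"
  by (simp add: adj2_def matrix2_simps algebra_simps)

lemma det_scaleR_2: "det (c *\<^sub>R A :: real^2^2) = c\<^sup>2 * det A"
  by (simp add: det_2 algebra_simps power2_eq_square)

lemma matrix_inv_eq:
  fixes A :: "real^'n^'n"
  assumes "A ** B = mat 1"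
  shows "matrix_inv A = B"
proof -
  have BA: "B ** A = mat 1" using assms matrix_left_right_inverse by blast
  have "A ** matrix_inv A = mat 1 \<and> matrix_inv A ** A = mat 1"
    unfolding matrix_inv_def by (rule someI[of _ B]) (use assms BA in blast)
  then show ?thesis
    by (metis BA matrix_mul_assoc matrix_mul_lid matrix_mul_rid)
qed

lemma matrix_inv_2:
  assumes "det A \<noteq> 0"
  shows "matrix_inv A = (1 / det A) *\<^sub>R adj2 A"
  by (rule matrix_inv_eq) (use mult_adj2[of A] assms in
    \<open>simp add: vec_eq_iff matrix_matrix_mult_def sum_2 forall_2 field_simps\<close>)

lemma matrix_inv_2_inverse:
  fixes A :: "real^2^2"
  assumes "det A \<noteq> 0"
  shows "A ** matrix_inv A = mat 1" "matrix_inv A ** A = mat 1"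
proof -
  show "A ** matrix_inv A = mat 1"
    using mult_adj2[of A] assms by (simp add: matrix_inv_2 vec_eq_iff matrix_matrix_mult_def sum_2 forall_2 field_simps)
  then show "matrix_inv A ** A = mat 1" using matrix_left_right_inverse by blast
qed

lemma inner_transpose_mult: "x \<bullet> (transpose A *v y) = (A *v x) \<bullet> (y :: real^_)"
  by (metis dot_lmul_matrix inner_commute transpose_matrix_vector transpose_transpose)

text \<open>Two plane vectors are independent iff this determinant is nonzero.\<close>

definition det2 :: "real^2 \<Rightarrow> real^2 \<Rightarrow> real" where
  "det2 v w = v$1 * w$2 - v$2 * w$1"

lemma det2_mult: "det2 (A *v v) (A *v w) = det A * det2 v w"
  by (simp add: det2_def matrix2_simps algebra_simps)

lemma det2_diff: "det2 v w - det2 v' w' = det2 (v - v') w + det2 v' (w - w')"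
  by (simp add: det2_def algebra_simps)

lemma abs_det2_le: "\<bar>det2 v w\<bar> \<le> 2 * (norm v * norm w)"
proof -
  have "\<bar>v$i * w$j\<bar> \<le> norm v * norm w" for i j
    unfolding abs_mult by (intro mult_mono component_le_norm_cart) auto
  from this[of 1 2] this[of 2 1] show ?thesis unfolding det2_def by linarith
qed

lemma lin_indep_pair_det2:
  assumes "det2 v w \<noteq> 0"
  shows "lin_indep_pair v w"
proof -
  have "v \<noteq> w" "w \<noteq> 0" using assms by (auto simp: det2_def)
  moreover have "v \<notin> span {w}"
    using assms by (auto simp: span_singleton det2_def)
  ultimately show ?thesis
    by (simp add: lin_indep_pair_def independent_insert)
qed

text \<open>
  Up to the factor \<open>det G\<close>, the matrix \<open>adj2 G ** S\<close> is \<open>matrix_inv G ** S\<close>, which is self-adjoint for the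
  inner product \<open>G\<close> and therefore has real eigenvalues. The proof completes a square as in the
  classical inequality \<open>K \<le> H\<^sup>2\<close> between the curvatures of a surface.
\<close>

lemma discriminant_nonneg:
  fixes G S :: "real^2^2"
  assumes "transpose G = G" "transpose S = S" "0 < det G" "0 < G$1$1"
  shows "4 * det (adj2 G ** S) \<le> (trace (adj2 G ** S))\<^sup>2"
proof -
  define E F H a b c where "E = G$1$1" and "F = G$1$2" and "H = G$2$2" and "a = S$1$1" and "b = S$1$2" and "c = S$2$2"
  have G: "G$2$1 = F" and S: "S$2$1 = b"
    using assms(1,2) by (auto simp: F_def b_def vec_eq_iff transpose_def)
  have "0 < E * H - F * F" using assms(3) by (simp add: det_2 G E_def F_def H_def)
  have E: "0 < E" using assms(4) by (simp add: E_def)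
  define \<Delta> where "\<Delta> = (trace (adj2 G ** S))\<^sup>2 - 4 * det (adj2 G ** S)"
  have eq: "\<Delta> = (H*a - 2*F*b + E*c)\<^sup>2 - 4 * (E*H - F*F) * (a*c - b*b)"
    by (simp add: \<Delta>_def adj2_def matrix2_simps G S E_def[symmetric] F_def[symmetric] H_def[symmetric]
        a_def[symmetric] b_def[symmetric] c_def[symmetric] algebra_simps power2_eq_square)
  have "E\<^sup>2 * \<Delta> = (E * (E*c - H*a) - 2*F*(E*b - F*a))\<^sup>2 + 4 * (E*H - F*F) * (E*b - F*a)\<^sup>2"
    unfolding eq by (simp add: algebra_simps power2_eq_square)
  also have "\<dots> \<ge> 0" using \<open>0 < E * H - F * F\<close> by simp
  finally have "0 \<le> \<Delta>" using E by (simp add: zero_le_mult_iff)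
  then show ?thesis by (simp add: \<Delta>_def)
qed

lemma matrix_mult_uminus [simp]:
  fixes A :: "real^'n^'m" and B :: "real^'k^'n"
  shows "(- A) ** B = - (A ** B)" "A ** (- B) = - (A ** B)"
  by (simp_all add: vec_eq_iff matrix_matrix_mult_def sum_negf)

text \<open>
  Polarization: three values of its quadratic form determine a symmetric matrix.
\<close>

lemma quadratic_form_matrix2:
  fixes S :: "real^2^2"
  assumes "transpose S = S"
  defines "b \<equiv> \<lambda>e. e \<bullet> (S *v e)"
  shows "S = (\<chi> i j. if i = j then b (axis i 1)
    else (b (axis 1 1 + axis 2 1) - b (axis 1 1) - b (axis 2 1)) / 2)"
proof -
  have "S $ 2 $ 1 = S $ 1 $ 2" using assms(1) by (auto simp: vec_eq_iff transpose_def)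
  then show ?thesis
    by (simp add: b_def vec_eq_iff forall_2 matrix_vector_mult_def inner_vec_def sum_2 axis_def)
qed

section \<open>Smooth matrix functions and eigenvector fields\<close>

lemma smooth_on_matrixI:
  fixes A :: "'a::real_normed_vector \<Rightarrow> real^'n^'m"
  assumes "open S" "\<And>i j. smooth_on S (\<lambda>x. A x $ i $ j)"
  shows "smooth_on S A"
  by (intro smooth_on_vecI assms)

lemma smooth_on_matrix_entry:
  fixes A :: "'a::real_normed_vector \<Rightarrow> real^'n^'m"
  assumes "open S" "smooth_on S A"
  shows "smooth_on S (\<lambda>x. A x $ i $ j)"
  by (intro smooth_on_vec_nth assms)

lemma smooth_on_matrix_mult:
  fixes A :: "'a::real_normed_vector \<Rightarrow> real^'n^'m" and B :: "'a \<Rightarrow> real^'k^'n"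
  assumes "open S" "smooth_on S A" "smooth_on S B"
  shows "smooth_on S (\<lambda>x. A x ** B x)"
  by (rule smooth_on_matrixI[OF assms(1)])
     (simp add: matrix_matrix_mult_def, intro smooth_on_sum smooth_on_mult smooth_on_matrix_entry assms)

lemma smooth_on_matrix_vector_mult:
  fixes A :: "'a::real_normed_vector \<Rightarrow> real^'n^'m"
  assumes "open S" "smooth_on S A" "smooth_on S v"
  shows "smooth_on S (\<lambda>x. A x *v v x)"
  by (rule smooth_on_vecI[OF assms(1)])
     (simp add: matrix_vector_mult_def, intro smooth_on_sum smooth_on_mult smooth_on_matrix_entry smooth_on_vec_nth assms)

lemma smooth_on_transpose:
  fixes A :: "'a::real_normed_vector \<Rightarrow> real^'n^'m"
  assumes "open S" "smooth_on S A"
  shows "smooth_on S (\<lambda>x. transpose (A x))"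
  by (rule smooth_on_matrixI[OF assms(1)])
     (simp add: transpose_def, intro smooth_on_matrix_entry assms)

lemma smooth_on_trace:
  fixes A :: "'a::real_normed_vector \<Rightarrow> real^'n^'n"
  assumes "open S" "smooth_on S A"
  shows "smooth_on S (\<lambda>x. trace (A x))"
  unfolding trace_def by (intro smooth_on_sum smooth_on_matrix_entry assms)

lemma smooth_on_det2x2:
  fixes A :: "'a::real_normed_vector \<Rightarrow> real^2^2"
  assumes "open S" "smooth_on S A"
  shows "smooth_on S (\<lambda>x. det (A x))"
  unfolding det_2 by (intro smooth_on_diff smooth_on_mult smooth_on_matrix_entry assms)

lemma smooth_on_adj2:
  assumes "open S" "smooth_on S A"
  shows "smooth_on S (\<lambda>x. adj2 (A x))"
  unfolding adj2_def by (intro smooth_on_diff smooth_on_scaleR smooth_on_trace smooth_on_const assms)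

lemma smooth_on_matrix_inv:
  fixes A :: "'a::real_normed_vector \<Rightarrow> real^2^2"
  assumes "open S" "smooth_on S A" "\<And>x. x \<in> S \<Longrightarrow> det (A x) \<noteq> 0"
  shows "smooth_on S (\<lambda>x. matrix_inv (A x))"
proof -
  have "smooth_on S (\<lambda>x. (1 / det (A x)) *\<^sub>R adj2 (A x))"
    by (intro smooth_on_scaleR smooth_on_divide smooth_on_const smooth_on_det2x2 smooth_on_adj2 assms)
  then show ?thesis
    using smooth_on_cong[OF assms(1), of "\<lambda>x. matrix_inv (A x)"] matrix_inv_2 assms(3) by fastforce
qed

lemma jacobian_mult:
  assumes "f differentiable (at q)"
  shows "jacobian f (at q) *v v = frechet_derivative f (at q) (v :: real^_)"
  using assms[unfolded jacobian_works] frechet_derivative_at by metis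

lemma smooth_on_jacobian:
  fixes f :: "real^'n \<Rightarrow> real^'m"
  assumes "open S" "smooth_on S f"
  shows "smooth_on S (\<lambda>x. jacobian f (at x))"
  by (rule smooth_on_matrixI[OF assms(1)])
     (simp add: jacobian_def matrix_def, intro smooth_on_vec_nth smooth_on_frechet_derivative assms)

text \<open>
  By the Cayley--Hamilton theorem \<open>(A - k) (A - k') = 0\<close>, so the image of \<open>A - k'\<close> consists of
  eigenvectors for \<open>k\<close>.
\<close>

lemma eigenvector_2:
  fixes A :: "real^2^2"
  assumes "k + k' = trace A" "k * k' = det A"
  shows "A *v ((A - k' *\<^sub>R mat 1) *v e) = k *\<^sub>R ((A - k' *\<^sub>R mat 1) *v e)"
proof -
  have h: "k + k' = A$1$1 + A$2$2" "k * k' = A$1$1 * A$2$2 - A$1$2 * A$2$1"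
    using assms by (simp_all add: trace_def sum_2 det_2)
  show ?thesis
    unfolding vec_eq_iff forall_2 matrix_vector_mult_def sum_2
    using h by (simp add: mat_def) algebra
qed

lemma det2_eigenvectors:
  fixes A :: "real^2^2"
  assumes "A *v v = k *\<^sub>R v" "A *v w = k' *\<^sub>R w" "k \<noteq> k'" "v \<noteq> 0" "w \<noteq> 0"
  shows "det2 v w \<noteq> 0"
proof
  assume 0: "det2 v w = 0"
  have "\<exists>c. v = c *\<^sub>R w"
  proof (cases "w$1 = 0")
    case True
    then have "w$2 \<noteq> 0" using assms(5) by (simp add: vec_eq_iff forall_2)
    then show ?thesis using 0 True
      by (intro exI[of _ "v$2 / w$2"]) (simp add: det2_def vec_eq_iff forall_2)
  next
    case False
    then show ?thesis using 0
      by (intro exI[of _ "v$1 / w$1"]) (simp add: det2_def vec_eq_iff forall_2 field_simps)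
  qed
  then obtain c where c: "v = c *\<^sub>R w" by blast
  then have "A *v v = k' *\<^sub>R v" by (simp add: matrix_vector_mult_scaleR assms(2))
  then have "(k - k') *\<^sub>R v = 0" by (simp add: assms(1) scaleR_left_diff_distrib)
  then show False using assms(3,4) by simp
qed

text \<open>
  Near \<open>p\<close> the eigenvalues are distinct and smooth, being given by the quadratic formula with positive
  discriminant. By \<open>eigenvector_2\<close>, applying \<open>A - k'\<close> to a fixed vector \<open>e\<close> gives a smooth eigenvector
  field for the other eigenvalue \<open>k\<close>, and a suitable \<open>e\<close> makes it nonzero at \<open>p\<close>.
\<close>

lemma smooth_eigenvectors:
  fixes A :: "real^2 \<Rightarrow> real^2^2"
  assumes "open U" "p \<in> U" and A: "smooth_on U A" and disc: "4 * det (A p) < (trace (A p))\<^sup>2"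
  obtains N k1 k2 \<omega>1 \<omega>2 where "open N" "p \<in> N" "N \<subseteq> U" "smooth_on N \<omega>1" "smooth_on N \<omega>2"
    and "\<And>q. q \<in> N \<Longrightarrow> A q *v \<omega>1 q = k1 q *\<^sub>R \<omega>1 q"
    and "\<And>q. q \<in> N \<Longrightarrow> A q *v \<omega>2 q = k2 q *\<^sub>R \<omega>2 q"
    and "\<And>q. q \<in> N \<Longrightarrow> det2 (\<omega>1 q) (\<omega>2 q) \<noteq> 0"
proof -
  define \<Delta> where "\<Delta> q = (trace (A q))\<^sup>2 - 4 * det (A q)" for q
  have smooth_\<Delta>: "smooth_on U \<Delta>"
    unfolding \<Delta>_def power2_eq_square
    by (intro smooth_on_diff smooth_on_mult smooth_on_const smooth_on_trace smooth_on_det2x2 A assms(1))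
  define V where "V = U \<inter> \<Delta> -` {0<..}"
  have oV: "open V" unfolding V_def
    by (rule continuous_open_preimage[OF smooth_on_continuous[OF smooth_\<Delta>] assms(1)]) simp
  have VU: "V \<subseteq> U" and pV: "p \<in> V" using assms(2) disc by (auto simp: V_def \<Delta>_def)
  define k where "k s q = (trace (A q) + s * sqrt (\<Delta> q)) / 2" for s q
  have smooth_k: "smooth_on V (k s)" for s
    unfolding k_def[abs_def]
    by (intro smooth_on_divide smooth_on_add smooth_on_mult smooth_on_const smooth_on_sqrt smooth_on_trace oV
        smooth_on_subset[OF A VU] smooth_on_subset[OF smooth_\<Delta> VU]) (auto simp: V_def)
  have ks: "k s q + k (- s) q = trace (A q)" "k s q * k (- s) q = det (A q)" "k s q \<noteq> k (- s) q"
    if "q \<in> V" "s\<^sup>2 = 1" for s q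
  proof -
    have pos: "0 < \<Delta> q" using that by (simp add: V_def)
    show "k s q + k (- s) q = trace (A q)" by (simp add: k_def field_simps)
    have "k s q * k (- s) q = ((trace (A q))\<^sup>2 - s\<^sup>2 * (sqrt (\<Delta> q))\<^sup>2) / 4"
      by (simp add: k_def field_simps power2_eq_square)
    then show "k s q * k (- s) q = det (A q)" using pos that by (simp add: \<Delta>_def)
    have "s \<noteq> 0" using that by auto
    then show "k s q \<noteq> k (- s) q" using pos by (simp add: k_def)
  qed
  define \<omega> where "\<omega> s e q = (A q - k (- s) q *\<^sub>R mat 1) *v e" for s e q
  have smooth_\<omega>: "smooth_on V (\<omega> s e)" for s e
    unfolding \<omega>_def[abs_def]
    by (intro smooth_on_matrix_vector_mult smooth_on_diff smooth_on_scaleR smooth_on_const smooth_k oV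
        smooth_on_subset[OF A VU])
  have eig: "A q *v \<omega> s e q = k s q *\<^sub>R \<omega> s e q" if "q \<in> V" "s\<^sup>2 = 1" for s e q
    unfolding \<omega>_def by (rule eigenvector_2[OF ks(1,2)[OF that]])
  have ex: "\<exists>e. \<omega> s e p \<noteq> 0" for s
  proof (rule ccontr)
    assume "\<nexists>e. \<omega> s e p \<noteq> 0"
    then have "A p = k (- s) p *\<^sub>R mat 1"
      unfolding \<omega>_def by (metis eq_iff_diff_eq_0 matrix_eq matrix_vector_mult_0)
    then have "(trace (A p))\<^sup>2 = 4 * det (A p)"
      by (simp add: trace_def det_2 sum_2 mat_def power2_eq_square)
    then show False using disc by simp
  qed
  obtain e1 e2 where e: "\<omega> 1 e1 p \<noteq> 0" "\<omega> (-1) e2 p \<noteq> 0" using ex by metis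
  define N where "N = (V \<inter> \<omega> 1 e1 -` (- {0})) \<inter> (V \<inter> \<omega> (-1) e2 -` (- {0}))"
  have oN: "open N"
    unfolding N_def by (intro open_Int continuous_open_preimage smooth_on_continuous smooth_\<omega> oV open_Compl closed_singleton)
  show thesis
  proof (rule that[of N "\<omega> 1 e1" "\<omega> (-1) e2" "k 1" "k (-1)"])
    show "p \<in> N" using e pV by (simp add: N_def)
    have NV: "N \<subseteq> V" by (auto simp: N_def)
    then show "N \<subseteq> U" using VU by blast
    show "smooth_on N (\<omega> 1 e1)" "smooth_on N (\<omega> (-1) e2)"
      by (rule smooth_on_subset[OF smooth_\<omega> NV])+
    fix q assume q: "q \<in> N"
    then have qV: "q \<in> V" by (simp add: N_def)
    show 1: "A q *v \<omega> 1 e1 q = k 1 q *\<^sub>R \<omega> 1 e1 q" by (rule eig[OF qV]) simp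
    show 2: "A q *v \<omega> (-1) e2 q = k (-1) q *\<^sub>R \<omega> (-1) e2 q" by (rule eig[OF qV]) simp
    show "det2 (\<omega> 1 e1 q) (\<omega> (-1) e2 q) \<noteq> 0"
      by (rule det2_eigenvectors[OF 1 2]) (use ks(3)[OF qV, of 1] q in \<open>auto simp: N_def\<close>)
  qed (rule oN)
qed

section \<open>The moving frame of a frontal\<close>

lemma columns_mult: "(W :: real^2^'m) *v v = v$1 *\<^sub>R column 1 W + v$2 *\<^sub>R column 2 W"
  by (simp add: vec_eq_iff matrix_vector_mult_def sum_2 column_def mult.commute)

lemma inner_gram: "(W *v v) \<bullet> (W *v w) = v \<bullet> ((transpose W ** W) *v (w :: real^_))" for W :: "real^'n^'m"
  by (simp only: matrix_vector_mul_assoc[symmetric] inner_transpose_mult)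

lemma transpose_gram: "transpose (transpose W ** W) = transpose W ** (W :: real^'n^'m)"
  by (simp add: matrix_transpose_mul)

lemma cross3_nonzero:
  assumes "lin_indep_pair v w"
  shows "cross3 v w \<noteq> 0"
proof
  assume "cross3 v w = 0"
  then have eq: "(w \<bullet> w) *\<^sub>R v = (w \<bullet> v) *\<^sub>R w"
    using Lagrange[of w v w] by simp
  have "v \<noteq> w" "independent {v, w}" using assms by (simp_all add: lin_indep_pair_def)
  then have w: "w \<noteq> 0" "v \<notin> span {w}" by (auto simp: independent_insert)
  have "v = (1 / (w \<bullet> w)) *\<^sub>R ((w \<bullet> w) *\<^sub>R v)" using w(1) by simp
  also have "\<dots> \<in> span {w}" unfolding eq by (intro span_scale span_base) simp
  finally show False using w(2) by simp
qed

lemma det_gram: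
  fixes W :: "real^2^3"
  shows "det (transpose W ** W) = (norm (cross3 (column 1 W) (column 2 W)))\<^sup>2"
  unfolding norm_cross unfolding power2_norm_eq_inner
  by (simp add: det_2 matrix_matrix_mult_def transpose_def column_def inner_vec_def power2_eq_square ac_simps)

text \<open>
  The matrix \<open>W ** matrix_inv (transpose W ** W) ** transpose W\<close> is the orthogonal projection onto the
  plane spanned by the columns of \<open>W\<close>, that is, onto the orthogonal complement of their cross product.
\<close>

lemma frame_expansion:
  fixes W :: "real^2^3"
  assumes N: "cross3 (column 1 W) (column 2 W) \<noteq> 0" and v: "cross3 (column 1 W) (column 2 W) \<bullet> v = 0"
  shows "W *v (matrix_inv (transpose W ** W) *v (transpose W *v v)) = v"
proof -
  let ?G = "transpose W ** W" and ?N = "cross3 (column 1 W) (column 2 W)"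
  have G: "det ?G \<noteq> 0" using N by (simp add: det_gram)
  \<comment> \<open>\<open>u\<close> is orthogonal to both columns and to their cross product\<close>
  define u where "u = W *v (matrix_inv ?G *v (transpose W *v v)) - v"
  have "transpose W *v u = (?G ** matrix_inv ?G) *v (transpose W *v v) - transpose W *v v"
    by (simp only: u_def matrix_vector_mult_diff_distrib matrix_vector_mul_assoc matrix_mul_assoc)
  then have "transpose W *v u = 0"
    by (simp only: matrix_inv_2_inverse(1)[OF G] matrix_vector_mul_lid) simp
  then have "(W *v z) \<bullet> u = 0" for z
    by (metis inner_transpose_mult inner_zero_right)
  then have c: "column i W \<bullet> u = 0" for i
    by (metis matrix_vector_mult_basis)
  have "?N \<bullet> (W *v z) = 0" for z
    by (simp add: columns_mult inner_add_right dot_cross_self)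
  then have "?N \<bullet> u = 0" using v by (simp add: u_def inner_diff_right)
  moreover have "cross3 u ?N = 0"
    using c[of 1] c[of 2] by (simp add: Lagrange inner_commute)
  ultimately have "u = 0" using norm_and_cross_eq_0[of u ?N] N by (simp add: inner_commute)
  then show ?thesis by (simp add: u_def)
qed

locale framed_map =
  fixes U :: "(real^2) set" and x :: "real^2 \<Rightarrow> real^3" and \<Omega> :: "real^2 \<Rightarrow> real^2^3"
  assumes open_U: "open U" and smooth_x: "smooth_on U x" and tmb: "tangent_moving_basis U x \<Omega>"
begin

abbreviation n :: "real^2 \<Rightarrow> real^3" where "n \<equiv> normal_field \<Omega>"

text \<open>
  \<open>G\<close> is the Gram matrix of the frame; \<open>L\<close> and \<open>M\<close> are the coordinate matrices of \<open>Dx\<close> and \<open>Dn\<close> in the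
  frame, see \<open>Jac_x\<close> and \<open>Jac_n\<close> below. The transpose in \<open>L\<close> makes it act on tangent vectors of \<open>U\<close>.
\<close>

definition G :: "real^2 \<Rightarrow> real^2^2" where "G q = transpose (\<Omega> q) ** \<Omega> q"
definition L :: "real^2 \<Rightarrow> real^2^2" where "L q = transpose (Lambda x \<Omega> q)"
definition M :: "real^2 \<Rightarrow> real^2^2" where "M q = matrix_inv (G q) ** transpose (\<Omega> q) ** Jac n q"

lemma smooth_\<Omega>: "smooth_on U \<Omega>"
  using tmb by (simp add: tangent_moving_basis_def)

lemma cross_nonzero: "q \<in> U \<Longrightarrow> cross3 (column 1 (\<Omega> q)) (column 2 (\<Omega> q)) \<noteq> 0"
  using tmb by (simp add: tangent_moving_basis_def cross3_nonzero)

lemma det_G_pos: "q \<in> U \<Longrightarrow> 0 < det (G q)"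
  using cross_nonzero[of q] by (simp add: G_def det_gram)

lemma G_sym: "transpose (G q) = G q"
  by (simp add: G_def transpose_gram)

lemma frame_inner: "(\<Omega> q *v v) \<bullet> (\<Omega> q *v w) = v \<bullet> (G q *v w)"
  by (simp only: G_def inner_gram)

lemma normal_expansion:
  assumes "q \<in> U" "n q \<bullet> v = 0"
  shows "\<Omega> q *v ((matrix_inv (G q) ** transpose (\<Omega> q)) *v v) = v"
  using frame_expansion[OF cross_nonzero[OF assms(1)], of v] assms(2) cross_nonzero[OF assms(1)]
  by (simp add: normal_field_def Let_def G_def matrix_vector_mul_assoc[symmetric])

lemma frame_inj:
  assumes "q \<in> U" "\<Omega> q *v v = 0"
  shows "v = 0"
proof -
  have "G q *v v = 0" using assms(2) by (simp add: G_def matrix_vector_mul_assoc[symmetric])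
  then have "(matrix_inv (G q) ** G q) *v v = 0" by (simp add: matrix_vector_mul_assoc[symmetric])
  then show ?thesis using det_G_pos[OF assms(1)] by (simp add: matrix_inv_2_inverse)
qed

lemma normal_frame: "n q \<bullet> (\<Omega> q *v v) = 0"
  by (simp add: normal_field_def Let_def columns_mult inner_add_right dot_cross_self)

lemma normal_unit: "q \<in> U \<Longrightarrow> n q \<bullet> n q = 1"
  using cross_nonzero[of q] by (simp add: normal_field_def Let_def dot_square_norm power2_eq_square field_simps)

lemma smooth_n: "smooth_on U n"
proof -
  have c: "smooth_on U (\<lambda>q. column i (\<Omega> q) $ j)" for i j
    unfolding column_def by (simp, intro smooth_on_matrix_entry open_U smooth_\<Omega>)
  have N: "smooth_on U (\<lambda>q. cross3 (column 1 (\<Omega> q)) (column 2 (\<Omega> q)))"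
  proof (rule smooth_on_vecI[OF open_U])
    fix i :: 3
    consider "i = 1" | "i = 2" | "i = 3" using exhaust_3 by blast
    then show "smooth_on U (\<lambda>q. cross3 (column 1 (\<Omega> q)) (column 2 (\<Omega> q)) $ i)"
      by cases (simp only: cross_components, intro smooth_on_diff smooth_on_mult c open_U)+
  qed
  have "smooth_on U (\<lambda>q. norm (cross3 (column 1 (\<Omega> q)) (column 2 (\<Omega> q))))"
    unfolding norm_eq_sqrt_inner
    by (intro smooth_on_sqrt smooth_on_inner N open_U) (use cross_nonzero in auto)
  then show ?thesis
    unfolding normal_field_def[abs_def] Let_def
    by (intro smooth_on_scaleR smooth_on_divide smooth_on_const N open_U) (use cross_nonzero in auto)
qed

lemma smooth_G: "smooth_on U G"
  unfolding G_def[abs_def] by (intro smooth_on_matrix_mult smooth_on_transpose open_U smooth_\<Omega>)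

lemma smooth_inv_G: "smooth_on U (\<lambda>q. matrix_inv (G q))"
  by (intro smooth_on_matrix_inv open_U smooth_G) (use det_G_pos in fastforce)

lemma smooth_L: "smooth_on U L"
  unfolding L_def[abs_def] Lambda_def G_def[symmetric]
  by (intro smooth_on_transpose smooth_on_matrix_mult smooth_on_jacobian smooth_inv_G smooth_x smooth_\<Omega> open_U)

lemma smooth_M: "smooth_on U M"
  unfolding M_def[abs_def]
  by (intro smooth_on_transpose smooth_on_matrix_mult smooth_on_jacobian smooth_inv_G smooth_n smooth_\<Omega> open_U)

lemma transpose_inv_G:
  assumes "q \<in> U"
  shows "transpose (matrix_inv (G q)) = matrix_inv (G q)"
proof -
  have "G q ** transpose (matrix_inv (G q)) = transpose (matrix_inv (G q) ** G q)"
    by (simp only: matrix_transpose_mul G_sym)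
  also have "\<dots> = mat 1"
    using det_G_pos[OF assms] by (simp add: matrix_inv_2_inverse transpose_mat)
  finally show ?thesis by (rule matrix_inv_eq[symmetric])
qed

lemma L_eq: "q \<in> U \<Longrightarrow> L q = matrix_inv (G q) ** transpose (\<Omega> q) ** Jac x q"
  by (simp add: L_def Lambda_def G_def[symmetric] matrix_transpose_mul transpose_inv_G matrix_mul_assoc)

lemma normal_dx:
  assumes "q \<in> U"
  shows "n q \<bullet> (Jac x q *v v) = 0"
proof -
  have "n q \<bullet> c = 0" if "c \<in> span {column 1 (\<Omega> q), column 2 (\<Omega> q)}" for c
    using that
  proof (induction rule: span_induct_alt)
    case (step r z y)
    then have "n q \<bullet> z = 0" using normal_frame[of q "axis _ 1"] by (auto simp: matrix_vector_mult_basis)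
    then show ?case using step by (simp add: inner_add_right)
  qed simp
  then show ?thesis
    using tmb assms by (simp add: columns_mult inner_add_right tangent_moving_basis_def)
qed

lemma normal_dn:
  assumes "q \<in> U"
  shows "n q \<bullet> (Jac n q *v v) = 0"
proof -
  have d: "(n has_derivative (\<lambda>v. Jac n q *v v)) (at q)"
    using smooth_on_differentiable[OF smooth_n assms] jacobian_works by blast
  have "((\<lambda>q. n q \<bullet> n q) has_derivative (\<lambda>v. n q \<bullet> (Jac n q *v v) + (Jac n q *v v) \<bullet> n q)) (at q)"
    by (rule has_derivative_inner[OF d d])
  moreover have "((\<lambda>q. n q \<bullet> n q) has_derivative (\<lambda>v. 0)) (at q)"
    by (rule has_derivative_transform_within_open[OF has_derivative_const[of 1] open_U assms])
       (simp add: normal_unit)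
  ultimately have "(\<lambda>v. n q \<bullet> (Jac n q *v v) + (Jac n q *v v) \<bullet> n q) = (\<lambda>v. 0)"
    by (rule has_derivative_unique)
  from fun_cong[OF this, of v] show ?thesis by (simp add: inner_commute)
qed

lemma Jac_x: "q \<in> U \<Longrightarrow> Jac x q = \<Omega> q ** L q"
  using normal_expansion[OF _ normal_dx]
  by (simp add: matrix_eq L_eq matrix_vector_mul_assoc[symmetric])

lemma Jac_n: "q \<in> U \<Longrightarrow> Jac n q = \<Omega> q ** M q"
  using normal_expansion[OF _ normal_dn]
  by (simp add: matrix_eq M_def matrix_vector_mul_assoc[symmetric])

text \<open>
  The frame is injective at every point of \<open>U\<close>, so \<open>Dx\<close> is injective exactly where its coordinate
  matrix is.
\<close>

lemma regular_iff:
  assumes "q \<in> U"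
  shows "q \<notin> singular_set U x \<longleftrightarrow> det (L q) \<noteq> 0"
proof -
  have "frechet_derivative x (at q) = (\<lambda>v. \<Omega> q *v (L q *v v))"
    using jacobian_mult[OF smooth_on_differentiable[OF smooth_x assms]] Jac_x[OF assms]
    by (simp add: fun_eq_iff matrix_vector_mul_assoc)
  moreover have "inj ((*v) (\<Omega> q))"
    by (rule injI) (metis frame_inj[OF assms] eq_iff_diff_eq_0 matrix_vector_mult_diff_distrib)
  ultimately have "inj (frechet_derivative x (at q)) \<longleftrightarrow> inj ((*v) (L q))"
    by (auto simp: inj_def)
  then show ?thesis
    using assms det_nz_iff_inj[of "(*v) (L q)"] by (simp add: singular_set_def)
qed

text \<open>
  Differentiating the orthogonality of \<open>n\<close> to the partial derivatives of \<open>x\<close> expresses the entries as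
  inner products of \<open>n\<close> with second derivatives of \<open>x\<close>, which are symmetric by Schwarz's theorem.
\<close>

lemma second_form_symmetric:
  assumes "q \<in> U"
  shows "transpose (second_form x \<Omega> q) = second_form x \<Omega> q"
proof -
  let ?e = "\<lambda>i. axis i 1 :: real^2"
  have dx: "frechet_derivative x (at r) v = Jac x r *v v" if "r \<in> U" for r v
    using jacobian_mult[OF smooth_on_differentiable[OF smooth_x that]] by simp
  have key: "(Jac n q *v w) \<bullet> (Jac x q *v v) = - (n q \<bullet> frechet_derivative (\<lambda>r. frechet_derivative x (at r) v) (at q) w)" for v w
  proof -
    have "(n has_derivative (\<lambda>v. Jac n q *v v)) (at q)"
      using smooth_on_differentiable[OF smooth_n assms] jacobian_works by blast
    from has_derivative_inner[OF this
        smooth_on_has_derivative[OF smooth_on_frechet_derivative[OF smooth_x, of v] assms]]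
    have "((\<lambda>r. n r \<bullet> frechet_derivative x (at r) v) has_derivative
       (\<lambda>w. n q \<bullet> frechet_derivative (\<lambda>r. frechet_derivative x (at r) v) (at q) w
           + (Jac n q *v w) \<bullet> frechet_derivative x (at q) v)) (at q)" .
    moreover have "((\<lambda>r. n r \<bullet> frechet_derivative x (at r) v) has_derivative (\<lambda>w. 0)) (at q)"
      by (rule has_derivative_transform_within_open[OF has_derivative_const[of 0] open_U assms])
         (simp add: normal_dx dx)
    ultimately have "(\<lambda>w. n q \<bullet> frechet_derivative (\<lambda>r. frechet_derivative x (at r) v) (at q) w
           + (Jac n q *v w) \<bullet> frechet_derivative x (at q) v) = (\<lambda>w. 0)"
      by (rule has_derivative_unique)
    from fun_cong[OF this, of w] show ?thesis by (simp add: dx[OF assms])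
  qed
  have comm: "n q \<bullet> frechet_derivative (\<lambda>r. frechet_derivative x (at r) v) (at q) w
      = n q \<bullet> frechet_derivative (\<lambda>r. frechet_derivative x (at r) w) (at q) v" for v w
  proof -
    define f where "f r = n q \<bullet> x r" for r
    have smooth_f: "smooth_on U f"
      unfolding f_def[abs_def] by (intro smooth_on_inner smooth_on_const smooth_x open_U)
    have df: "frechet_derivative f (at r) z = n q \<bullet> frechet_derivative x (at r) z" if "r \<in> U" for r z
    proof -
      have "(f has_derivative (\<lambda>z. n q \<bullet> frechet_derivative x (at r) z)) (at r)"
        unfolding f_def[abs_def] by (intro has_derivative_inner_right smooth_on_has_derivative[OF smooth_x that])
      then show ?thesis by (metis frechet_derivative_at)
    qed
    have ddf: "frechet_derivative (\<lambda>r. frechet_derivative f (at r) z) (at q) w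
       = n q \<bullet> frechet_derivative (\<lambda>r. frechet_derivative x (at r) z) (at q) w" for z w
    proof -
      have "((\<lambda>r. n q \<bullet> frechet_derivative x (at r) z) has_derivative
          (\<lambda>w. n q \<bullet> frechet_derivative (\<lambda>r. frechet_derivative x (at r) z) (at q) w)) (at q)"
        by (intro has_derivative_inner_right
            smooth_on_has_derivative[OF smooth_on_frechet_derivative[OF smooth_x] assms])
      then have "((\<lambda>r. frechet_derivative f (at r) z) has_derivative
          (\<lambda>w. n q \<bullet> frechet_derivative (\<lambda>r. frechet_derivative x (at r) z) (at q) w)) (at q)"
        by (rule has_derivative_transform_within_open[OF _ open_U assms]) (simp add: df)
      then show ?thesis by (metis frechet_derivative_at)
    qed
    have "Ck_on 2 U f" using smooth_f by (simp add: smooth_on_def)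
    from second_derivative_symmetric[OF open_U assms this, of v w] show ?thesis
      by (simp add: ddf)
  qed
  have "(transpose (Jac x q) ** Jac n q) $ i $ j = (Jac n q *v ?e j) \<bullet> (Jac x q *v ?e i)" for i j
    by (simp add: matrix_vector_mult_basis matrix_matrix_mult_def transpose_def column_def inner_vec_def mult.commute)
  then have "(transpose (Jac x q) ** Jac n q) $ i $ j = (transpose (Jac x q) ** Jac n q) $ j $ i" for i j
    using key comm by metis
  then show ?thesis
    by (simp add: second_form_def transpose_def[of "- _"] vec_eq_iff)
qed

end

section \<open>Extension of the shape operator\<close>

context framed_map
begin

lemma first_form_eq: "q \<in> U \<Longrightarrow> first_form x q = transpose (L q) ** G q ** L q"
  by (simp add: first_form_def Jac_x G_def matrix_transpose_mul matrix_mul_assoc)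

lemma second_form_eq: "q \<in> U \<Longrightarrow> second_form x \<Omega> q = - (transpose (L q) ** G q ** M q)"
  by (simp add: second_form_def Jac_x Jac_n G_def matrix_transpose_mul matrix_mul_assoc)

text \<open>
  At a regular point, this is the second fundamental form with respect to the columns of \<open>\<Omega> q\<close>: by
  \<open>S_L\<close> and \<open>second_form_eq\<close>, pulling it back along \<open>L q\<close> gives \<open>second_form x \<Omega> q\<close>.
\<close>

definition S :: "real^2 \<Rightarrow> real^2^2" where "S q = - (G q ** M q ** matrix_inv (L q))"

lemma S_L:
  assumes "det (L q) \<noteq> 0"
  shows "S q ** L q = - (G q ** M q)"
proof -
  have "S q ** L q = - (G q ** M q ** (matrix_inv (L q) ** L q))"
    by (simp add: S_def matrix_mul_assoc)
  then show ?thesis using matrix_inv_2_inverse(2)[OF assms] by simp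
qed

lemma S_symmetric:
  assumes "q \<in> U" and det: "det (L q) \<noteq> 0"
  shows "transpose (S q) = S q"
proof -
  let ?P = "matrix_inv (L q)"
  have "transpose ?P ** transpose (L q) = mat 1"
    by (simp add: matrix_transpose_mul[symmetric] matrix_inv_2_inverse[OF det] transpose_mat)
  then have "S q = transpose ?P ** (transpose (L q) ** S q ** L q) ** ?P"
    by (metis matrix_inv_2_inverse(1)[OF det] matrix_mul_assoc matrix_mul_lid matrix_mul_rid)
  also have "transpose (L q) ** S q ** L q = transpose (L q) ** (S q ** L q)"
    by (simp add: matrix_mul_assoc)
  also have "\<dots> = second_form x \<Omega> q"
    by (simp add: S_L[OF det] second_form_eq[OF assms(1)] matrix_mul_assoc)
  finally have S: "S q = transpose ?P ** second_form x \<Omega> q ** ?P" .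
  show ?thesis
    by (subst (1 2) S) (simp only: matrix_transpose_mul transpose_transpose second_form_symmetric[OF assms(1)] matrix_mul_assoc)
qed

text \<open>
  In the variable \<open>\<omega> = L q *v \<zeta>\<close> the normal curvature is a quotient of quadratic forms whose
  denominator does not degenerate at the singularities.
\<close>

lemma normal_curvature_S:
  assumes "q \<in> U" and det: "det (L q) \<noteq> 0" and "\<omega> \<noteq> 0"
  shows "normal_curvature x \<Omega> q (matrix_inv (L q) *v \<omega>) * (\<omega> \<bullet> (G q *v \<omega>)) = \<omega> \<bullet> (S q *v \<omega>)"
proof -
  define \<zeta> where "\<zeta> = matrix_inv (L q) *v \<omega>"
  have L\<zeta>: "L q *v \<zeta> = \<omega>"
    by (simp add: \<zeta>_def matrix_vector_mul_assoc matrix_inv_2_inverse[OF det])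
  have "\<zeta> \<bullet> (first_form x q *v \<zeta>) = \<omega> \<bullet> (G q *v \<omega>)"
    by (simp only: first_form_eq[OF assms(1)] matrix_vector_mul_assoc[symmetric] inner_transpose_mult L\<zeta>)
  moreover have "\<zeta> \<bullet> (second_form x \<Omega> q *v \<zeta>) = \<omega> \<bullet> (S q *v \<omega>)"
  proof -
    have "second_form x \<Omega> q = transpose (L q) ** (S q ** L q)"
      by (simp add: S_L[OF det] second_form_eq[OF assms(1)] matrix_mul_assoc)
    then show ?thesis
      by (simp only: matrix_vector_mul_assoc[symmetric] inner_transpose_mult L\<zeta>)
  qed
  moreover have "\<omega> \<bullet> (G q *v \<omega>) \<noteq> 0"
    using frame_inj[OF assms(1)] assms(3) by (metis frame_inner inner_eq_zero_iff)
  ultimately show ?thesis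
    unfolding \<zeta>_def[symmetric] normal_curvature_def by simp
qed

text \<open>
  The extended normal curvature provides values of the quadratic form of \<open>S\<close>, hence by polarization a
  smooth extension \<open>T\<close> of \<open>S\<close> itself, and \<open>A = matrix_inv G ** T\<close>. All equations hold at regular points by
  linear algebra and extend to \<open>U\<close> because the regular points are dense.
\<close>

theorem smooth_shape_operator:
  assumes ext: "normal_curvature_extends U x \<Omega>" and proper: "interior (singular_set U x) = {}"
  obtains A where "smooth_on U A"
    and "\<And>q. q \<in> U \<Longrightarrow> M q = - (A q ** L q)"
    and "\<And>q. q \<in> U \<Longrightarrow> gauss_curvature_ext U x \<Omega> q = det (A q)"
    and "\<And>q. q \<in> U \<Longrightarrow> mean_curvature_ext U x \<Omega> q = trace (A q) / 2"
    and "\<And>q. q \<in> U \<Longrightarrow> 4 * det (A q) \<le> (trace (A q))\<^sup>2"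
proof -
  let ?R = "U - singular_set U x"
  have R: "q \<in> U" "det (L q) \<noteq> 0" if "q \<in> ?R" for q using that regular_iff[of q] by auto
  have dense: "interior (U - ?R) = {}"
  proof -
    have "U - ?R = singular_set U x" by (auto simp: singular_set_def)
    then show ?thesis using proper by simp
  qed
  obtain k where smooth_k: "smooth_on (U \<times> (UNIV - {0})) k"
    and k: "\<And>q \<omega>. q \<in> ?R \<Longrightarrow> \<omega> \<noteq> 0 \<Longrightarrow> k (q, \<omega>) = normal_curvature x \<Omega> q (matrix_inv (L q) *v \<omega>)"
    using ext unfolding normal_curvature_extends_def smooth_extension_of_def L_def by fastforce
  define b where "b q e = k (q, e) * (e \<bullet> (G q *v e))" for q e
  have smooth_b: "smooth_on U (\<lambda>q. b q e)" if "e \<noteq> 0" for e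
  proof -
    have "smooth_on U (\<lambda>q. k (q, e))"
      by (rule smooth_on_compose[where f = "\<lambda>q. (q, e)" and g = k, OF open_U _ _ _ smooth_k])
        (use that in \<open>auto intro!: open_Times open_U smooth_on_Pair smooth_on_const
          smooth_on_bounded_linear[OF bounded_linear_ident]\<close>)
    then show ?thesis
      unfolding b_def by (intro smooth_on_mult smooth_on_inner smooth_on_const smooth_on_matrix_vector_mult smooth_G open_U)
  qed
  have b: "b q e = e \<bullet> (S q *v e)" if "q \<in> ?R" "e \<noteq> 0" for q e
    unfolding b_def k[OF that] by (rule normal_curvature_S[OF R[OF that(1)] that(2)])
  let ?e = "\<lambda>i. axis i 1 :: real^2"
  define T where "T q = (\<chi> i j. if i = j then b q (?e i)
    else (b q (?e 1 + ?e 2) - b q (?e 1) - b q (?e 2)) / 2)" for q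
  have ne: "?e i \<noteq> 0" "?e 1 + ?e 2 \<noteq> 0" for i
    by (auto simp: axis_def vec_eq_iff)
  have smooth_T: "smooth_on U T"
  proof (rule smooth_on_matrixI[OF open_U])
    fix i j :: 2
    show "smooth_on U (\<lambda>q. T q $ i $ j)"
      by (cases "i = j") (simp_all add: T_def, (intro smooth_on_divide smooth_on_diff smooth_on_const smooth_b ne open_U; simp)+)
  qed
  have T_sym: "transpose (T q) = T q" for q
    by (simp add: T_def transpose_def vec_eq_iff)
  have TS: "T q = S q" if "q \<in> ?R" for q
    unfolding T_def b[OF that ne(1)] b[OF that ne(2)]
    by (rule quadratic_form_matrix2[OF S_symmetric[OF R[OF that]], symmetric])
  define A where "A q = matrix_inv (G q) ** T q" for q
  have smooth_A: "smooth_on U A"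
    unfolding A_def[abs_def] by (intro smooth_on_matrix_mult smooth_inv_G smooth_T open_U)
  have MR: "M q = - (A q ** L q)" if "q \<in> ?R" for q
  proof -
    have "A q ** L q = matrix_inv (G q) ** (S q ** L q)"
      by (simp add: A_def TS[OF that] matrix_mul_assoc)
    also have "\<dots> = - ((matrix_inv (G q) ** G q) ** M q)"
      by (simp add: S_L[OF R(2)[OF that]] matrix_mul_assoc)
    finally show ?thesis using det_G_pos[OF R(1)[OF that]] by (simp add: matrix_inv_2_inverse)
  qed
  show thesis
  proof (rule that[OF smooth_A])
    fix q assume q: "q \<in> U"
    show "M q = - (A q ** L q)"
    proof (rule smooth_extension_unique[OF open_U dense _ _ q])
      show "smooth_extension_of U ?R M M"
        using smooth_M by (simp add: smooth_extension_of_def)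
      show "smooth_extension_of U ?R M (\<lambda>q. - (A q ** L q))"
        unfolding smooth_extension_of_def
        using MR smooth_on_uminus[OF open_U smooth_on_matrix_mult[OF open_U smooth_A smooth_L]] by auto
    qed
    have ext_eq: "smooth_extension U ?R f q = g q" if g: "smooth_on U g" "\<And>q. q \<in> ?R \<Longrightarrow> f q = g q" for f g :: "real^2 \<Rightarrow> real"
    proof (rule smooth_extension_unique[OF open_U dense _ _ q])
      show "smooth_extension_of U ?R f g" using g by (simp add: smooth_extension_of_def)
      then show "smooth_extension_of U ?R f (smooth_extension U ?R f)"
        unfolding smooth_extension_def by (rule someI[of "smooth_extension_of U ?R f"])
    qed
    show "gauss_curvature_ext U x \<Omega> q = det (A q)"
      unfolding gauss_curvature_ext_def
    proof (rule ext_eq[OF smooth_on_det2x2[OF open_U smooth_A]])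
      fix r assume r: "r \<in> ?R"
      have "second_form x \<Omega> r = transpose (L r) ** G r ** A r ** L r"
        by (simp add: second_form_eq[OF R(1)[OF r]] MR[OF r] matrix_mul_assoc)
      then show "gauss_curvature x \<Omega> r = det (A r)"
        using R[OF r] det_G_pos[OF R(1)[OF r]]
        by (simp add: gauss_curvature_def first_form_eq det_mul)
    qed
    show "mean_curvature_ext U x \<Omega> q = trace (A q) / 2"
      unfolding mean_curvature_ext_def
    proof (rule ext_eq)
      show "smooth_on U (\<lambda>q. trace (A q) / 2)"
        by (intro smooth_on_divide smooth_on_trace smooth_A smooth_on_const open_U) simp
      fix r assume r: "r \<in> ?R"
      note LL = matrix_inv_2_inverse[OF R(2)[OF r]]
      have GG: "matrix_inv (G r) ** G r = mat 1" "G r ** matrix_inv (G r) = mat 1"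
        using det_G_pos[OF R(1)[OF r]] by (simp_all add: matrix_inv_2_inverse)
      have tL: "transpose (L r) ** transpose (matrix_inv (L r)) = mat 1"
        by (simp add: matrix_transpose_mul[symmetric] LL transpose_mat)
      have inv: "matrix_inv (first_form x r) = matrix_inv (L r) ** matrix_inv (G r) ** transpose (matrix_inv (L r))"
      proof (rule matrix_inv_eq)
        show "first_form x r ** (matrix_inv (L r) ** matrix_inv (G r) ** transpose (matrix_inv (L r))) = mat 1"
          unfolding first_form_eq[OF R(1)[OF r]] by (metis LL(1) GG(2) tL matrix_mul_assoc matrix_mul_rid)
      qed
      have "second_form x \<Omega> r = transpose (L r) ** (G r ** A r ** L r)"
        by (simp add: second_form_eq[OF R(1)[OF r]] MR[OF r] matrix_mul_assoc)
      then have "trace (second_form x \<Omega> r ** matrix_inv (first_form x r))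
        = trace (transpose (L r) ** (G r ** A r ** (L r ** matrix_inv (L r)) ** matrix_inv (G r) ** transpose (matrix_inv (L r))))"
        by (simp only: inv matrix_mul_assoc)
      also have "\<dots> = trace (G r ** (A r ** matrix_inv (G r)) ** (transpose (matrix_inv (L r)) ** transpose (L r)))"
        by (subst trace_mul_sym) (simp only: LL matrix_mul_assoc matrix_mul_rid)
      also have "\<dots> = trace (G r ** (A r ** matrix_inv (G r)))"
        using tL matrix_left_right_inverse[of "transpose (L r)"] by simp
      also have "\<dots> = trace (A r ** (matrix_inv (G r) ** G r))"
        by (subst trace_mul_sym) (simp only: matrix_mul_assoc)
      finally show "mean_curvature x \<Omega> r = trace (A r) / 2"
        by (simp add: mean_curvature_def GG)
    qed
    have "A q = (1 / det (G q)) *\<^sub>R (adj2 (G q) ** T q)"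
      using det_G_pos[OF q] by (simp add: A_def matrix_inv_2 vec_eq_iff matrix_matrix_mult_def sum_2 field_simps)
    moreover have "0 < G q $ 1 $ 1"
    proof -
      have "G q $ 1 $ 1 = (\<Omega> q *v axis 1 1) \<bullet> (\<Omega> q *v axis 1 1)"
        unfolding frame_inner by (simp add: matrix_vector_mult_def inner_vec_def sum_2 axis_def)
      moreover have "\<Omega> q *v axis 1 1 \<noteq> 0" using frame_inj[OF q] ne(1) by blast
      ultimately show ?thesis by simp
    qed
    ultimately show "4 * det (A q) \<le> (trace (A q))\<^sup>2"
      using discriminant_nonneg[OF G_sym T_sym det_G_pos[OF q]] det_G_pos[OF q]
      by (simp add: det_scaleR_2 trace_def sum_2 power2_eq_square field_simps)
  qed
qed

end

section \<open>Gaussian lines of curvature\<close>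

context framed_map
begin

text \<open>
  In the frame, the velocity of \<open>x \<circ> \<gamma>\<close> has the coordinates \<open>L \<gamma>'\<close> and that of \<open>n \<circ> \<gamma>\<close> the coordinates
  \<open>- A (L \<gamma>')\<close>. They are proportional when \<open>L \<gamma>'\<close> is an eigenvector of \<open>A\<close>, and both vanish when
  \<open>L \<gamma>' = 0\<close>.
\<close>

lemma principal_curve_gaussian_line:
  assumes A: "\<And>q. q \<in> U \<Longrightarrow> M q = - (A q ** L q)"
    and "open J" "is_interval J" "smooth_on J \<gamma>" and \<gamma>U: "\<And>t. t \<in> J \<Longrightarrow> \<gamma> t \<in> U"
    and \<gamma>: "\<And>t. t \<in> J \<Longrightarrow> (\<gamma> has_vector_derivative v t) (at t)"
    and eig: "\<And>t. t \<in> J \<Longrightarrow> A (\<gamma> t) *v (L (\<gamma> t) *v v t) = k t *\<^sub>R (L (\<gamma> t) *v v t)"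
  shows "gaussian_line_of_curvature U x \<Omega> J \<gamma>"
  unfolding gaussian_line_of_curvature_def
proof (intro conjI exI[of _ "\<lambda>t. - k t"] ballI)
  fix t assume t: "t \<in> J"
  have chain: "vector_derivative (f \<circ> \<gamma>) (at t) = Jac f (\<gamma> t) *v v t" if f: "smooth_on U f" for f
  proof -
    have "f differentiable (at (\<gamma> t))" by (rule smooth_on_differentiable[OF f \<gamma>U[OF t]])
    then have d: "(f has_derivative (\<lambda>h. Jac f (\<gamma> t) *v h)) (at (\<gamma> t))" using jacobian_works by blast
    have "((\<lambda>t. f (\<gamma> t)) has_vector_derivative Jac f (\<gamma> t) *v v t) (at t)"
      using has_derivative_compose[OF \<gamma>[OF t, unfolded has_vector_derivative_def] d]
      by (simp add: has_vector_derivative_def matrix_vector_mult_scaleR)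
    then show ?thesis by (simp add: o_def vector_derivative_at)
  qed
  have neg: "(- B) *v w = - (B *v w)" for B :: "real^2^3" and w
    by (simp add: matrix_vector_mult_def vec_eq_iff sum_negf)
  have "Jac n (\<gamma> t) *v v t = - (\<Omega> (\<gamma> t) *v (A (\<gamma> t) *v (L (\<gamma> t) *v v t)))"
    by (simp add: Jac_n[OF \<gamma>U[OF t]] A[OF \<gamma>U[OF t]] matrix_vector_mul_assoc matrix_mul_assoc neg)
  also have "\<dots> = - k t *\<^sub>R (\<Omega> (\<gamma> t) *v (L (\<gamma> t) *v v t))"
    by (simp add: eig[OF t] matrix_vector_mult_scaleR)
  also have "\<dots> = - k t *\<^sub>R (Jac x (\<gamma> t) *v v t)"
    by (simp add: Jac_x[OF \<gamma>U[OF t]] matrix_vector_mul_assoc)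
  finally show "vector_derivative (n \<circ> \<gamma>) (at t) = - k t *\<^sub>R vector_derivative (x \<circ> \<gamma>) (at t)"
    by (simp only: chain[OF smooth_n] chain[OF smooth_x])
qed (use assms in auto)

end

text \<open>
  Along a flow line of \<open>D X\<close> the factor \<open>D\<close> satisfies a homogeneous linear differential inequality, so
  for a short time it stays comparable to its initial value. The speed, and with it the
  displacement, is then bounded by a multiple of that value.
\<close>

lemma degenerate_flow_displacement:
  fixes X :: "'e::real_normed_vector \<Rightarrow> 'e" and D :: "'e \<Rightarrow> real"
  assumes \<delta>: "0 \<le> \<delta>" and B: "0 \<le> B" "B * \<delta> \<le> 1/2"
    and D: "\<And>z. z \<in> K \<Longrightarrow> (D has_derivative D' z) (at z)"
    and D'X: "\<And>z. z \<in> K \<Longrightarrow> \<bar>D' z (X z)\<bar> \<le> B" and m: "\<And>z. z \<in> K \<Longrightarrow> norm (X z) \<le> m"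
    and \<gamma>K: "\<And>s. s \<in> {-\<delta>..\<delta>} \<Longrightarrow> \<gamma> s \<in> K"
    and \<gamma>: "\<And>s. s \<in> {-\<delta>..\<delta>} \<Longrightarrow> (\<gamma> has_vector_derivative D (\<gamma> s) *\<^sub>R X (\<gamma> s)) (at s)"
    and t: "t \<in> {-\<delta>..\<delta>}"
  shows "\<bar>D (\<gamma> t)\<bar> \<le> 2 * \<bar>D (\<gamma> 0)\<bar>" and "norm (\<gamma> t - \<gamma> 0) \<le> 2 * m * \<delta> * \<bar>D (\<gamma> 0)\<bar>"
proof -
  have Dle: "\<bar>D (\<gamma> s)\<bar> \<le> 2 * \<bar>D (\<gamma> 0)\<bar>" if s: "s \<in> {-\<delta>..\<delta>}" for s
  proof -
    have "norm (D (\<gamma> s)) \<le> 2 * (norm (D (\<gamma> 0)) + \<delta> * 0)"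
    proof (rule short_time_estimate[OF \<delta> B order_refl _ _ s, where w = "\<lambda>s. D (\<gamma> s)"])
      fix s assume s: "s \<in> {-\<delta>..\<delta>}"
      show "((\<lambda>s. D (\<gamma> s)) has_vector_derivative D (\<gamma> s) *\<^sub>R D' (\<gamma> s) (X (\<gamma> s))) (at s)"
        using has_derivative_compose[OF \<gamma>[OF s, unfolded has_vector_derivative_def] D[OF \<gamma>K[OF s]]]
        by (simp add: has_vector_derivative_def mult.assoc linear_simps(5)[OF has_derivative_bounded_linear[OF D[OF \<gamma>K[OF s]]]])
      show "norm (D (\<gamma> s) *\<^sub>R D' (\<gamma> s) (X (\<gamma> s))) \<le> B * norm (D (\<gamma> s)) + 0"
        using mult_right_mono[OF D'X[OF \<gamma>K[OF s]], of "\<bar>D (\<gamma> s)\<bar>"] by (simp add: abs_mult mult.commute)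
    qed
    then show ?thesis by simp
  qed
  show "\<bar>D (\<gamma> t)\<bar> \<le> 2 * \<bar>D (\<gamma> 0)\<bar>" by (rule Dle[OF t])
  have m0: "0 \<le> m" using norm_ge_zero m[OF \<gamma>K[OF t]] by (rule order_trans)
  have "norm (\<gamma> t - \<gamma> 0) \<le> (2 * \<bar>D (\<gamma> 0)\<bar> * m) * norm (t - 0)"
  proof (rule differentiable_bound[of "{-\<delta>..\<delta>}"])
    show "(\<gamma> has_derivative (\<lambda>h. h *\<^sub>R (D (\<gamma> s) *\<^sub>R X (\<gamma> s)))) (at s within {-\<delta>..\<delta>})" if "s \<in> {-\<delta>..\<delta>}" for s
      using \<gamma>[OF that] unfolding has_vector_derivative_def by (rule has_derivative_at_withinI)
    show "onorm (\<lambda>h. h *\<^sub>R (D (\<gamma> s) *\<^sub>R X (\<gamma> s))) \<le> 2 * \<bar>D (\<gamma> 0)\<bar> * m" if s: "s \<in> {-\<delta>..\<delta>}" for s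
    proof (rule onorm_bound)
      have "\<bar>D (\<gamma> s)\<bar> * norm (X (\<gamma> s)) \<le> 2 * \<bar>D (\<gamma> 0)\<bar> * m"
        by (intro mult_mono Dle[OF s] m[OF \<gamma>K[OF s]]) auto
      from mult_left_mono[OF this abs_ge_zero]
      show "norm (h *\<^sub>R (D (\<gamma> s) *\<^sub>R X (\<gamma> s))) \<le> 2 * \<bar>D (\<gamma> 0)\<bar> * m * norm h" for h
        by (simp add: abs_mult mult.commute mult.left_commute)
    qed (use m0 in simp)
  qed (use t \<delta> in auto)
  also have "\<dots> \<le> (2 * \<bar>D (\<gamma> 0)\<bar> * m) * \<delta>"
    using t m0 by (intro mult_left_mono) auto
  finally show "norm (\<gamma> t - \<gamma> 0) \<le> 2 * m * \<delta> * \<bar>D (\<gamma> 0)\<bar>" by (simp add: ac_simps)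
qed

text \<open>
  The fields \<open>X1\<close> and \<open>X2\<close> become dependent where \<open>D\<close> vanishes, so closeness of the two flow lines to
  \<open>q\<close> is not enough to keep them transversal. But by \<open>degenerate_flow_displacement\<close> they stay within
  \<open>O(\<epsilon> \<bar>D q\<bar>)\<close> of \<open>q\<close>, which changes the determinant by \<open>O(\<epsilon> \<bar>D q\<bar>)\<close>, while its absolute value at \<open>q\<close>
  is bounded below by a positive multiple of \<open>\<bar>D q\<bar>\<close>.
\<close>

lemma transversal_flows:
  fixes X1 X2 :: "real^2 \<Rightarrow> real^2" and D c :: "real^2 \<Rightarrow> real"
  assumes "open N" "p \<in> N" and X1: "smooth_on N X1" and X2: "smooth_on N X2" and D: "smooth_on N D"
    and c: "continuous_on N c" "\<And>q. q \<in> N \<Longrightarrow> c q \<noteq> 0"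
    and det: "\<And>q. q \<in> N \<Longrightarrow> det2 (X1 q) (X2 q) = D q * c q"
  obtains \<epsilon> r \<phi>1 \<phi>2 where "0 < \<epsilon>" "0 < r" "ball p r \<subseteq> N"
    and "local_flow (\<lambda>q. D q *\<^sub>R X1 q) N \<epsilon> (ball p r) \<phi>1"
    and "local_flow (\<lambda>q. D q *\<^sub>R X2 q) N \<epsilon> (ball p r) \<phi>2"
    and "\<And>t q. t \<in> {-\<epsilon><..<\<epsilon>} \<Longrightarrow> q \<in> ball p r \<Longrightarrow> D (\<phi>1 (t, q)) \<noteq> 0 \<Longrightarrow>
       det2 (X1 (\<phi>1 (t, q))) (X2 (\<phi>2 (t, q))) \<noteq> 0"
proof -
  obtain R where R: "0 < R" "cball p R \<subseteq> N"
    using assms(1,2) open_contains_cball by blast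
  let ?K = "cball p R"
  have ballN: "ball p R \<subseteq> N" using R by auto
  have C1: "Ck_on (Suc 0) N f" if "smooth_on N f" for f :: "real^2 \<Rightarrow> 'b::real_normed_vector"
    using that unfolding smooth_on_def by blast
  obtain B1 where B1: "0 < B1" "\<And>z. z \<in> ?K \<Longrightarrow> norm (X1 z) \<le> B1"
      "\<And>a b. a \<in> ?K \<Longrightarrow> b \<in> ?K \<Longrightarrow> norm (X1 a - X1 b) \<le> B1 * norm (a - b)"
    using C1_bounded_and_lipschitz_on_cball[OF C1[OF X1] R(2)] by metis
  obtain B2 where B2: "0 < B2" "\<And>z. z \<in> ?K \<Longrightarrow> norm (X2 z) \<le> B2"
      "\<And>a b. a \<in> ?K \<Longrightarrow> b \<in> ?K \<Longrightarrow> norm (X2 a - X2 b) \<le> B2 * norm (a - b)"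
    using C1_bounded_and_lipschitz_on_cball[OF C1[OF X2] R(2)] by metis
  obtain BD where BD: "0 < BD" "\<And>z h. z \<in> ?K \<Longrightarrow> norm (frechet_derivative D (at z) h) \<le> BD * norm h"
    using C1_bounded_and_lipschitz_on_cball[OF C1[OF D] R(2)] by metis
  define m where "m = max B1 B2"
  have m: "0 < m" "\<And>z. z \<in> ?K \<Longrightarrow> norm (X1 z) \<le> m" "\<And>z. z \<in> ?K \<Longrightarrow> norm (X2 z) \<le> m"
    using B1(1) B1(2) B2(2) by (auto simp: m_def intro: order_trans[OF _ max.cobounded1] order_trans[OF _ max.cobounded2])
  have lip: "norm (X1 a - X1 b) \<le> m * norm (a - b)" "norm (X2 a - X2 b) \<le> m * norm (a - b)"
    if "a \<in> ?K" "b \<in> ?K" for a b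
    using B1(3)[OF that] B2(3)[OF that] mult_right_mono[of B1 m "norm (a - b)"] mult_right_mono[of B2 m "norm (a - b)"]
    by (auto simp: m_def)
  have "continuous_on ?K (\<lambda>z. \<bar>c z\<bar>)"
    by (intro continuous_intros continuous_on_subset[OF c(1) R(2)])
  then obtain z0 where z0: "z0 \<in> ?K" "\<And>z. z \<in> ?K \<Longrightarrow> \<bar>c z0\<bar> \<le> \<bar>c z\<bar>"
    using continuous_attains_inf[OF compact_cball, of p R "\<lambda>z. \<bar>c z\<bar>"] R(1) by auto
  define c0 where "c0 = \<bar>c z0\<bar>"
  have c0: "0 < c0" "\<And>z. z \<in> ?K \<Longrightarrow> c0 \<le> \<bar>c z\<bar>"
    using z0 c(2)[of z0] R(2) by (auto simp: c0_def)

  have flow: "\<exists>\<epsilon> r \<phi>. 0 < \<epsilon> \<and> 0 < r \<and> local_flow (\<lambda>q. D q *\<^sub>R X q) (ball p R) \<epsilon> (ball p r) \<phi>"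
    if "smooth_on N X" for X
  proof -
    have fs: "smooth_on (ball p R) (\<lambda>q. D q *\<^sub>R X q)"
      by (intro smooth_on_subset[OF _ ballN] smooth_on_scaleR assms that)
    have "p \<in> ball p R" using R(1) by simp
    from open_ball this fs show ?thesis by (rule smooth_local_flow) blast
  qed
  obtain \<epsilon>1 r1 \<phi>1 where "0 < \<epsilon>1" "0 < r1"
    and flow1: "local_flow (\<lambda>q. D q *\<^sub>R X1 q) (ball p R) \<epsilon>1 (ball p r1) \<phi>1"
    using flow[OF X1] by blast
  obtain \<epsilon>2 r2 \<phi>2 where "0 < \<epsilon>2" "0 < r2"
    and flow2: "local_flow (\<lambda>q. D q *\<^sub>R X2 q) (ball p R) \<epsilon>2 (ball p r2) \<phi>2"
    using flow[OF X2] by blast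
  \<comment> \<open>the third entry serves for \<open>short_time_estimate\<close>, the last one makes the possible change
      \<open>8 * m ^ 3 * \<epsilon> * \<bar>D q\<bar>\<close> of the determinant smaller than \<open>c0 * \<bar>D q\<bar>\<close>\<close>
  define \<epsilon> where "\<epsilon> = Min {\<epsilon>1, \<epsilon>2, 1 / (2 * (BD * m)), c0 / (9 * m ^ 3)}"
  define r where "r = Min {r1, r2, R}"
  have \<epsilon>: "0 < \<epsilon>" "\<epsilon> \<le> \<epsilon>1" "\<epsilon> \<le> \<epsilon>2" "BD * m * \<epsilon> \<le> 1/2" "8 * m ^ 3 * \<epsilon> < c0"
  proof -
    show "0 < \<epsilon>" "\<epsilon> \<le> \<epsilon>1" "\<epsilon> \<le> \<epsilon>2" using \<open>0 < \<epsilon>1\<close> \<open>0 < \<epsilon>2\<close> BD(1) m(1) c0(1) by (simp_all add: \<epsilon>_def)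
    have "\<epsilon> \<le> 1 / (2 * (BD * m))" by (simp add: \<epsilon>_def)
    then show "BD * m * \<epsilon> \<le> 1/2" using BD(1) m(1) by (simp add: pos_le_divide_eq algebra_simps)
    have "\<epsilon> \<le> c0 / (9 * m ^ 3)" by (simp add: \<epsilon>_def)
    then have "9 * (m ^ 3 * \<epsilon>) \<le> c0" using m(1) by (simp add: pos_le_divide_eq algebra_simps)
    moreover have "0 < m ^ 3 * \<epsilon>" using m(1) \<open>0 < \<epsilon>\<close> by simp
    ultimately show "8 * m ^ 3 * \<epsilon> < c0" by linarith
  qed
  have r: "0 < r" "r \<le> r1" "r \<le> r2" "r \<le> R" using \<open>0 < r1\<close> \<open>0 < r2\<close> R(1) by (simp_all add: r_def)
  have Q: "ball p r \<subseteq> ball p r1" "ball p r \<subseteq> ball p r2" "ball p r \<subseteq> ball p R" using r by auto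
  note f1 = local_flow_restrict[OF flow1 \<epsilon>(2) Q(1) order_refl]
    and f2 = local_flow_restrict[OF flow2 \<epsilon>(3) Q(2) order_refl]
  have disp: "\<bar>D (\<phi> (t, q))\<bar> \<le> 2 * \<bar>D q\<bar> \<and> norm (\<phi> (t, q) - q) \<le> 2 * m * \<epsilon> * \<bar>D q\<bar>"
    if X: "\<And>z. z \<in> ?K \<Longrightarrow> norm (X z) \<le> m" and t: "t \<in> {-\<epsilon><..<\<epsilon>}" and q: "q \<in> ball p r"
      and \<phi>: "local_flow (\<lambda>q. D q *\<^sub>R X q) (ball p R) \<epsilon> (ball p r) \<phi>"
    for X :: "real^2 \<Rightarrow> real^2" and \<phi> t q
  proof -
    have sub: "{- \<bar>t\<bar>..\<bar>t\<bar>} \<subseteq> {-\<epsilon><..<\<epsilon>}" using t by auto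
    have B: "0 \<le> BD * m" "BD * m * \<bar>t\<bar> \<le> 1/2"
    proof -
      show "0 \<le> BD * m" using BD(1) m(1) by simp
      then have "BD * m * \<bar>t\<bar> \<le> BD * m * \<epsilon>" by (rule mult_left_mono[rotated]) (use t in auto)
      then show "BD * m * \<bar>t\<bar> \<le> 1/2" using \<epsilon>(4) by linarith
    qed
    have D': "\<bar>frechet_derivative D (at z) (X z)\<bar> \<le> BD * m" if "z \<in> ?K" for z
      using order_trans[OF BD(2)[OF that, of "X z"] mult_left_mono[OF X[OF that] less_imp_le[OF BD(1)]]] by simp
    have dD: "(D has_derivative frechet_derivative D (at z)) (at z)" if "z \<in> ?K" for z
      by (rule smooth_on_has_derivative[OF D]) (use R(2) that in auto)
    have \<gamma>: "\<phi> (s, q) \<in> ?K" if "s \<in> {- \<bar>t\<bar>..\<bar>t\<bar>}" for s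
      using local_flowD(3)[OF \<phi> subsetD[OF sub that] q] by auto
    have tt: "t \<in> {- \<bar>t\<bar>..\<bar>t\<bar>}" by auto
    note est = degenerate_flow_displacement[where \<gamma> = "\<lambda>t. \<phi> (t, q)", OF abs_ge_zero B dD D' X \<gamma>
      local_flowD(4)[OF \<phi> subsetD[OF sub] q] tt]
    have "norm (\<phi> (t, q) - q) \<le> 2 * m * \<bar>t\<bar> * \<bar>D q\<bar>" using est(2) by (simp add: local_flowD(2)[OF \<phi> q])
    also have "\<dots> \<le> 2 * m * \<epsilon> * \<bar>D q\<bar>"
      by (intro mult_right_mono mult_left_mono) (use t m(1) in auto)
    finally show ?thesis using est(1) by (simp add: local_flowD(2)[OF \<phi> q])
  qed
  show thesis
  proof (rule that[of \<epsilon> r \<phi>1 \<phi>2])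
    show "ball p r \<subseteq> N" using Q(3) ballN by (rule order_trans)
    show "local_flow (\<lambda>q. D q *\<^sub>R X1 q) N \<epsilon> (ball p r) \<phi>1" "local_flow (\<lambda>q. D q *\<^sub>R X2 q) N \<epsilon> (ball p r) \<phi>2"
      using local_flow_restrict[OF f1 order_refl order_refl ballN]
        local_flow_restrict[OF f2 order_refl order_refl ballN] .
    fix t q assume t: "t \<in> {-\<epsilon><..<\<epsilon>}" and q: "q \<in> ball p r" and D0: "D (\<phi>1 (t, q)) \<noteq> 0"
    let ?a = "\<phi>1 (t, q)" and ?b = "\<phi>2 (t, q)"
    have a: "\<bar>D ?a\<bar> \<le> 2 * \<bar>D q\<bar>" "norm (?a - q) \<le> 2 * m * \<epsilon> * \<bar>D q\<bar>"
      using disp[OF m(2) t q f1] by auto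
    have b: "norm (?b - q) \<le> 2 * m * \<epsilon> * \<bar>D q\<bar>"
      using disp[OF m(3) t q f2] by auto
    have K: "?a \<in> ?K" "?b \<in> ?K" "q \<in> ?K"
      using local_flowD(3)[OF f1 t q] local_flowD(3)[OF f2 t q] subsetD[OF Q(3) q] by auto
    have Dq: "0 < \<bar>D q\<bar>" using a(1) D0 by auto
    have X1d: "norm (X1 ?a - X1 q) \<le> m * (2 * m * \<epsilon> * \<bar>D q\<bar>)"
      using lip(1)[OF K(1,3)] mult_left_mono[OF a(2), of m] m(1) by linarith
    have X2d: "norm (X2 ?b - X2 q) \<le> m * (2 * m * \<epsilon> * \<bar>D q\<bar>)"
      using lip(2)[OF K(2,3)] mult_left_mono[OF b, of m] m(1) by linarith
    have nn: "0 \<le> m * (2 * m * \<epsilon> * \<bar>D q\<bar>)" using m(1) \<epsilon>(1) by simp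
    have "\<bar>det2 (X1 ?a) (X2 ?b) - det2 (X1 q) (X2 q)\<bar>
        \<le> \<bar>det2 (X1 ?a - X1 q) (X2 ?b)\<bar> + \<bar>det2 (X1 q) (X2 ?b - X2 q)\<bar>"
      unfolding det2_diff by (rule abs_triangle_ineq)
    also have "\<dots> \<le> 2 * (norm (X1 ?a - X1 q) * norm (X2 ?b)) + 2 * (norm (X1 q) * norm (X2 ?b - X2 q))"
      by (intro add_mono abs_det2_le)
    also have "\<dots> \<le> 2 * (m * (2 * m * \<epsilon> * \<bar>D q\<bar>) * m) + 2 * (m * (m * (2 * m * \<epsilon> * \<bar>D q\<bar>)))"
      by (intro add_mono mult_left_mono mult_mono X1d X2d m(2,3) K nn) (use m(1) in auto)
    also have "\<dots> = (8 * m ^ 3 * \<epsilon>) * \<bar>D q\<bar>"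
      by (simp add: power3_eq_cube)
    also have "\<dots> < c0 * \<bar>D q\<bar>" by (rule mult_strict_right_mono[OF \<epsilon>(5) Dq])
    also have "\<dots> \<le> \<bar>det2 (X1 q) (X2 q)\<bar>"
      using mult_right_mono[OF c0(2)[OF K(3)], of "\<bar>D q\<bar>"] det[OF subsetD[OF R(2) K(3)]] by (simp add: abs_mult mult.commute)
    finally show "det2 (X1 ?a) (X2 ?b) \<noteq> 0" by auto
  qed (use \<epsilon> r in auto)
qed

theorem theorem5p3:
  fixes U :: "(real^2) set" and x :: "real^2 \<Rightarrow> real^3" and \<Omega> :: "real^2 \<Rightarrow> real^2^3" and p :: "real^2"
  assumes "open U"
    and "proper_frontal U x"
    and "tangent_moving_basis U x \<Omega>"
    and "normal_curvature_extends U x \<Omega>"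
    and "p \<in> singular_set U x"
    and "principal_curvature_ext_minus U x \<Omega> p \<noteq> principal_curvature_ext_plus U x \<Omega> p"
  shows "\<exists>(J :: real set) (U1 :: (real^2) set) (U2 :: (real^2) set)
            (\<phi>1 :: real \<times> (real^2) \<Rightarrow> real^2) (\<phi>2 :: real \<times> (real^2) \<Rightarrow> real^2).
      open J \<and> is_interval J \<and> 0 \<in> J \<and>
      open U1 \<and> open U2 \<and> p \<in> U1 \<and> U1 \<subseteq> U2 \<and> U2 \<subseteq> U \<and>
      \<phi>1 ` (J \<times> U1) \<subseteq> U2 \<and> \<phi>2 ` (J \<times> U1) \<subseteq> U2 \<and>
      smooth_on (J \<times> U1) \<phi>1 \<and> smooth_on (J \<times> U1) \<phi>2 \<and>
      (\<forall>q\<in>U1. \<phi>1 (0, q) = q \<and> \<phi>2 (0, q) = q) \<and>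
      (\<forall>q\<in>U1. gaussian_line_of_curvature U x \<Omega> J (\<lambda>t. \<phi>1 (t, q)) \<and>
               gaussian_line_of_curvature U x \<Omega> J (\<lambda>t. \<phi>2 (t, q))) \<and>
      (\<forall>q\<in>U1. \<forall>t0\<in>J.
         (\<phi>1 (t0, q) \<in> U - singular_set U x \<longrightarrow>
            vector_derivative (\<lambda>t. \<phi>1 (t, q)) (at t0) \<noteq> 0) \<and>
         (\<phi>2 (t0, q) \<in> U - singular_set U x \<longrightarrow>
            vector_derivative (\<lambda>t. \<phi>2 (t, q)) (at t0) \<noteq> 0) \<and>
         (\<phi>1 (t0, q) \<in> U - singular_set U x \<and> \<phi>2 (t0, q) \<in> U - singular_set U x \<longrightarrow>
            lin_indep_pair (vector_derivative (\<lambda>t. \<phi>1 (t, q)) (at t0))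
                           (vector_derivative (\<lambda>t. \<phi>2 (t, q)) (at t0))))"
proof -
  interpret framed_map U x \<Omega>
    using assms(1-3) by unfold_locales (simp_all add: proper_frontal_def frontal_def)
  have pU: "p \<in> U" using assms(5) by (simp add: singular_set_def)
  obtain A where smooth_A: "smooth_on U A" and MA: "\<And>q. q \<in> U \<Longrightarrow> M q = - (A q ** L q)"
    and gauss: "gauss_curvature_ext U x \<Omega> p = det (A p)" and mean: "mean_curvature_ext U x \<Omega> p = trace (A p) / 2"
    and disc: "4 * det (A p) \<le> (trace (A p))\<^sup>2"
    using smooth_shape_operator[OF assms(4)] assms(2) pU unfolding proper_frontal_def by metis
  \<comment> \<open>the two principal curvatures differ by twice the square root of this discriminant\<close>
  have "(trace (A p) / 2)\<^sup>2 - det (A p) \<noteq> 0"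
    using assms(6) by (auto simp: principal_curvature_ext_minus_def principal_curvature_ext_plus_def gauss mean)
  then have "4 * det (A p) < (trace (A p))\<^sup>2"
    using disc by (simp add: power_divide)
  from smooth_eigenvectors[OF assms(1) pU smooth_A this]
  obtain N k1 k2 \<omega>1 \<omega>2 where N: "open N" "p \<in> N" "N \<subseteq> U"
    and \<omega>: "smooth_on N \<omega>1" "smooth_on N \<omega>2"
    and eig: "\<And>q. q \<in> N \<Longrightarrow> A q *v \<omega>1 q = k1 q *\<^sub>R \<omega>1 q" "\<And>q. q \<in> N \<Longrightarrow> A q *v \<omega>2 q = k2 q *\<^sub>R \<omega>2 q"
    and indep: "\<And>q. q \<in> N \<Longrightarrow> det2 (\<omega>1 q) (\<omega>2 q) \<noteq> 0"
    by metis
  define D where "D q = det (L q)" for q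
  \<comment> \<open>the adjugate inverts \<open>L q\<close> up to the factor \<open>D q\<close> and stays smooth at the singularities\<close>
  define X1 where "X1 q = adj2 (L q) *v \<omega>1 q" for q
  define X2 where "X2 q = adj2 (L q) *v \<omega>2 q" for q
  have LN: "smooth_on N L" by (rule smooth_on_subset[OF smooth_L N(3)])
  have smooth_X: "smooth_on N X1" "smooth_on N X2"
    unfolding X1_def[abs_def] X2_def[abs_def]
    by (intro smooth_on_matrix_vector_mult smooth_on_adj2 LN \<omega> N(1))+
  have smooth_D: "smooth_on N D"
    unfolding D_def[abs_def] by (intro smooth_on_det2x2 LN N(1))
  have cont: "continuous_on N (\<lambda>q. det2 (\<omega>1 q) (\<omega>2 q))"
    unfolding det2_def
    by (rule smooth_on_continuous, intro smooth_on_diff smooth_on_mult smooth_on_vec_nth \<omega> N(1))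
  have det: "det2 (X1 q) (X2 q) = D q * det2 (\<omega>1 q) (\<omega>2 q)" for q
    by (simp add: X1_def X2_def D_def det2_mult det_adj2)
  obtain \<epsilon> r \<phi>1 \<phi>2 where \<epsilon>: "0 < \<epsilon>" and r: "0 < r" "ball p r \<subseteq> N"
    and \<phi>1: "local_flow (\<lambda>q. D q *\<^sub>R X1 q) N \<epsilon> (ball p r) \<phi>1"
    and \<phi>2: "local_flow (\<lambda>q. D q *\<^sub>R X2 q) N \<epsilon> (ball p r) \<phi>2"
    and trans: "\<And>t q. t \<in> {-\<epsilon><..<\<epsilon>} \<Longrightarrow> q \<in> ball p r \<Longrightarrow> D (\<phi>1 (t, q)) \<noteq> 0 \<Longrightarrow>
       det2 (X1 (\<phi>1 (t, q))) (X2 (\<phi>2 (t, q))) \<noteq> 0"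
    using transversal_flows[OF N(1,2) smooth_X smooth_D cont indep det] by blast
  define J where "J = {-\<epsilon><..<\<epsilon>}"
  define Q where "Q = ball p r"
  note flow1 = local_flowD[OF \<phi>1, folded J_def Q_def] and flow2 = local_flowD[OF \<phi>2, folded J_def Q_def]
  have openJ: "open J" "is_interval J" "0 \<in> J" using \<epsilon> by (auto simp: J_def is_interval_oo)
  have openQ: "open Q" "p \<in> Q" "Q \<subseteq> N" using r by (auto simp: Q_def)
  have line: "gaussian_line_of_curvature U x \<Omega> J (\<lambda>t. \<phi> (t, q))"
    if q: "q \<in> Q" and X: "\<And>q. X q = adj2 (L q) *v \<omega> q" and eig: "\<And>q. q \<in> N \<Longrightarrow> A q *v \<omega> q = k q *\<^sub>R \<omega> q"
      and smooth: "smooth_on (J \<times> Q) \<phi>"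
      and \<phi>: "\<And>t. t \<in> J \<Longrightarrow> \<phi> (t, q) \<in> N"
        "\<And>t. t \<in> J \<Longrightarrow> ((\<lambda>t. \<phi> (t, q)) has_vector_derivative D (\<phi> (t, q)) *\<^sub>R X (\<phi> (t, q))) (at t)"
    for \<phi> :: "real \<times> (real^2) \<Rightarrow> real^2" and X \<omega> k q
  proof (rule principal_curve_gaussian_line[OF MA openJ(1,2) _ _ \<phi>(2)])
    show "smooth_on J (\<lambda>t. \<phi> (t, q))"
      by (rule smooth_on_compose[where f = "\<lambda>t. (t, q)" and g = \<phi>, OF openJ(1) open_Times[OF openJ(1) openQ(1)] _ _ smooth])
        (use q in \<open>auto intro!: smooth_on_Pair smooth_on_const smooth_on_bounded_linear[OF bounded_linear_ident] openJ\<close>)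
    fix t assume t: "t \<in> J"
    show "\<phi> (t, q) \<in> U" using \<phi>(1)[OF t] N(3) by blast
    have "L z *v X z = D z *\<^sub>R \<omega> z" for z
      by (simp add: X D_def matrix_vector_mul_assoc mult_adj2 scaleR_matrix_vector_assoc[symmetric])
    then show "A (\<phi> (t, q)) *v (L (\<phi> (t, q)) *v (D (\<phi> (t, q)) *\<^sub>R X (\<phi> (t, q)))) =
        k (\<phi> (t, q)) *\<^sub>R (L (\<phi> (t, q)) *v (D (\<phi> (t, q)) *\<^sub>R X (\<phi> (t, q))))"
      by (simp add: matrix_vector_mult_scaleR eig[OF \<phi>(1)[OF t]])
  qed
  have reg: "D z \<noteq> 0" "X1 z \<noteq> 0" "X2 z \<noteq> 0" if "z \<in> U - singular_set U x" "z \<in> N" for z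
  proof -
    show D: "D z \<noteq> 0" using that regular_iff[of z] by (simp add: D_def)
    then have "det2 (X1 z) (X2 z) \<noteq> 0" using det indep[OF that(2)] by simp
    then show "X1 z \<noteq> 0" "X2 z \<noteq> 0" by (auto simp: det2_def)
  qed
  have vd: "vector_derivative (\<lambda>t. \<phi>1 (t, q)) (at t) = D (\<phi>1 (t, q)) *\<^sub>R X1 (\<phi>1 (t, q))"
    "vector_derivative (\<lambda>t. \<phi>2 (t, q)) (at t) = D (\<phi>2 (t, q)) *\<^sub>R X2 (\<phi>2 (t, q))"
    if "t \<in> J" "q \<in> Q" for t q
    using flow1 flow2 that by (simp_all add: vector_derivative_at)
  have li: "lin_indep_pair (D (\<phi>1 (t, q)) *\<^sub>R X1 (\<phi>1 (t, q))) (D (\<phi>2 (t, q)) *\<^sub>R X2 (\<phi>2 (t, q)))"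
    if "t \<in> J" "q \<in> Q" "\<phi>1 (t, q) \<in> U - singular_set U x" "\<phi>2 (t, q) \<in> U - singular_set U x" for t q
  proof (rule lin_indep_pair_det2)
    have "D (\<phi>1 (t, q)) \<noteq> 0" "D (\<phi>2 (t, q)) \<noteq> 0" using reg(1) that flow1 flow2 by simp_all
    moreover have "det2 (a *\<^sub>R v) (b *\<^sub>R w) = a * b * det2 v w" for a b v w
      by (simp add: det2_def algebra_simps)
    ultimately show "det2 (D (\<phi>1 (t, q)) *\<^sub>R X1 (\<phi>1 (t, q))) (D (\<phi>2 (t, q)) *\<^sub>R X2 (\<phi>2 (t, q))) \<noteq> 0"
      using trans[of t q] that by (simp add: J_def Q_def)
  qed
  have lines: "\<forall>q\<in>Q. gaussian_line_of_curvature U x \<Omega> J (\<lambda>t. \<phi>1 (t, q)) \<and>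
      gaussian_line_of_curvature U x \<Omega> J (\<lambda>t. \<phi>2 (t, q))"
  proof (intro ballI conjI)
    fix q assume q: "q \<in> Q"
    show "gaussian_line_of_curvature U x \<Omega> J (\<lambda>t. \<phi>1 (t, q))"
      by (rule line[OF q X1_def eig(1) flow1(1)]) (use flow1 q in auto)
    show "gaussian_line_of_curvature U x \<Omega> J (\<lambda>t. \<phi>2 (t, q))"
      by (rule line[OF q X2_def eig(2) flow2(1)]) (use flow2 q in auto)
  qed
  have regular: "\<forall>q\<in>Q. \<forall>t0\<in>J.
      (\<phi>1 (t0, q) \<in> U - singular_set U x \<longrightarrow> vector_derivative (\<lambda>t. \<phi>1 (t, q)) (at t0) \<noteq> 0) \<and>
      (\<phi>2 (t0, q) \<in> U - singular_set U x \<longrightarrow> vector_derivative (\<lambda>t. \<phi>2 (t, q)) (at t0) \<noteq> 0) \<and>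
      (\<phi>1 (t0, q) \<in> U - singular_set U x \<and> \<phi>2 (t0, q) \<in> U - singular_set U x \<longrightarrow>
        lin_indep_pair (vector_derivative (\<lambda>t. \<phi>1 (t, q)) (at t0)) (vector_derivative (\<lambda>t. \<phi>2 (t, q)) (at t0)))"
  proof (intro ballI conjI impI)
    fix q t assume q: "q \<in> Q" and t: "t \<in> J"
    show "vector_derivative (\<lambda>t. \<phi>1 (t, q)) (at t) \<noteq> 0" if "\<phi>1 (t, q) \<in> U - singular_set U x"
      unfolding vd[OF t q] using reg(1,2)[OF that flow1(3)[OF t q]] by simp
    show "vector_derivative (\<lambda>t. \<phi>2 (t, q)) (at t) \<noteq> 0" if "\<phi>2 (t, q) \<in> U - singular_set U x"
      unfolding vd[OF t q] using reg(1,3)[OF that flow2(3)[OF t q]] by simp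
    show "lin_indep_pair (vector_derivative (\<lambda>t. \<phi>1 (t, q)) (at t)) (vector_derivative (\<lambda>t. \<phi>2 (t, q)) (at t))"
      if "\<phi>1 (t, q) \<in> U - singular_set U x \<and> \<phi>2 (t, q) \<in> U - singular_set U x"
      unfolding vd[OF t q] using li[OF t q] that by blast
  qed
  have start: "\<forall>q\<in>Q. \<phi>1 (0, q) = q \<and> \<phi>2 (0, q) = q"
    and range: "\<phi>1 ` (J \<times> Q) \<subseteq> N" "\<phi>2 ` (J \<times> Q) \<subseteq> N"
    using flow1(2,3) flow2(2,3) by auto
  show ?thesis
    by (rule exI[of _ J], rule exI[of _ Q], rule exI[of _ N], rule exI[of _ \<phi>1], rule exI[of _ \<phi>2])
       (intro conjI openJ openQ N range flow1(1) flow2(1) start lines regular)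
qed

end
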